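(* Let $u_0\in C_\psi$ be such that $\mathcal{E}(u_0)<\frac{c_0^2}{4}$ and let $u$ be an FVI gradient flow starting at $u_0$. Let $$M_{crit}=\{u_\infty\in C_\psi: D\mathcal{E}(u_\infty)(v-u_\infty)\ge0\ \ \forall v\in C_\psi,\ \ \mathcal{E}(u_\infty)\le\mathcal{E}(u_0)\}.$$ Then $u:[0,\infty)\to C^1([0,1])$ is fully $C^1([0,1])$-subconvergent to points in $M_{crit}$. Moreover, for each $\epsilon>0$ there exists a set $B\subset[0,\infty)$ with Lebesgue measure $|B|<\epsilon$ such that $u|_{[0,\infty)\setminus B}:[0,\infty)\setminus B\to W^{2,2}(0,1)$ is $W^{2,2}(0,1)$-subconvergent to points in $M_{crit}$.
   Context: The elastic energy is $\mathcal{E}: W^{2,2}(0,1)\cap W_0^{1,2}(0,1)\to\mathbb{R}$, $\mathcal{E}(u)=\int_0^1 \frac{u''(x)^2}{(1+u'(x)^2)^{5/2}}\,dx$, where $W^{2,2}(0,1)\cap W_0^{1,2}(0,1)$ carries the norm $\|u\|=\|u''\|_{L^2}$; $D\mathcal{E}$ denotes its Fréchet derivative. Set $c_0=\int_{\mathbb{R}}(1+t^2)^{-5/4}\,dt$. Standing assumption on the obstacle: $\psi\in C([0,1])$, $\psi(0)<0$, $\psi(1)<0$, and there is $x_0\in(0,1)$ with $\psi(x_0)>0$. Set $C_\psi=\{u\in W^{2,2}(0,1)\cap W_0^{1,2}(0,1): u\ge\psi \text{ a.e.}\}$. For a Banach space $V$, $D^{1,2}((0,\infty),V)=\{u\in W^{1,1}_{loc}((0,\infty),V):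 \dot u\in L^2((0,\infty),V)\}$, where $\dot u$ is the weak time derivative. $(\cdot,\cdot)$ is the scalar product of $L^2(0,1)$. For $u_0\in C_\psi$, a function $u\in L^\infty((0,\infty),W^{2,2}(0,1)\cap W_0^{1,2}(0,1))\cap D^{1,2}((0,\infty),L^2(0,1))$ is an FVI gradient flow (for $\mathcal{E}$, in $C_\psi$) starting at $u_0$ if: (i) $u(t)\in C_\psi$ for a.e. $t>0$; (ii) $t\mapsto\mathcal{E}(u(t))$ coincides a.e. with a nonincreasing function $\phi:[0,\infty)\to\mathbb{R}$ with $\phi(0)=\mathcal{E}(u_0)$; (iii) the unique $C([0,\infty),L^2(0,1))$-representative of $u$ satisfies $u(0)=u_0$; (iv) for a.e. $t>0$: $(\dot u(t),v-u(t))+D\mathcal{E}(u(t))(v-u(t))\ge0$ for all $v\in C_\psi$. Such a $u$ has a unique representative in $C([0,\infty),C^1([0,1]))$, with which it is always identified. Subconvergence: let $A\subset[0,\infty)$ be unbounded, $X$ a Banach space, $u:A\to X$ and $M\subset X$. Then $u$ is $X$-subconvergent to points in $M$ if each sequence $(\theta_n)\subset A$ with $\theta_n\to\infty$ has a subsequence $(\theta_{k_n})$ such that $u(\theta_{k_n})$ converges in $X$ to an element of $M$. If $A=[0,\infty)$, $u$ is called fully $X$-subconvergent to points in $M$. *)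

theory Defs
  imports "HOL-Analysis.Analysis"
begin

subsection \<open>The Hilbert space \<open>L\<^sup>2(0,1)\<close>\<close>

abbreviation unit_leb :: "real measure"
  where "unit_leb \<equiv> lebesgue_on {0<..<1}"

definition square_integrable :: "(real \<Rightarrow> real) set" where
  "square_integrable = {f \<in> borel_measurable unit_leb. integrable unit_leb (\<lambda>x. (f x)\<^sup>2)}"

lemma square_integrable_prod:
  assumes "f \<in> square_integrable" "g \<in> square_integrable"
  shows "integrable unit_leb (\<lambda>x. f x * g x)"
proof (rule Bochner_Integration.integrable_bound)
  show "integrable unit_leb (\<lambda>x. (f x)\<^sup>2 + (g x)\<^sup>2)"
    using assms by (auto simp: square_integrable_def)
  show "(\<lambda>x. f x * g x) \<in> borel_measurable unit_leb"
    using assms by (auto simp: square_integrable_def)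
  have "\<bar>a * b\<bar> \<le> \<bar>a\<^sup>2 + b\<^sup>2\<bar>" for a b :: real
    using sum_squares_bound[of "\<bar>a\<bar>" "\<bar>b\<bar>"] abs_ge_zero[of "a*b"]
    unfolding abs_mult power2_abs mult.assoc by linarith
  then show "AE x in unit_leb. norm (f x * g x) \<le> norm ((f x)\<^sup>2 + (g x)\<^sup>2)"
    by simp
qed

lemma square_integrable_add:
  assumes "f \<in> square_integrable" "g \<in> square_integrable"
  shows "(\<lambda>x. f x + g x) \<in> square_integrable"
  using assms square_integrable_prod[OF assms]
  by (auto simp: square_integrable_def power2_sum mult.assoc)

lemma square_integrable_scale:
  assumes "f \<in> square_integrable"
  shows "(\<lambda>x. c * f x) \<in> square_integrable"
  using assms by (auto simp: square_integrable_def power_mult_distrib)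

lemma square_integrable_zero: "(\<lambda>x. 0) \<in> square_integrable"
  by (auto simp: square_integrable_def)

lemma square_integrable_uminus: "f \<in> square_integrable \<Longrightarrow> (\<lambda>x. - f x) \<in> square_integrable"
  using square_integrable_scale[of f "-1"] by simp

lemma square_integrable_diff:
  "f \<in> square_integrable \<Longrightarrow> g \<in> square_integrable \<Longrightarrow> (\<lambda>x. f x - g x) \<in> square_integrable"
  using square_integrable_add[of f "\<lambda>x. - g x"] square_integrable_uminus[of g] by simp

quotient_type L2 = "real \<Rightarrow> real" / partial:
  "\<lambda>f g. f \<in> square_integrable \<and> g \<in> square_integrable \<and> (AE x in unit_leb. f x = g x)"
proof (rule part_equivpI)
  show "\<exists>f. f \<in> square_integrable \<and> f \<in> square_integrable \<and> (AE x in unit_leb. f x = f x)"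
    using square_integrable_zero by auto
  show "symp (\<lambda>f g. f \<in> square_integrable \<and> g \<in> square_integrable \<and> (AE x in unit_leb. f x = g x))"
    by (auto simp: symp_def elim: eventually_mono)
  show "transp (\<lambda>f g. f \<in> square_integrable \<and> g \<in> square_integrable \<and> (AE x in unit_leb. f x = g x))"
    by (auto simp: transp_def elim: eventually_elim2)
qed

lemma rep_L2_mem: "rep_L2 f \<in> square_integrable"
  using Quotient_rep_reflp[OF Quotient_L2, of f] by auto

lemma abs_rep_L2: "abs_L2 (rep_L2 f) = f"
  by (rule Quotient_abs_rep[OF Quotient_L2])

lemma rep_abs_L2: "f \<in> square_integrable \<Longrightarrow> AE x in unit_leb. rep_L2 (abs_L2 f) x = f x"
  using Quotient_rep_abs[OF Quotient_L2, of f] by auto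

lemma L2_eq_iff: "f = g \<longleftrightarrow> (AE x in unit_leb. rep_L2 f x = rep_L2 g x)"
  by (metis (mono_tags, lifting) Quotient_rel_rep[OF Quotient_L2] rep_L2_mem AE_I2)

lemma abs_L2_eq_iff:
  "f \<in> square_integrable \<Longrightarrow> g \<in> square_integrable \<Longrightarrow>
    abs_L2 f = abs_L2 g \<longleftrightarrow> (AE x in unit_leb. f x = g x)"
  using Quotient_rel[OF Quotient_L2] by (metis (mono_tags, lifting) AE_I2)

instantiation L2 :: real_vector
begin

lift_definition zero_L2 :: L2 is "\<lambda>x. 0" by (auto simp: square_integrable_zero)

lift_definition plus_L2 :: "L2 \<Rightarrow> L2 \<Rightarrow> L2" is "\<lambda>f g x. f x + g x"
  by (auto simp: square_integrable_add elim: eventually_elim2)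

lift_definition minus_L2 :: "L2 \<Rightarrow> L2 \<Rightarrow> L2" is "\<lambda>f g x. f x - g x"
  by (auto simp: square_integrable_diff elim: eventually_elim2)

lift_definition uminus_L2 :: "L2 \<Rightarrow> L2" is "\<lambda>f x. - f x"
  by (auto simp: square_integrable_uminus)

lift_definition scaleR_L2 :: "real \<Rightarrow> L2 \<Rightarrow> L2" is "\<lambda>c f x. c * f x"
  by (auto simp: square_integrable_scale elim: eventually_mono)

instance
proof
  fix f g h :: L2 and a b :: real
  show "f + g + h = f + (g + h)"
    by transfer (auto simp: square_integrable_add add.assoc)
  show "f + g = g + f"
    by transfer (auto simp: square_integrable_add add.commute)
  show "0 + f = f"
    by transfer (auto simp: square_integrable_add)
  show "- f + f = 0"
    by transfer (auto simp: square_integrable_zero)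
  show "f - g = f + - g"
    by transfer (auto simp: square_integrable_diff)
  show "a *\<^sub>R (f + g) = a *\<^sub>R f + a *\<^sub>R g"
    by transfer (auto simp: square_integrable_add square_integrable_scale algebra_simps)
  show "(a + b) *\<^sub>R f = a *\<^sub>R f + b *\<^sub>R f"
    by transfer (auto simp: square_integrable_add square_integrable_scale algebra_simps)
  show "a *\<^sub>R b *\<^sub>R f = (a * b) *\<^sub>R f"
    by transfer (auto simp: square_integrable_scale algebra_simps)
  show "1 *\<^sub>R f = f"
    by transfer (auto simp: square_integrable_scale)
qed

end

instantiation L2 :: real_inner
begin

lift_definition inner_L2 :: "L2 \<Rightarrow> L2 \<Rightarrow> real" is "\<lambda>f g. LINT x|unit_leb. f x * g x"
proof -
  fix f f' g g' :: "real \<Rightarrow> real"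
  assume f: "f \<in> square_integrable \<and> f' \<in> square_integrable \<and> (AE x in unit_leb. f x = f' x)"
    and g: "g \<in> square_integrable \<and> g' \<in> square_integrable \<and> (AE x in unit_leb. g x = g' x)"
  show "(LINT x|unit_leb. f x * g x) = (LINT x|unit_leb. f' x * g' x)"
  proof (rule integral_cong_AE)
    show "AE x in unit_leb. f x * g x = f' x * g' x"
      using f g by (auto elim: eventually_elim2)
  qed (use f g in \<open>auto simp: square_integrable_def\<close>)
qed

definition norm_L2 :: "L2 \<Rightarrow> real" where "norm_L2 f = sqrt (inner f f)"
definition dist_L2 :: "L2 \<Rightarrow> L2 \<Rightarrow> real" where "dist_L2 f g = norm (f - g)"
definition sgn_L2 :: "L2 \<Rightarrow> L2" where "sgn_L2 f = f /\<^sub>R norm f"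
definition uniformity_L2 :: "(L2 \<times> L2) filter"
  where "uniformity_L2 = (INF e\<in>{0<..}. principal {(f, g). dist f g < e})"
definition open_L2 :: "L2 set \<Rightarrow> bool"
  where "open_L2 S = (\<forall>f\<in>S. \<forall>\<^sub>F (f', g) in uniformity. f' = f \<longrightarrow> g \<in> S)"

instance
proof
  fix f g h :: L2 and a :: real
  show "dist f g = norm (f - g)" by (rule dist_L2_def)
  show "sgn f = f /\<^sub>R norm f" by (rule sgn_L2_def)
  show "uniformity = (INF e\<in>{0<..}. principal {(x::L2, y). dist x y < e})"
    by (rule uniformity_L2_def)
  show "open U = (\<forall>x\<in>U. \<forall>\<^sub>F (x', y) in uniformity. x' = x \<longrightarrow> y \<in> U)" for U :: "L2 set"
    by (rule open_L2_def)
  show "inner f g = inner g f"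
    by transfer (auto simp: mult.commute)
  show "inner (f + g) h = inner f h + inner g h"
    by transfer (simp add: algebra_simps square_integrable_prod)
  show "inner (a *\<^sub>R f) g = a * inner f g"
    by transfer (simp add: mult.assoc)
  show "0 \<le> inner f f"
    by transfer simp
  show "(inner f f = 0) = (f = 0)"
  proof (transfer, goal_cases)
    case (1 f)
    then have i: "integrable unit_leb (\<lambda>x. f x * f x)"
      by (auto simp: square_integrable_prod)
    then show ?case
      using 1 integral_nonneg_eq_0_iff_AE[OF i] by (auto simp: square_integrable_zero)
  qed
  show "norm f = sqrt (inner f f)" by (rule norm_L2_def)
qed

end

lemma space_unit_leb [simp]: "space unit_leb = {0<..<1}"
  by (simp add: space_restrict_space)

lemma AE_unit_leb_iff: "(AE x in unit_leb. P x) \<longleftrightarrow> (AE x in lebesgue. x \<in> {0<..<1} \<longrightarrow> P x)"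
  by (rule AE_restrict_space_iff) simp

lemma integrable_const_unit_leb [simp]: "integrable unit_leb (\<lambda>x. c :: real)"
  by (simp add: integrable_restrict_space lmeasurable_iff_integrable[symmetric])

lemma borel_measurable_unit_leb:
  assumes "f \<in> borel_measurable borel"
  shows "f \<in> borel_measurable unit_leb"
  using assms by (intro measurable_restrict_space1 measurable_completion) simp

lemma square_integrable_bounded:
  assumes "f \<in> borel_measurable unit_leb" "\<And>x. 0 < x \<Longrightarrow> x < 1 \<Longrightarrow> \<bar>f x\<bar> \<le> B"
  shows "f \<in> square_integrable"
proof -
  have "integrable unit_leb (\<lambda>x. (f x)\<^sup>2)"
  proof (rule Bochner_Integration.integrable_bound[of _ "\<lambda>x. B\<^sup>2"])
    show "AE x in unit_leb. norm ((f x)\<^sup>2) \<le> norm (B\<^sup>2)"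
      using assms(2) by (auto intro!: AE_I2 abs_le_square_iff[THEN iffD1] simp: abs_if) (smt (verit))+
  qed (use assms in auto)
  with assms show ?thesis by (auto simp: square_integrable_def)
qed

lemma square_integrable_dominated:
  assumes "f \<in> borel_measurable unit_leb" "w \<in> square_integrable"
    and "AE x in unit_leb. \<bar>f x\<bar> \<le> \<bar>w x\<bar>"
  shows "f \<in> square_integrable"
proof -
  have "integrable unit_leb (\<lambda>x. (f x)\<^sup>2)"
  proof (rule Bochner_Integration.integrable_bound[of _ "\<lambda>x. (w x)\<^sup>2"])
    show "AE x in unit_leb. norm ((f x)\<^sup>2) \<le> norm ((w x)\<^sup>2)"
      using assms(3) by eventually_elim (simp add: abs_le_square_iff)
  qed (use assms in \<open>auto simp: square_integrable_def\<close>)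
  with assms show ?thesis by (auto simp: square_integrable_def)
qed

lemma abs_L2_add:
  "f \<in> square_integrable \<Longrightarrow> g \<in> square_integrable \<Longrightarrow>
    abs_L2 f + abs_L2 g = abs_L2 (\<lambda>x. f x + g x)"
  by (rule plus_L2.abs_eq) auto

lemma abs_L2_diff:
  "f \<in> square_integrable \<Longrightarrow> g \<in> square_integrable \<Longrightarrow>
    abs_L2 f - abs_L2 g = abs_L2 (\<lambda>x. f x - g x)"
  by (rule minus_L2.abs_eq) auto

lemma abs_L2_scaleR: "f \<in> square_integrable \<Longrightarrow> c *\<^sub>R abs_L2 f = abs_L2 (\<lambda>x. c * f x)"
  by (rule scaleR_L2.abs_eq) auto

lemma inner_abs_L2:
  "f \<in> square_integrable \<Longrightarrow> g \<in> square_integrable \<Longrightarrow>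
    inner (abs_L2 f) (abs_L2 g) = (LINT x|unit_leb. f x * g x)"
  by (rule inner_L2.abs_eq) auto

lemma norm_abs_L2: "f \<in> square_integrable \<Longrightarrow> (norm (abs_L2 f))\<^sup>2 = (LINT x|unit_leb. (f x)\<^sup>2)"
  using inner_abs_L2[of f f] by (simp add: power2_norm_eq_inner power2_eq_square[of "f _"])

lemma zero_L2_eq: "0 = abs_L2 (\<lambda>x. 0)"
  by (simp add: zero_L2.abs_eq)

lemma inner_L2_rep: "inner f g = (LINT x|unit_leb. rep_L2 f x * rep_L2 g x)"
  using inner_abs_L2[OF rep_L2_mem rep_L2_mem] by (simp add: abs_rep_L2)

lemma tendsto_abs_L2_dominated:
  assumes w: "w \<in> square_integrable" and f: "f \<in> borel_measurable unit_leb"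
    and s: "\<And>n. s n \<in> borel_measurable unit_leb"
    and le: "\<And>n. AE x in unit_leb. \<bar>s n x\<bar> \<le> w x"
    and lim: "AE x in unit_leb. (\<lambda>n. s n x) \<longlonglongrightarrow> f x"
  shows "f \<in> square_integrable" "\<And>n. s n \<in> square_integrable"
    "(\<lambda>n. abs_L2 (s n)) \<longlonglongrightarrow> abs_L2 f"
proof -
  have le': "AE x in unit_leb. \<forall>n. \<bar>s n x\<bar> \<le> w x"
    using le by (simp add: AE_all_countable)
  from le' lim have fle: "AE x in unit_leb. \<bar>f x\<bar> \<le> w x"
    by eventually_elim (rule LIMSEQ_le_const2[OF tendsto_rabs], auto)
  show fs: "f \<in> square_integrable"
    using fle by (intro square_integrable_dominated[OF f w]) (auto elim: eventually_mono)
  show ss: "s n \<in> square_integrable" for n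
    using le[of n] by (intro square_integrable_dominated[OF s w]) (auto elim: eventually_mono)
  have m: "(\<lambda>x. w x * w x) \<in> borel_measurable unit_leb"
    using w by (auto simp: square_integrable_def)
  have "(\<lambda>n. LINT x|unit_leb. (s n x - f x)\<^sup>2) \<longlonglongrightarrow> (LINT x|unit_leb. 0)"
  proof (rule integral_dominated_convergence[where w = "\<lambda>x. (2 * w x)\<^sup>2"])
    show "integrable unit_leb (\<lambda>x. (2 * w x)\<^sup>2)"
      using square_integrable_scale[OF w, of 2] by (auto simp: square_integrable_def)
    show "AE x in unit_leb. (\<lambda>n. (s n x - f x)\<^sup>2) \<longlonglongrightarrow> 0"
      using lim
    proof eventually_elim
      case (elim x)
      then have "(\<lambda>n. (s n x - f x)\<^sup>2) \<longlonglongrightarrow> (f x - f x)\<^sup>2" by (intro tendsto_intros)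
      then show ?case by simp
    qed
    show "AE x in unit_leb. norm ((s n x - f x)\<^sup>2) \<le> (2 * w x)\<^sup>2" for n
      using le[of n] fle
    proof eventually_elim
      case (elim x)
      then have "\<bar>s n x - f x\<bar> \<le> \<bar>2 * w x\<bar>" by linarith
      then have "(s n x - f x)\<^sup>2 \<le> (2 * w x)\<^sup>2" by (simp only: abs_le_square_iff)
      then show ?case by (simp only: real_norm_def abs_power2)
    qed
  qed (use f s in auto)
  then have "(\<lambda>n. (norm (abs_L2 (s n) - abs_L2 f))\<^sup>2) \<longlonglongrightarrow> 0"
    using ss fs by (simp add: abs_L2_diff norm_abs_L2 square_integrable_diff)
  then have "(\<lambda>n. sqrt ((norm (abs_L2 (s n) - abs_L2 f))\<^sup>2)) \<longlonglongrightarrow> sqrt 0"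
    by (rule tendsto_real_sqrt)
  then have "(\<lambda>n. norm (abs_L2 (s n) - abs_L2 f)) \<longlonglongrightarrow> 0" by simp
  then show "(\<lambda>n. abs_L2 (s n)) \<longlonglongrightarrow> abs_L2 f"
    by (rule LIM_zero_cancel[OF tendsto_norm_zero_cancel])
qed

lemma integral_abs_le_norm:
  assumes f: "f \<in> square_integrable"
  shows "integrable unit_leb f" "(LINT x|unit_leb. \<bar>f x\<bar>) \<le> norm (abs_L2 f)"
proof -
  have 1: "(\<lambda>x. 1) \<in> square_integrable"
    by (rule square_integrable_bounded[of _ 1]) auto
  show "integrable unit_leb f"
    using square_integrable_prod[OF f 1] by simp
  have a: "(\<lambda>x. \<bar>f x\<bar>) \<in> square_integrable"
    using f by (auto simp: square_integrable_def)
  have n1: "norm (abs_L2 (\<lambda>x. 1)) = 1"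
  proof -
    have "(norm (abs_L2 (\<lambda>x. 1)))\<^sup>2 = 1"
      using norm_abs_L2[OF 1] by (simp add: measure_restrict_space)
    then show ?thesis using norm_ge_zero[of "abs_L2 (\<lambda>x. 1)"] by (auto simp: power2_eq_1_iff)
  qed
  have na: "norm (abs_L2 (\<lambda>x. \<bar>f x\<bar>)) = norm (abs_L2 f)"
    using norm_abs_L2[OF a] norm_abs_L2[OF f] by (intro power2_eq_imp_eq[OF _ norm_ge_zero norm_ge_zero]) simp
  have "(LINT x|unit_leb. \<bar>f x\<bar>) = inner (abs_L2 (\<lambda>x. \<bar>f x\<bar>)) (abs_L2 (\<lambda>x. 1))"
    using inner_abs_L2[OF a 1] by simp
  also have "\<dots> \<le> norm (abs_L2 (\<lambda>x. \<bar>f x\<bar>)) * norm (abs_L2 (\<lambda>x. 1))"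
    by (rule norm_cauchy_schwarz)
  finally show "(LINT x|unit_leb. \<bar>f x\<bar>) \<le> norm (abs_L2 f)"
    by (simp add: n1 na)
qed

instance L2 :: complete_space
proof
  fix X :: "nat \<Rightarrow> L2" assume X: "Cauchy X"
  define s where "s n = rep_L2 (X n)" for n
  have s: "s n \<in> square_integrable" for n by (simp add: s_def rep_L2_mem)
  then have sm: "s n \<in> borel_measurable unit_leb" for n by (simp add: square_integrable_def)
  have Xs: "X n = abs_L2 (s n)" for n by (simp add: s_def abs_rep_L2)
  have L1: "\<exists>N. \<forall>i\<ge>N. \<forall>j\<ge>N. (LINT x|unit_leb. norm (s i x - s j x)) < e" if "e > 0" for e
  proof -
    obtain N where N: "\<forall>i\<ge>N. \<forall>j\<ge>N. norm (X i - X j) < e"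
      using X \<open>e > 0\<close> unfolding Cauchy_def dist_norm by blast
    have "(LINT x|unit_leb. norm (s i x - s j x)) \<le> norm (X i - X j)" for i j
      using integral_abs_le_norm(2)[OF square_integrable_diff[OF s[of i] s[of j]]]
      by (simp add: Xs abs_L2_diff s)
    with N show ?thesis by (meson le_less_trans)
  qed
  obtain r where r: "strict_mono r" and C: "AE x in unit_leb. Cauchy (\<lambda>i. s (r i) x)"
    using cauchy_L1_AE_cauchy_subseq[OF integral_abs_le_norm(1)[OF s] L1] by blast
  define F where "F x = lim (\<lambda>i. s (r i) x)" for x
  have Fm: "F \<in> borel_measurable unit_leb"
    unfolding F_def using sm by (intro borel_measurable_lim_metric)
  have lim: "AE x in unit_leb. (\<lambda>i. s (r i) x) \<longlonglongrightarrow> F x"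
    using C unfolding F_def by eventually_elim (simp add: Cauchy_convergent_iff convergent_LIMSEQ_iff)
  have key: "\<exists>N. \<forall>k\<ge>N. F \<in> square_integrable \<and> norm (X k - abs_L2 F) \<le> e" if "e > 0" for e
  proof -
    obtain N where N: "\<forall>i\<ge>N. \<forall>j\<ge>N. norm (X i - X j) < e"
      using X \<open>e > 0\<close> unfolding Cauchy_def dist_norm by blast
    have "F \<in> square_integrable \<and> norm (X k - abs_L2 F) \<le> e" if k: "k \<ge> N" for k
    proof -
      have bd: "(\<integral>\<^sup>+x. ennreal ((s (r m) x - s k x)\<^sup>2) \<partial>unit_leb) \<le> ennreal (e\<^sup>2)" if "m \<ge> N" for m
      proof -
        have d: "(\<lambda>x. s (r m) x - s k x) \<in> square_integrable" by (intro square_integrable_diff s)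
        have "(\<integral>\<^sup>+x. ennreal ((s (r m) x - s k x)\<^sup>2) \<partial>unit_leb)
            = ennreal (LINT x|unit_leb. (s (r m) x - s k x)\<^sup>2)"
          using d by (intro nn_integral_eq_integral) (auto simp: square_integrable_def)
        also have "(LINT x|unit_leb. (s (r m) x - s k x)\<^sup>2) = (norm (X (r m) - X k))\<^sup>2"
          by (simp add: Xs abs_L2_diff s norm_abs_L2 d)
        also have "ennreal \<dots> \<le> ennreal (e\<^sup>2)"
          using N k \<open>m \<ge> N\<close> seq_suble[OF r, of m] by (intro ennreal_leI power_mono) (auto intro: less_imp_le)
        finally show ?thesis .
      qed
      have "(\<integral>\<^sup>+x. ennreal ((F x - s k x)\<^sup>2) \<partial>unit_leb)
          \<le> (\<integral>\<^sup>+x. liminf (\<lambda>m. ennreal ((s (r m) x - s k x)\<^sup>2)) \<partial>unit_leb)"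
      proof (rule nn_integral_mono_AE)
        show "AE x in unit_leb. ennreal ((F x - s k x)\<^sup>2) \<le> liminf (\<lambda>m. ennreal ((s (r m) x - s k x)\<^sup>2))"
          using lim
        proof eventually_elim
          case (elim x)
          then have "(\<lambda>m. ennreal ((s (r m) x - s k x)\<^sup>2)) \<longlonglongrightarrow> ennreal ((F x - s k x)\<^sup>2)"
            by (intro tendsto_intros) auto
          from lim_imp_Liminf[OF sequentially_bot this] show ?case by (simp only: order_refl)
        qed
      qed
      also have "\<dots> \<le> liminf (\<lambda>m. \<integral>\<^sup>+x. ennreal ((s (r m) x - s k x)\<^sup>2) \<partial>unit_leb)"
        using sm by (intro nn_integral_liminf) auto
      also have "\<dots> \<le> ennreal (e\<^sup>2)"
        using bd by (intro Liminf_le) (auto simp: eventually_sequentially)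
      finally have fin: "(\<integral>\<^sup>+x. ennreal ((F x - s k x)\<^sup>2) \<partial>unit_leb) \<le> ennreal (e\<^sup>2)" .
      have d: "(\<lambda>x. F x - s k x) \<in> square_integrable"
        unfolding square_integrable_def
      proof (intro CollectI conjI)
        show "integrable unit_leb (\<lambda>x. (F x - s k x)\<^sup>2)"
          using fin Fm sm by (intro integrableI_bounded) (auto intro: le_less_trans)
      qed (use Fm sm in auto)
      have F: "F \<in> square_integrable"
        using square_integrable_add[OF d s[of k]] by simp
      have nrm: "(norm (abs_L2 F - X k))\<^sup>2 = (LINT x|unit_leb. (F x - s k x)\<^sup>2)"
        by (simp add: Xs abs_L2_diff s F norm_abs_L2 d)
      have "ennreal (LINT x|unit_leb. (F x - s k x)\<^sup>2) \<le> ennreal (e\<^sup>2)"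
        using d fin nn_integral_eq_integral[of unit_leb "\<lambda>x. (F x - s k x)\<^sup>2"]
        by (simp add: square_integrable_def)
      then have "(LINT x|unit_leb. (F x - s k x)\<^sup>2) \<le> e\<^sup>2"
        by (simp only: ennreal_le_iff zero_le_power2)
      with nrm have "norm (abs_L2 F - X k) \<le> e"
        using \<open>e > 0\<close> by (auto intro: power2_le_imp_le[of _ e])
      with F show ?thesis by (simp add: norm_minus_commute)
    qed
    then show ?thesis by blast
  qed
  have "X \<longlonglongrightarrow> abs_L2 F"
  proof (rule LIMSEQ_I)
    fix e :: real assume "e > 0"
    then show "\<exists>N. \<forall>n\<ge>N. norm (X n - abs_L2 F) < e"
      using key[of "e/2"] by fastforce
  qed
  then show "convergent X" by (rule convergentI)
qed

instance L2 :: banach ..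

lemma L2_closed_subspace_UNIV:
  assumes sub: "subspace S" and cl: "closed S"
    and gen: "\<And>q. 0 < q \<Longrightarrow> q \<le> 1 \<Longrightarrow> abs_L2 (indicator {0<..<q}) \<in> S"
  shows "S = UNIV"
proof -
  define ind :: "real set \<Rightarrow> L2" where "ind A = abs_L2 (indicator (A \<inter> {0<..<1}))" for A
  have i0: "indicator {} = (\<lambda>x::real. 0::real)" by auto
  have sb: "sets borel = sigma_sets UNIV (range (lessThan :: real \<Rightarrow> _))"
    unfolding borel_Iio by simp
  have mI: "indicator (A \<inter> {0<..<1}) \<in> borel_measurable unit_leb" if "A \<in> sets borel" for A :: "real set"
    using that by (intro borel_measurable_unit_leb) auto
  have sqI: "indicator (A \<inter> {0<..<1}) \<in> square_integrable" if "A \<in> sets borel" for A :: "real set"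
    by (rule square_integrable_bounded[OF mI[OF that], of 1]) (auto simp: indicator_def)
  have ind_S: "ind A \<in> S" if "A \<in> sets borel" for A
  proof -
    have A: "A \<in> sigma_sets UNIV (range lessThan)"
      using that by (simp add: sb)
    have int: "Int_stable (range (lessThan :: real \<Rightarrow> _))"
    proof (rule Int_stableI)
      fix a b :: "real set" assume "a \<in> range lessThan" "b \<in> range lessThan"
      then obtain p q where "a = {..<p}" "b = {..<q}" by auto
      then have "a \<inter> b = {..<min p q}" by auto
      then show "a \<inter> b \<in> range lessThan" by simp
    qed
    have pow: "range (lessThan :: real \<Rightarrow> _) \<subseteq> Pow UNIV"
      unfolding Pow_UNIV by (rule subset_UNIV)
    from int pow A show ?thesis
    proof (induction rule: sigma_sets_induct_disjoint)
      show "ind {} \<in> S" using subspace_0[OF sub] by (simp add: ind_def zero_L2_eq i0)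
    next
      fix A assume "A \<in> range (lessThan :: real \<Rightarrow> _)"
      then obtain q where A: "A = {..<q}" by blast
      consider "q \<le> 0" | "0 < q" "q \<le> 1" | "q > 1" by linarith
      then show "ind A \<in> S"
      proof cases
        case 1
        then have "A \<inter> {0<..<1} = {}" by (auto simp: A)
        then show ?thesis using subspace_0[OF sub] by (simp add: ind_def zero_L2_eq i0)
      next
        case 2
        then have "A \<inter> {0<..<1} = {0<..<q}" by (auto simp: A)
        then show ?thesis using gen[OF 2] by (simp add: ind_def)
      next
        case 3
        then have "A \<inter> {0<..<1} = {0<..<1}" by (auto simp: A)
        then show ?thesis using gen[of 1] by (simp add: ind_def)
      qed
    next
      fix A assume "A \<in> sigma_sets UNIV (range (lessThan :: real \<Rightarrow> _))" and IH: "ind A \<in> S"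
      then have A: "A \<in> sets borel" by (simp add: sb)
      have "ind (UNIV - A) = abs_L2 (indicator {0<..<1}) - ind A"
        unfolding ind_def using sqI[OF A] sqI[of UNIV]
        by (subst abs_L2_diff) (auto intro!: arg_cong[of _ _ abs_L2] simp: indicator_def)
      then show "ind (UNIV - A) \<in> S"
        using gen[of 1] IH sub by (simp add: subspace_diff)
    next
      fix A :: "nat \<Rightarrow> real set" assume dis: "disjoint_family A"
        and "range A \<subseteq> sigma_sets UNIV (range lessThan)" and IH: "\<And>i. ind (A i) \<in> S"
      then have A: "A i \<in> sets borel" for i
        by (auto simp: sb)
      have fin: "ind (\<Union>i<n. A i) = (\<Sum>i<n. ind (A i))" for n
      proof (induction n)
        case 0 then show ?case by (simp add: ind_def zero_L2_eq i0)
      next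
        case (Suc n)
        have "A i \<inter> A n = {}" if "i < n" for i
          using disjoint_family_onD[OF dis, of i n] that by simp
        then have "(\<Union>i<n. A i) \<inter> A n = {}" by blast
        then have eq: "indicator ((\<Union>i<Suc n. A i) \<inter> {0<..<1}) =
            (\<lambda>x. indicator ((\<Union>i<n. A i) \<inter> {0<..<1}) x + indicator (A n \<inter> {0<..<1}) x :: real)"
          by (intro ext) (auto simp: indicator_def lessThan_Suc)
        have "(\<Union>i<n. A i) \<in> sets borel" using A by blast
        then have "ind (\<Union>i<Suc n. A i) = ind (\<Union>i<n. A i) + ind (A n)"
          unfolding ind_def eq by (intro abs_L2_add[symmetric] sqI A)
        with Suc show ?case by (simp only: sum.lessThan_Suc)
      qed
      have "(\<lambda>n. ind (\<Union>i<n. A i)) \<longlonglongrightarrow> ind (\<Union>i. A i)"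
        unfolding ind_def
      proof (rule tendsto_abs_L2_dominated(3)[where w = "\<lambda>x. 1"])
        show "(\<lambda>x. 1) \<in> square_integrable"
          by (rule square_integrable_bounded[of _ 1]) auto
        show "AE x in unit_leb. (\<lambda>n. indicator ((\<Union>i<n. A i) \<inter> {0<..<1}) x :: real)
            \<longlonglongrightarrow> indicator ((\<Union>i. A i) \<inter> {0<..<1}) x"
        proof (rule AE_I2)
          fix x :: real
          show "(\<lambda>n. indicator ((\<Union>i<n. A i) \<inter> {0<..<1}) x :: real)
            \<longlonglongrightarrow> indicator ((\<Union>i. A i) \<inter> {0<..<1}) x"
          proof (cases "\<exists>i. x \<in> A i")
            case True
            then obtain i where "x \<in> A i" by blast
            then have "\<forall>\<^sub>F n in sequentially. indicator ((\<Union>i<n. A i) \<inter> {0<..<1}) x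
                = (indicator ((\<Union>i. A i) \<inter> {0<..<1}) x :: real)"
              unfolding eventually_sequentially
              by (intro exI[of _ "Suc i"]) (auto simp: indicator_def)
            then show ?thesis by (rule tendsto_eventually)
          next
            case False
            then show ?thesis by (simp add: indicator_def)
          qed
        qed
      qed (use A in \<open>auto intro!: mI AE_I2 simp: indicator_def\<close>)
      moreover have "ind (\<Union>i<n. A i) \<in> S" for n
        unfolding fin using IH sub by (intro subspace_sum) auto
      ultimately show "ind (\<Union>i. A i) \<in> S"
        by (metis (mono_tags, lifting) closed_sequentially[OF cl])
    qed
  qed
  have "h \<in> S" for h
  proof -
    define f where "f x = (if x \<in> {0<..<1} then rep_L2 h x else 0)" for x
    have "f \<in> borel_measurable lebesgue"
      using rep_L2_mem[of h] unfolding f_def square_integrable_def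
      by (intro borel_measurable_if_I) auto
    then obtain g where gm: "g \<in> borel_measurable lborel" and "AE x in lborel. f x = g x"
      using completion_ex_borel_measurable_real by blast
    then have "AE x in lebesgue. f x = g x" by (simp add: AE_completion)
    then have fg: "AE x in unit_leb. rep_L2 h x = g x"
      unfolding AE_unit_leb_iff by eventually_elim (auto simp: f_def)
    have gs: "g \<in> square_integrable"
      using gm fg by (intro square_integrable_dominated[OF _ rep_L2_mem[of h]])
        (auto intro!: borel_measurable_unit_leb elim: eventually_mono)
    have hg: "h = abs_L2 g"
      using fg gs rep_L2_mem[of h] abs_L2_eq_iff abs_rep_L2 by metis
    obtain s where s: "\<And>i. simple_function lborel (s i)" "\<And>x. (\<lambda>i. s i x) \<longlonglongrightarrow> g x"
      "\<And>i x. \<bar>s i x\<bar> \<le> 2 * \<bar>g x\<bar>"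
      using borel_measurable_implies_sequence_metric[OF gm, of 0] by (auto simp: dist_real_def)
    have sm: "s i \<in> borel_measurable borel" for i
      using borel_measurable_simple_function[OF s(1)[of i]] by simp
    have sS: "abs_L2 (s i) \<in> S" for i
    proof -
      have fin: "finite (range (s i))" using s(1)[of i] by (auto simp: simple_function_def)
      have vb: "s i -` {y} \<in> sets borel" for y
        using sm[of i] by (intro measurable_sets_borel) auto
      have *: "finite F \<Longrightarrow>
        (\<lambda>x. \<Sum>y\<in>F. y * indicator (s i -` {y} \<inter> {0<..<1}) x) \<in> square_integrable \<and>
        abs_L2 (\<lambda>x. \<Sum>y\<in>F. y * indicator (s i -` {y} \<inter> {0<..<1}) x) \<in> S" for F
      proof (induction F rule: finite_induct)
        case empty
        then show ?case using subspace_0[OF sub] by (simp add: square_integrable_zero zero_L2_eq)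
      next
        case (insert y F)
        have a: "(\<lambda>x. y * indicator (s i -` {y} \<inter> {0<..<1}) x) \<in> square_integrable"
          by (intro square_integrable_scale sqI vb)
        have b: "abs_L2 (\<lambda>x. y * indicator (s i -` {y} \<inter> {0<..<1}) x) \<in> S"
          using ind_S[OF vb[of y]] sub unfolding ind_def
          by (subst abs_L2_scaleR[symmetric]) (auto intro!: subspace_scale sqI vb)
        show ?case
          unfolding sum.insert[OF insert.hyps]
            abs_L2_add[OF a conjunct1[OF insert.IH], symmetric]
          by (intro conjI square_integrable_add subspace_add[OF sub] a b
              conjunct1[OF insert.IH] conjunct2[OF insert.IH])
      qed
      have "s i x = (\<Sum>y\<in>range (s i). y * indicator (s i -` {y} \<inter> {0<..<1}) x)"
        if "x \<in> space unit_leb" for x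
        using that fin by (simp add: indicator_def if_distrib[of "\<lambda>c. _ * c"] sum.delta cong: if_cong)
      then have "AE x in unit_leb. s i x = (\<Sum>y\<in>range (s i). y * indicator (s i -` {y} \<inter> {0<..<1}) x)"
        by (rule AE_I2)
      moreover have "s i \<in> square_integrable"
        by (rule square_integrable_dominated[OF borel_measurable_unit_leb[OF sm[of i]]
              square_integrable_scale[OF gs, of 2]]) (use s(3) in \<open>auto simp: abs_mult\<close>)
      ultimately have "abs_L2 (s i) = abs_L2 (\<lambda>x. \<Sum>y\<in>range (s i). y * indicator (s i -` {y} \<inter> {0<..<1}) x)"
        using *[OF fin] abs_L2_eq_iff by blast
      then show ?thesis using *[OF fin] by simp
    qed
    have "(\<lambda>i. abs_L2 (s i)) \<longlonglongrightarrow> abs_L2 g"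
    proof (rule tendsto_abs_L2_dominated(3)[where w = "\<lambda>x. 2 * \<bar>g x\<bar>"])
      show "(\<lambda>x. 2 * \<bar>g x\<bar>) \<in> square_integrable"
        using gs by (intro square_integrable_scale) (auto simp: square_integrable_def)
    qed (use s gm sm in \<open>auto intro!: borel_measurable_unit_leb\<close>)
    with sS show "h \<in> S"
      unfolding hg by (metis (mono_tags, lifting) closed_sequentially[OF cl])
  qed
  then show ?thesis by blast
qed

lemma second_countable_if_countable_dense:
  fixes D :: "'a::metric_space set"
  assumes "countable D" "closure D = UNIV"
  shows "\<exists>B::'a set set. countable B \<and> open = generate_topology B"
proof -
  define B where "B = (\<lambda>(d, n). ball d (1 / real (Suc n))) ` (D \<times> (UNIV :: nat set))"
  have "topological_basis B"
  proof (rule topological_basisI)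
    fix U and x :: 'a assume "open U" "x \<in> U"
    then obtain e where e: "e > 0" "ball x e \<subseteq> U" using openE by blast
    obtain n :: nat where n: "inverse (real (Suc n)) < e / 2"
      using reals_Archimedean[of "e / 2"] e(1) by auto
    have "x \<in> closure D" using assms(2) by simp
    then obtain d where d: "d \<in> D" "dist d x < 1 / real (Suc n)"
      unfolding closure_approachable by (metis of_nat_0_less_iff zero_less_Suc zero_less_divide_1_iff)
    have "ball d (1 / real (Suc n)) \<subseteq> ball x e"
    proof
      fix y assume "y \<in> ball d (1 / real (Suc n))"
      then have "dist x y < 1 / real (Suc n) + 1 / real (Suc n)"
        using d(2) dist_triangle[of x y d] by (simp add: dist_commute)
      also have "\<dots> < e" using n by (simp add: field_simps)
      finally show "y \<in> ball x e" by simp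
    qed
    then show "\<exists>B'\<in>B. x \<in> B' \<and> B' \<subseteq> U"
      using d e(2) unfolding B_def by (intro bexI[of _ "ball d (1 / real (Suc n))"]) auto
  qed (auto simp: B_def)
  moreover have "countable B" using assms(1) by (simp add: B_def)
  ultimately show ?thesis using topological_basis_imp_subbasis by blast
qed

lemma tendsto_ind:
  assumes "\<And>n. q - 1 / real (Suc n) < p n" "\<And>n. p n < q" "q \<le> 1"
  shows "(\<lambda>n. abs_L2 (indicator {0<..<p n})) \<longlonglongrightarrow> abs_L2 (indicator {0<..<q})"
proof (rule tendsto_abs_L2_dominated(3)[where w = "\<lambda>x. 1"])
  show "(\<lambda>x. 1) \<in> square_integrable" by (rule square_integrable_bounded[of _ 1]) auto
  have "(\<lambda>n. q - 1 / real (Suc n)) \<longlonglongrightarrow> q - 0"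
    by (intro tendsto_intros LIMSEQ_Suc lim_1_over_n)
  then have lim: "(\<lambda>n. q - 1 / real (Suc n)) \<longlonglongrightarrow> q" by simp
  show "AE x in unit_leb. (\<lambda>n. indicator {0<..<p n} x :: real) \<longlonglongrightarrow> indicator {0<..<q} x"
  proof (intro AE_I2 tendsto_eventually)
    fix x :: real
    show "\<forall>\<^sub>F n in sequentially. indicator {0<..<p n} x = (indicator {0<..<q} x :: real)"
    proof (cases "x < q")
      case True
      then have "\<forall>\<^sub>F n in sequentially. x < q - 1 / real (Suc n)"
        using lim by (rule order_tendstoD(1)[rotated])
      then show ?thesis
      proof eventually_elim
        case (elim n)
        with True assms(1)[of n] show ?case by (auto simp: indicator_def)
      qed
    next
      case False
      then have "\<not> x < p n" for n using assms(2)[of n] by simp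
      then show ?thesis using False by (simp add: indicator_def)
    qed
  qed
qed (auto intro!: borel_measurable_unit_leb)

instance L2 :: second_countable_topology
proof
  define e where "e q = abs_L2 (indicator {0<..<q :: real})" for q
  define lc where "lc xs = (\<Sum>(c, q)\<leftarrow>xs. (of_rat c :: real) *\<^sub>R e (of_rat q))" for xs
  define D where "D = range lc"
  have "countable D" unfolding D_def by simp
  have D0: "0 \<in> D" unfolding D_def by (intro range_eqI[of _ _ "[]"]) (simp add: lc_def)
  have Dadd: "x + y \<in> D" if xy: "x \<in> D" "y \<in> D" for x y
  proof -
    obtain xs ys where "x = lc xs" "y = lc ys" using xy unfolding D_def by blast
    then have "x + y = lc (xs @ ys)" by (simp add: lc_def)
    then show ?thesis by (simp add: D_def)
  qed
  have lcs: "lc (map (\<lambda>(c, q). (r * c, q)) xs) = of_rat r *\<^sub>R lc xs" for r xs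
    by (induction xs) (auto simp: lc_def of_rat_mult scaleR_add_right)
  have Dscale: "of_rat r *\<^sub>R x \<in> D" if "x \<in> D" for r x
    using that lcs by (auto simp: D_def) (metis rangeI)
  have "subspace (closure D)"
  proof (rule subspaceI)
    show "0 \<in> closure D" using D0 closure_subset by blast
  next
    fix x y assume "x \<in> closure D" "y \<in> closure D"
    then obtain xs ys where "\<forall>n::nat. xs n \<in> D" "xs \<longlonglongrightarrow> x" "\<forall>n::nat. ys n \<in> D" "ys \<longlonglongrightarrow> y"
      by (auto simp: closure_sequential)
    then show "x + y \<in> closure D"
      unfolding closure_sequential using Dadd
      by (intro exI[of _ "\<lambda>n. xs n + ys n"]) (auto intro: tendsto_add)
  next
    fix c :: real and x assume "x \<in> closure D"
    then obtain xs where xs: "\<forall>n::nat. xs n \<in> D" "xs \<longlonglongrightarrow> x"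
      by (auto simp: closure_sequential)
    have "\<forall>n::nat. \<exists>r. c - 1 / real (Suc n) < of_rat r \<and> of_rat r < c"
      using of_rat_dense by (metis diff_less_eq less_add_same_cancel1 of_nat_0_less_iff zero_less_Suc zero_less_divide_1_iff)
    then obtain r where r: "\<And>n::nat. c - 1 / real (Suc n) < of_rat (r n)" "\<And>n. of_rat (r n) < c"
      by metis
    have "(\<lambda>n. c - 1 / real (Suc n)) \<longlonglongrightarrow> c - 0"
      by (intro tendsto_intros LIMSEQ_Suc lim_1_over_n)
    then have lim: "(\<lambda>n. c - 1 / real (Suc n)) \<longlonglongrightarrow> c" by simp
    have "(\<lambda>n. of_rat (r n)) \<longlonglongrightarrow> c"
      by (rule tendsto_sandwich[OF _ _ lim tendsto_const])
        (intro always_eventually allI less_imp_le r)+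
    then show "c *\<^sub>R x \<in> closure D"
      unfolding closure_sequential using Dscale xs
      by (intro exI[of _ "\<lambda>n. of_rat (r n) *\<^sub>R xs n"]) (auto intro: tendsto_scaleR)
  qed
  moreover have "e q \<in> closure D" if "0 < q" "q \<le> 1" for q
  proof -
    have "\<forall>n::nat. \<exists>r. q - 1 / real (Suc n) < of_rat r \<and> of_rat r < q"
      using of_rat_dense by (metis diff_less_eq less_add_same_cancel1 of_nat_0_less_iff zero_less_Suc zero_less_divide_1_iff)
    then obtain r where r: "\<And>n::nat. q - 1 / real (Suc n) < of_rat (r n)" "\<And>n. of_rat (r n) < q"
      by metis
    have "e (of_rat (r n)) \<in> D" for n
      unfolding D_def by (intro range_eqI[of _ _ "[(1, r n)]"]) (simp add: lc_def)
    with tendsto_ind[OF r that(2)] show ?thesis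
      unfolding closure_sequential e_def
      by (intro exI[of _ "\<lambda>n. abs_L2 (indicator {0<..<real_of_rat (r n)})"]) auto
  qed
  ultimately have "closure D = UNIV"
    unfolding e_def by (intro L2_closed_subspace_UNIV) auto
  then show "\<exists>B::L2 set set. countable B \<and> open = generate_topology B"
    using second_countable_if_countable_dense \<open>countable D\<close> by blast
qed


subsection \<open>Test functions\<close>

definition smooth :: "(real \<Rightarrow> real) \<Rightarrow> bool" where
  "smooth \<phi> \<longleftrightarrow> (\<forall>n x. (deriv ^^ n) \<phi> field_differentiable at x)"

definition test_functions :: "real set \<Rightarrow> (real \<Rightarrow> real) set" where
  "test_functions S =
    {\<phi>. smooth \<phi> \<and> compact (closure {x. \<phi> x \<noteq> 0}) \<and> closure {x. \<phi> x \<noteq> 0} \<subseteq> S}"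

lemma smooth_coinduct:
  assumes "f \<in> C"
    and "\<And>g. g \<in> C \<Longrightarrow> \<exists>g'\<in>C. \<forall>x. (g has_field_derivative g' x) (at x)"
  shows "smooth f"
proof -
  have *: "deriv g \<in> C \<and> (\<forall>x. g field_differentiable at x)" if gC: "g \<in> C" for g
  proof -
    obtain g' where g': "g' \<in> C" "\<And>x. (g has_field_derivative g' x) (at x)"
      using assms(2)[OF gC] by blast
    then have "deriv g = g'" using DERIV_imp_deriv by blast
    with g' show ?thesis by (auto simp: field_differentiable_def)
  qed
  have "(deriv ^^ n) f \<in> C" for n
    by (induction n) (auto simp: assms(1) *)
  with * show ?thesis unfolding smooth_def by blast
qed

lemma smooth_deriv:
  assumes "smooth f"
  shows "smooth (deriv f)" "(f has_field_derivative deriv f x) (at x)"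
proof -
  have "(deriv ^^ n) (deriv f) = (deriv ^^ Suc n) f" for n
    by (simp add: funpow_swap1)
  then show "smooth (deriv f)" using assms unfolding smooth_def by presburger
  have "(deriv ^^ 0) f field_differentiable at x" using assms unfolding smooth_def by blast
  then show "(f has_field_derivative deriv f x) (at x)"
    by (simp add: field_differentiable_derivI)
qed

lemma smooth_lincomb:
  assumes "smooth f" "smooth g"
  shows "smooth (\<lambda>x. a * f x + b * g x)"
proof (rule smooth_coinduct[of _ "{\<lambda>x. a * f x + b * g x | f g. smooth f \<and> smooth g}"])
  fix h assume "h \<in> {\<lambda>x. a * f x + b * g x | f g. smooth f \<and> smooth g}"
  then obtain f g where h: "h = (\<lambda>x. a * f x + b * g x)" "smooth f" "smooth g" by blast
  show "\<exists>h'\<in>{\<lambda>x. a * f x + b * g x | f g. smooth f \<and> smooth g}.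
      \<forall>x. (h has_field_derivative h' x) (at x)"
  proof (intro bexI[of _ "\<lambda>x. a * deriv f x + b * deriv g x"] allI)
    show "(h has_field_derivative a * deriv f x + b * deriv g x) (at x)" for x
      unfolding h(1) by (intro DERIV_add DERIV_cmult smooth_deriv(2) h(2,3))
    show "(\<lambda>x. a * deriv f x + b * deriv g x) \<in> {\<lambda>x. a * f x + b * g x | f g. smooth f \<and> smooth g}"
      using h(2,3) smooth_deriv(1) by blast
  qed
qed (use assms in blast)

inductive_set prod_class :: "(real \<Rightarrow> real) set" where
  prod: "smooth f \<Longrightarrow> smooth g \<Longrightarrow> (\<lambda>x. f x * g x) \<in> prod_class"
| add: "u \<in> prod_class \<Longrightarrow> v \<in> prod_class \<Longrightarrow> (\<lambda>x. u x + v x) \<in> prod_class"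

lemma smooth_mult:
  assumes "smooth f" "smooth g"
  shows "smooth (\<lambda>x. f x * g x)"
proof (rule smooth_coinduct[of _ prod_class])
  show "(\<lambda>x. f x * g x) \<in> prod_class" using assms by (rule prod_class.prod)
  fix h assume "h \<in> prod_class"
  then show "\<exists>h'\<in>prod_class. \<forall>x. (h has_field_derivative h' x) (at x)"
  proof induction
    case (prod f g)
    show ?case
    proof (intro bexI[of _ "\<lambda>x. f x * deriv g x + deriv f x * g x"] allI)
      show "((\<lambda>x. f x * g x) has_field_derivative f x * deriv g x + deriv f x * g x) (at x)" for x
        by (intro DERIV_mult' smooth_deriv(2) prod)
      show "(\<lambda>x. f x * deriv g x + deriv f x * g x) \<in> prod_class"
        by (intro prod_class.intros smooth_deriv(1) prod)
    qed
  next
    case (add u v)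
    then obtain u' v' where "u' \<in> prod_class" "\<And>x. (u has_field_derivative u' x) (at x)"
      "v' \<in> prod_class" "\<And>x. (v has_field_derivative v' x) (at x)" by blast
    then show ?case
      by (intro bexI[of _ "\<lambda>x. u' x + v' x"] allI DERIV_add prod_class.add) auto
  qed
qed

lemma smooth_affine:
  assumes "smooth f"
  shows "smooth (\<lambda>x. f (m * x + d))"
proof -
  let ?C = "{\<lambda>x. c * f (m * x + d) | c f. smooth f}"
  have "(\<lambda>x. 1 * f (m * x + d)) \<in> ?C" using assms by blast
  then have "smooth (\<lambda>x. 1 * f (m * x + d))"
  proof (rule smooth_coinduct)
    fix h assume "h \<in> ?C"
    then obtain c f where h: "h = (\<lambda>x. c * f (m * x + d))" "smooth f" by blast
    show "\<exists>h'\<in>?C. \<forall>x. (h has_field_derivative h' x) (at x)"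
    proof (intro bexI[of _ "\<lambda>x. (c * m) * deriv f (m * x + d)"] allI)
      fix x
      have "((\<lambda>x. f (m * x + d)) has_field_derivative deriv f (m * x + d) * m) (at x)"
        by (rule DERIV_chain2[OF smooth_deriv(2)[OF h(2)]]) (auto intro!: derivative_eq_intros)
      from DERIV_cmult[OF this, of c]
      show "(h has_field_derivative (c * m) * deriv f (m * x + d)) (at x)"
        unfolding h(1) by (simp add: mult_ac)
    qed (use smooth_deriv(1)[OF h(2)] in blast)
  qed
  then show ?thesis by simp
qed

definition hexp :: "nat \<Rightarrow> real \<Rightarrow> real" where
  "hexp k x = (if x > 0 then inverse x ^ k * exp (- inverse x) else 0)"

lemma hexp_tendsto_0: "(hexp k \<longlongrightarrow> 0) (at 0)"
proof -
  have "((\<lambda>y. y ^ k / exp y :: real) \<longlongrightarrow> 0) at_top"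
    by (rule tendsto_power_div_exp_0)
  then have "((\<lambda>x. inverse x ^ k / exp (inverse x) :: real) \<longlongrightarrow> 0) (at_right 0)"
    by (rule filterlim_compose[OF _ filterlim_inverse_at_top_right])
  then have r: "(hexp k \<longlongrightarrow> 0) (at_right 0)"
    by (rule Lim_transform_eventually)
      (auto simp: hexp_def eventually_at_filter exp_minus field_simps)
  have l: "(hexp k \<longlongrightarrow> 0) (at_left 0)"
    by (rule tendsto_eventually) (auto simp: hexp_def eventually_at_filter)
  from r l show ?thesis by (simp add: filterlim_split_at)
qed

lemma hexp_deriv:
  "(hexp k has_field_derivative - real k * hexp (Suc k) x + hexp (Suc (Suc k)) x) (at x)"
proof -
  consider "x < 0" | "x = 0" | "x > 0" by linarith
  then show ?thesis
  proof cases
    case 1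
    have "(hexp k has_field_derivative 0) (at x)"
    proof (rule has_field_derivative_transform_within_open[of "\<lambda>x. 0" _ _ "{..<0}"])
    qed (use 1 in \<open>auto simp: hexp_def\<close>)
    then show ?thesis using 1 by (simp add: hexp_def)
  next
    case 2
    have "((\<lambda>h. (hexp k (0 + h) - hexp k 0) / h) \<longlongrightarrow> 0) (at 0)"
    proof (rule Lim_transform_eventually[OF hexp_tendsto_0[of "Suc k"]])
      show "\<forall>\<^sub>F h in at 0. hexp (Suc k) h = (hexp k (0 + h) - hexp k 0) / h"
        by (auto simp: hexp_def eventually_at_filter field_simps)
    qed
    then show ?thesis unfolding 2 DERIV_def by (simp add: hexp_def)
  next
    case 3
    then have "x \<noteq> 0" by simp
    note di = DERIV_inverse[OF this, of UNIV]
    have "((\<lambda>x. inverse x ^ k * exp (- inverse x)) has_field_derivative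
        - real k * hexp (Suc k) x + hexp (Suc (Suc k)) x) (at x)"
      by (rule DERIV_cong[OF DERIV_mult[OF DERIV_power[OF di] DERIV_fun_exp[OF DERIV_minus[OF di]]]])
        (use 3 in \<open>cases k; simp add: hexp_def algebra_simps\<close>)
    then show ?thesis
      by (rule has_field_derivative_transform_within_open[of _ _ _ "{0<..}"])
        (use 3 in \<open>auto simp: hexp_def\<close>)
  qed
qed

inductive_set hexp_class :: "(real \<Rightarrow> real) set" where
  base: "hexp k \<in> hexp_class"
| lin: "u \<in> hexp_class \<Longrightarrow> v \<in> hexp_class \<Longrightarrow> (\<lambda>x. a * u x + b * v x) \<in> hexp_class"

lemma smooth_hexp: "smooth (hexp k)"
proof (rule smooth_coinduct[of _ hexp_class])
  show "hexp k \<in> hexp_class" by (rule hexp_class.base)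
  fix h assume "h \<in> hexp_class"
  then show "\<exists>h'\<in>hexp_class. \<forall>x. (h has_field_derivative h' x) (at x)"
  proof induction
    case (base k)
    show ?case
      using hexp_deriv[of k] hexp_class.lin[OF hexp_class.base[of "Suc k"] hexp_class.base[of "Suc (Suc k)"], of "- real k" 1]
      by (intro bexI[of _ "\<lambda>x. - real k * hexp (Suc k) x + 1 * hexp (Suc (Suc k)) x"]) auto
  next
    case (lin u v a b)
    then obtain u' v' where "u' \<in> hexp_class" "\<And>x. (u has_field_derivative u' x) (at x)"
      "v' \<in> hexp_class" "\<And>x. (v has_field_derivative v' x) (at x)" by blast
    then show ?case
      by (intro bexI[of _ "\<lambda>x. a * u' x + b * v' x"] allI DERIV_add DERIV_cmult hexp_class.lin) auto
  qed
qed

definition bump :: "real \<Rightarrow> real \<Rightarrow> real \<Rightarrow> real \<Rightarrow> real" where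
  "bump m a b x = hexp 0 (m * (x - a)) * hexp 0 (m * (b - x))"

lemma bump_test:
  assumes "m > 0" "a < b" "{a..b} \<subseteq> S"
  shows "bump m a b \<in> test_functions S"
proof -
  have "{x. bump m a b x \<noteq> 0} \<subseteq> {a..b}"
    using assms by (auto simp: bump_def hexp_def zero_less_mult_iff split: if_splits)
  then have sub: "closure {x. bump m a b x \<noteq> 0} \<subseteq> {a..b}"
    by (simp add: closure_minimal)
  have "bump m a b = (\<lambda>x. hexp 0 (m * x + (- m * a)) * hexp 0 ((- m) * x + m * b))"
    by (auto simp: bump_def algebra_simps)
  then have "smooth (bump m a b)"
    by (simp only:) (intro smooth_mult smooth_affine smooth_hexp)
  moreover have "compact (closure {x. bump m a b x \<noteq> 0})"
    using sub by (meson bounded_closed_interval bounded_subset closed_closure compact_eq_bounded_closed)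
  ultimately show ?thesis using sub assms(3) unfolding test_functions_def by blast
qed

lemma test_deriv:
  assumes "\<phi> \<in> test_functions S"
  shows "deriv \<phi> \<in> test_functions S"
proof -
  have sm: "smooth \<phi>" using assms by (simp add: test_functions_def)
  have "deriv \<phi> x = 0" if "x \<notin> closure {x. \<phi> x \<noteq> 0}" for x
  proof -
    have "(\<phi> has_field_derivative 0) (at x)"
      by (rule has_field_derivative_transform_within_open[of "\<lambda>x. 0" _ _ "- closure {x. \<phi> x \<noteq> 0}"])
        (use that closure_subset[of "{x. \<phi> x \<noteq> 0}"] in auto)
    then show ?thesis by (rule DERIV_imp_deriv)
  qed
  then have sub: "closure {x. deriv \<phi> x \<noteq> 0} \<subseteq> closure {x. \<phi> x \<noteq> 0}"
    by (intro closure_minimal) auto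
  with assms have "compact (closure {x. deriv \<phi> x \<noteq> 0})"
    by (metis (mono_tags, lifting) closed_closure compact_Int_closed inf.absorb_iff2 mem_Collect_eq test_functions_def)
  with sub assms show ?thesis
    using smooth_deriv(1)[OF sm] unfolding test_functions_def by blast
qed

lemma compact_closed_subset_aux:
  fixes K T :: "real set"
  shows "compact K \<Longrightarrow> closed T \<Longrightarrow> T \<subseteq> K \<Longrightarrow> compact T"
  using compact_Int_closed[of K T] by (simp add: inf.absorb2)

lemma test_lincomb:
  assumes f: "f \<in> test_functions S" and g: "g \<in> test_functions S"
  shows "(\<lambda>x. a * f x + b * g x) \<in> test_functions S"
proof -
  let ?K = "closure {x. f x \<noteq> 0} \<union> closure {x. g x \<noteq> 0}"
  have K: "compact ?K" "?K \<subseteq> S" using f g by (auto simp: test_functions_def)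
  have "{x. a * f x + b * g x \<noteq> 0} \<subseteq> {x. f x \<noteq> 0} \<union> {x. g x \<noteq> 0}" by auto
  then have sub: "closure {x. a * f x + b * g x \<noteq> 0} \<subseteq> ?K"
    unfolding closure_Un[symmetric] by (rule closure_mono)
  have "compact (closure {x. a * f x + b * g x \<noteq> 0})"
    by (rule compact_closed_subset_aux[OF K(1) closed_closure sub])
  moreover have "smooth (\<lambda>x. a * f x + b * g x)"
    using f g by (intro smooth_lincomb) (auto simp: test_functions_def)
  ultimately show ?thesis
    using order_trans[OF sub K(2)] unfolding test_functions_def by (intro CollectI conjI)
qed

lemma test_continuous:
  assumes "\<phi> \<in> test_functions S"
  shows "continuous_on A \<phi>"
proof -
  have "smooth \<phi>" using assms by (simp add: test_functions_def)
  from smooth_deriv(2)[OF this] show ?thesis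
    by (meson DERIV_isCont continuous_at_imp_continuous_on)
qed

lemma test_square_integrable:
  assumes "\<phi> \<in> test_functions S"
  shows "\<phi> \<in> square_integrable"
proof -
  have "compact (\<phi> ` {0..1})"
    using test_continuous[OF assms] by (intro compact_continuous_image) auto
  then obtain B where "\<forall>y\<in>\<phi> ` {0..1}. \<bar>y\<bar> \<le> B"
    using compact_imp_bounded bounded_real by blast
  then show ?thesis
    using test_continuous[OF assms, of UNIV]
    by (intro square_integrable_bounded[of _ B] borel_measurable_unit_leb
        borel_measurable_continuous_onI) auto
qed

lemma L2_closed_subspace_test_UNIV:
  assumes sub: "subspace S" and cl: "closed S"
    and gen: "\<And>\<phi>. \<phi> \<in> test_functions {0<..<1} \<Longrightarrow> abs_L2 \<phi> \<in> S"
  shows "S = UNIV"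
proof (rule L2_closed_subspace_UNIV[OF sub cl])
  fix q :: real assume q: "0 < q" "q \<le> 1"
  define a where "a n = q / real (n + 3)" for n :: nat
  define b where "b n = q - a n" for n
  have a0: "0 < a n" for n using q by (simp add: a_def)
  have ab: "a n < b n" for n
  proof -
    have "a n \<le> q / 3" unfolding a_def using q by (intro divide_left_mono) auto
    then show ?thesis using q by (simp add: b_def)
  qed
  have bq: "b n < q" for n using a0[of n] by (simp add: b_def)
  define \<phi> where "\<phi> n = bump (real (Suc n)) (a n) (b n)" for n
  have t: "\<phi> n \<in> test_functions {0<..<1}" for n
    unfolding \<phi>_def by (intro bump_test) (use a0[of n] ab[of n] bq[of n] q in auto)
  have h: "0 \<le> hexp 0 y" "hexp 0 y \<le> 1" for y by (auto simp: hexp_def)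
  have alim: "a \<longlonglongrightarrow> 0"
    unfolding a_def using LIMSEQ_ignore_initial_segment[OF lim_const_over_n[of q], of 3] by simp
  then have blim: "b \<longlonglongrightarrow> q"
    unfolding b_def using tendsto_diff[OF tendsto_const alim, of q] by simp
  have hlim: "(hexp 0 \<longlongrightarrow> 1) at_top"
  proof -
    have "((\<lambda>x::real. exp (- inverse x)) \<longlongrightarrow> exp (- 0)) at_top"
      by (intro tendsto_intros tendsto_inverse_0_at_top filterlim_ident)
    then have "((\<lambda>x::real. exp (- inverse x)) \<longlongrightarrow> 1) at_top" by simp
    then show ?thesis
      by (rule Lim_transform_eventually)
        (auto simp: hexp_def intro!: eventually_mono[OF eventually_gt_at_top[of 0]])
  qed
  have big: "filterlim (\<lambda>n. real (Suc n) * c n) at_top sequentially"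
    if "c \<longlonglongrightarrow> l" "l > 0" for c l
    by (subst mult.commute, rule filterlim_tendsto_pos_mult_at_top[OF that])
      (rule filterlim_compose[OF filterlim_real_sequentially filterlim_Suc])
  have "(\<lambda>n. abs_L2 (\<phi> n)) \<longlonglongrightarrow> abs_L2 (indicator {0<..<q})"
  proof (rule tendsto_abs_L2_dominated(3)[where w = "\<lambda>x. 1"])
    show "(\<lambda>x. 1) \<in> square_integrable" by (rule square_integrable_bounded[of _ 1]) auto
    show "\<phi> n \<in> borel_measurable unit_leb" for n
      using test_square_integrable[OF t] by (simp add: square_integrable_def)
    show "AE x in unit_leb. \<bar>\<phi> n x\<bar> \<le> 1" for n
      using h by (intro AE_I2) (auto simp: \<phi>_def bump_def abs_mult intro!: mult_le_one)
    show "AE x in unit_leb. (\<lambda>n. \<phi> n x) \<longlonglongrightarrow> indicator {0<..<q} x"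
    proof (rule AE_I2)
      fix x :: real assume "x \<in> space unit_leb"
      then have x: "0 < x" by simp
      show "(\<lambda>n. \<phi> n x) \<longlonglongrightarrow> indicator {0<..<q} x"
      proof (cases "x < q")
        case True
        have "(\<lambda>n. x - a n) \<longlonglongrightarrow> x - 0" "(\<lambda>n. b n - x) \<longlonglongrightarrow> q - x"
          by (intro tendsto_intros alim blim)+
        then have "(\<lambda>n. hexp 0 (real (Suc n) * (x - a n)) * hexp 0 (real (Suc n) * (b n - x)))
            \<longlonglongrightarrow> 1 * 1"
          using x True by (intro tendsto_mult filterlim_compose[OF hlim] big[of _ "x - 0"] big[of _ "q - x"]) auto
        then show ?thesis using x True by (simp add: \<phi>_def bump_def)
      next
        case False
        then have "b n - x < 0" for n using bq[of n] by simp
        then have "\<phi> n x = 0" for n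
          by (auto simp: \<phi>_def bump_def hexp_def zero_less_mult_iff not_less less_imp_le)
        then show ?thesis using False by simp
      qed
    qed
  qed (auto intro!: borel_measurable_unit_leb)
  with gen[OF t] show "abs_L2 (indicator {0<..<q}) \<in> S"
    by (metis (mono_tags, lifting) closed_sequentially[OF cl])
qed

lemma L2_test_orthogonal_zero:
  assumes "\<And>\<phi>. \<phi> \<in> test_functions {0<..<1} \<Longrightarrow> inner f (abs_L2 \<phi>) = 0"
  shows "f = 0"
proof -
  have "{g. inner f g = 0} = UNIV"
  proof (rule L2_closed_subspace_test_UNIV)
    show "subspace {g. inner f g = 0}" by (rule subspace_hyperplane)
    show "closed {g. inner f g = 0}" by (rule closed_hyperplane)
  qed (use assms in auto)
  then have "inner f f = 0" by blast
  then show ?thesis by simp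
qed


subsection \<open>Weak derivatives and Sobolev spaces\<close>

lemma second_countable_if_isometry:
  fixes J :: "'a::metric_space \<Rightarrow> 'b::{metric_space, second_countable_topology}"
  assumes iso: "\<And>x y. dist (J x) (J y) = dist x y"
  shows "\<exists>B::'a set set. countable B \<and> open = generate_topology B"
proof -
  obtain B' :: "'b set set" where B': "countable B'" "topological_basis B'"
    using ex_countable_basis by blast
  define B where "B = (\<lambda>b. J -` b) ` B'"
  have "topological_basis B"
  proof (rule topological_basisI)
    fix b assume "b \<in> B"
    then obtain c where c: "c \<in> B'" "b = J -` c" by (auto simp: B_def)
    have cont: "continuous_on UNIV J"
      unfolding continuous_on_iff iso by blast
    show "open b"
      unfolding c(2) by (rule open_vimage[OF topological_basis_open[OF B'(2) c(1)] cont])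
  next
    fix U and x :: 'a assume "open U" "x \<in> U"
    then obtain e where e: "e > 0" "ball x e \<subseteq> U" using openE by blast
    obtain c where c: "c \<in> B'" "J x \<in> c" "c \<subseteq> ball (J x) e"
      by (rule topological_basisE[OF B'(2) open_ball centre_in_ball[THEN iffD2, OF e(1)]])
    have "J -` c \<subseteq> ball x e" using c(3) by (auto simp: iso[symmetric])
    then show "\<exists>b\<in>B. x \<in> b \<and> b \<subseteq> U"
      using c e(2) unfolding B_def by (intro bexI[of _ "J -` c"]) auto
  qed
  moreover have "countable B" using B'(1) by (simp add: B_def)
  ultimately show ?thesis using topological_basis_imp_subbasis by blast
qed

definition has_weak_deriv :: "L2 \<Rightarrow> L2 \<Rightarrow> bool" where
  "has_weak_deriv f g \<longleftrightarrow>
    (\<forall>\<phi>\<in>test_functions {0<..<1}.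
      (LINT x|unit_leb. rep_L2 f x * deriv \<phi> x) = - (LINT x|unit_leb. rep_L2 g x * \<phi> x))"

definition weak_deriv :: "L2 \<Rightarrow> L2" where
  "weak_deriv f = (THE g. has_weak_deriv f g)"

lemma inner_abs_L2_right:
  "\<phi> \<in> square_integrable \<Longrightarrow> inner f (abs_L2 \<phi>) = (LINT x|unit_leb. rep_L2 f x * \<phi> x)"
  using inner_abs_L2[OF rep_L2_mem[of f], of \<phi>] by (simp add: abs_rep_L2)

lemma has_weak_deriv_iff_inner:
  "has_weak_deriv f g \<longleftrightarrow>
    (\<forall>\<phi>\<in>test_functions {0<..<1}. inner f (abs_L2 (deriv \<phi>)) = - inner g (abs_L2 \<phi>))"
  unfolding has_weak_deriv_def
  by (intro ball_cong refl)
    (simp add: inner_abs_L2_right test_square_integrable[OF test_deriv] test_square_integrable)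

lemma has_weak_deriv_unique:
  assumes "has_weak_deriv f g" "has_weak_deriv f h"
  shows "g = h"
proof -
  have "inner (g - h) (abs_L2 \<phi>) = 0" if "\<phi> \<in> test_functions {0<..<1}" for \<phi>
    using assms that by (simp add: has_weak_deriv_iff_inner inner_diff_left)
  then show ?thesis using L2_test_orthogonal_zero[of "g - h"] by simp
qed

lemma weak_deriv_eq: "has_weak_deriv f g \<Longrightarrow> weak_deriv f = g"
  unfolding weak_deriv_def using has_weak_deriv_unique by blast

lemma has_weak_deriv_zero: "has_weak_deriv 0 0"
  by (simp add: has_weak_deriv_iff_inner)

lemma has_weak_deriv_add:
  "has_weak_deriv f f' \<Longrightarrow> has_weak_deriv g g' \<Longrightarrow> has_weak_deriv (f + g) (f' + g')"
  by (simp add: has_weak_deriv_iff_inner inner_add_left)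

lemma has_weak_deriv_scaleR:
  "has_weak_deriv f f' \<Longrightarrow> has_weak_deriv (c *\<^sub>R f) (c *\<^sub>R f')"
  by (simp add: has_weak_deriv_iff_inner)

lemma has_weak_deriv_LIMSEQ:
  assumes "\<And>n::nat. has_weak_deriv (f n) (g n)" "f \<longlonglongrightarrow> F" "g \<longlonglongrightarrow> G"
  shows "has_weak_deriv F G"
  unfolding has_weak_deriv_iff_inner
proof
  fix \<phi> assume \<phi>: "\<phi> \<in> test_functions {0<..<1}"
  have "(\<lambda>n. inner (f n) (abs_L2 (deriv \<phi>))) \<longlonglongrightarrow> inner F (abs_L2 (deriv \<phi>))"
    by (intro tendsto_intros assms)
  moreover have "(\<lambda>n. - inner (g n) (abs_L2 \<phi>)) \<longlonglongrightarrow> - inner G (abs_L2 \<phi>)"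
    by (intro tendsto_intros assms)
  moreover have "inner (f n) (abs_L2 (deriv \<phi>)) = - inner (g n) (abs_L2 \<phi>)" for n
    using assms(1) \<phi> by (simp add: has_weak_deriv_iff_inner)
  ultimately show "inner F (abs_L2 (deriv \<phi>)) = - inner G (abs_L2 \<phi>)"
    using LIMSEQ_unique by simp
qed

(* Closure of the test functions in the norm of W^{1,2}(0,1). *)
definition W12_0 :: "L2 set" where
  "W12_0 = {u. \<exists>u1. has_weak_deriv u u1 \<and>
    (\<exists>\<phi>. (\<forall>n. \<phi> n \<in> test_functions {0<..<1}) \<and>
      (\<lambda>n::nat. abs_L2 (\<phi> n)) \<longlonglongrightarrow> u \<and> (\<lambda>n. abs_L2 (deriv (\<phi> n))) \<longlonglongrightarrow> u1)}"

lemma W12_0_iff: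
  assumes "has_weak_deriv u u1"
  shows "u \<in> W12_0 \<longleftrightarrow> (\<exists>\<phi>. (\<forall>n. \<phi> n \<in> test_functions {0<..<1}) \<and>
      (\<lambda>n::nat. abs_L2 (\<phi> n)) \<longlonglongrightarrow> u \<and> (\<lambda>n. abs_L2 (deriv (\<phi> n))) \<longlonglongrightarrow> u1)"
  using has_weak_deriv_unique[OF assms] assms unfolding W12_0_def by blast

lemma abs_L2_lincomb:
  assumes "f \<in> square_integrable" "g \<in> square_integrable"
  shows "abs_L2 (\<lambda>x. a * f x + b * g x) = a *\<^sub>R abs_L2 f + b *\<^sub>R abs_L2 g"
  using assms by (simp add: abs_L2_scaleR abs_L2_add square_integrable_scale)

lemma W12_0_lincomb:
  assumes "u \<in> W12_0" "v \<in> W12_0"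
  shows "a *\<^sub>R u + b *\<^sub>R v \<in> W12_0"
proof -
  obtain u1 \<phi> where u: "has_weak_deriv u u1" "\<And>n. \<phi> n \<in> test_functions {0<..<1}"
    "(\<lambda>n::nat. abs_L2 (\<phi> n)) \<longlonglongrightarrow> u" "(\<lambda>n. abs_L2 (deriv (\<phi> n))) \<longlonglongrightarrow> u1"
    using assms(1) unfolding W12_0_def by blast
  obtain v1 \<psi> where v: "has_weak_deriv v v1" "\<And>n. \<psi> n \<in> test_functions {0<..<1}"
    "(\<lambda>n::nat. abs_L2 (\<psi> n)) \<longlonglongrightarrow> v" "(\<lambda>n. abs_L2 (deriv (\<psi> n))) \<longlonglongrightarrow> v1"
    using assms(2) unfolding W12_0_def by blast
  have sm: "smooth (\<phi> n)" "smooth (\<psi> n)" for n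
    using u(2) v(2) by (auto simp: test_functions_def)
  have d: "deriv (\<lambda>x. a * \<phi> n x + b * \<psi> n x) = (\<lambda>x. a * deriv (\<phi> n) x + b * deriv (\<psi> n) x)" for n
    by (rule ext, rule DERIV_imp_deriv) (intro DERIV_add DERIV_cmult smooth_deriv(2) sm)
  show ?thesis
    unfolding W12_0_def
  proof (intro CollectI exI conjI allI)
    show "has_weak_deriv (a *\<^sub>R u + b *\<^sub>R v) (a *\<^sub>R u1 + b *\<^sub>R v1)"
      by (intro has_weak_deriv_add has_weak_deriv_scaleR u v)
    show "(\<lambda>x. a * \<phi> n x + b * \<psi> n x) \<in> test_functions {0<..<1}" for n
      by (intro test_lincomb u v)
    show "(\<lambda>n. abs_L2 (\<lambda>x. a * \<phi> n x + b * \<psi> n x)) \<longlonglongrightarrow> a *\<^sub>R u + b *\<^sub>R v"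
      unfolding abs_L2_lincomb[OF test_square_integrable[OF u(2)] test_square_integrable[OF v(2)]]
      by (intro tendsto_intros u v)
    show "(\<lambda>n. abs_L2 (deriv (\<lambda>x. a * \<phi> n x + b * \<psi> n x))) \<longlonglongrightarrow> a *\<^sub>R u1 + b *\<^sub>R v1"
      unfolding d abs_L2_lincomb[OF test_square_integrable[OF test_deriv[OF u(2)]]
          test_square_integrable[OF test_deriv[OF v(2)]]]
      by (intro tendsto_intros u v)
  qed
qed

lemma zero_in_W12_0: "0 \<in> W12_0"
proof -
  have t: "(\<lambda>x. 0) \<in> test_functions {0<..<1}"
    using test_lincomb[OF bump_test[of 1 "1/3" "2/3" "{0<..<1}"] bump_test[of 1 "1/3" "2/3" "{0<..<1}"], of 0 0]
    by (simp add: subset_iff)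
  have d: "deriv (\<lambda>x. 0 :: real) = (\<lambda>x. 0)" by simp
  show ?thesis
    unfolding W12_0_iff[OF has_weak_deriv_zero]
    by (rule exI[of _ "\<lambda>n x. 0"]) (simp add: t zero_L2_eq d del: deriv_const)
qed

lemma test_pointwise_bound:
  assumes t: "\<phi> \<in> test_functions {0<..<1}" and x: "0 < x" "x < 1"
  shows "\<bar>\<phi> x\<bar> \<le> norm (abs_L2 (deriv \<phi>))"
proof -
  have sm: "smooth \<phi>" using t by (simp add: test_functions_def)
  have t': "deriv \<phi> \<in> test_functions {0<..<1}" by (rule test_deriv[OF t])
  have z: "f y = 0" if "f \<in> test_functions {0<..<1}" "y \<notin> {0<..<1}" for f y
    using that closure_subset[of "{x. f x \<noteq> 0}"] unfolding test_functions_def by blast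
  have c: "isCont (deriv \<phi>) y" for y
    using test_continuous[OF t', of UNIV] by (simp add: continuous_on_eq_continuous_at)
  have hb: "has_bochner_integral lborel (\<lambda>y. deriv \<phi> y * indicator {0..x} y) (\<phi> x - \<phi> 0)"
    by (rule has_bochner_integral_FTC_Icc_real) (use x smooth_deriv(2)[OF sm] c in auto)
  have int: "integrable lborel (\<lambda>y. \<bar>deriv \<phi> y\<bar> * indicator {0..1} y)"
  proof -
    have "set_integrable lborel {0..1} (\<lambda>y. \<bar>deriv \<phi> y\<bar>)"
      by (intro borel_integrable_atLeastAtMost' continuous_on_rabs test_continuous[OF t'])
    then show ?thesis by (simp add: set_integrable_def mult.commute)
  qed
  have "\<bar>\<phi> x\<bar> = \<bar>\<integral>y. deriv \<phi> y * indicator {0..x} y \<partial>lborel\<bar>"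
    using has_bochner_integral_integral_eq[OF hb] z[OF t, of 0] by simp
  also have "\<dots> \<le> (\<integral>y. \<bar>deriv \<phi> y\<bar> * indicator {0..1} y \<partial>lborel)"
  proof (rule order_trans[OF integral_abs_bound])
    show "(\<integral>y. \<bar>deriv \<phi> y * indicator {0..x} y\<bar> \<partial>lborel)
        \<le> (\<integral>y. \<bar>deriv \<phi> y\<bar> * indicator {0..1} y \<partial>lborel)"
      using hb x by (intro integral_mono int) (auto simp: has_bochner_integral_iff indicator_def)
  qed
  also have "(\<lambda>y. \<bar>deriv \<phi> y\<bar> * indicator {0..1} y) = (\<lambda>y. indicator {0<..<1} y *\<^sub>R \<bar>deriv \<phi> y\<bar>)"
    using z[OF t'] by (auto simp: indicator_def)
  also have "(\<integral>y. indicator {0<..<1} y *\<^sub>R \<bar>deriv \<phi> y\<bar> \<partial>lborel)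
      = (\<integral>y. indicator {0<..<1} y *\<^sub>R \<bar>deriv \<phi> y\<bar> \<partial>lebesgue)"
  proof (rule integral_completion[symmetric])
    have "deriv \<phi> \<in> borel_measurable borel"
      using test_continuous[OF t', of UNIV] by (rule borel_measurable_continuous_onI)
    then show "(\<lambda>y. indicator {0<..<1} y *\<^sub>R \<bar>deriv \<phi> y\<bar>) \<in> borel_measurable lborel" by simp
  qed
  also have "\<dots> = (LINT y|unit_leb. \<bar>deriv \<phi> y\<bar>)"
    by (rule integral_restrict_space[symmetric]) simp
  also have "\<dots> \<le> norm (abs_L2 (deriv \<phi>))"
    by (rule integral_abs_le_norm(2)[OF test_square_integrable[OF t']])
  finally show ?thesis .
qed

lemma test_poincare:
  assumes t: "\<phi> \<in> test_functions {0<..<1}"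
  shows "norm (abs_L2 \<phi>) \<le> norm (abs_L2 (deriv \<phi>))"
proof -
  let ?N = "norm (abs_L2 (deriv \<phi>))"
  have s: "\<phi> \<in> square_integrable" by (rule test_square_integrable[OF t])
  have "(norm (abs_L2 \<phi>))\<^sup>2 = (LINT x|unit_leb. (\<phi> x)\<^sup>2)" by (rule norm_abs_L2[OF s])
  also have "\<dots> \<le> (LINT x|unit_leb. ?N\<^sup>2)"
  proof (rule integral_mono)
    fix x assume "x \<in> space unit_leb"
    then show "(\<phi> x)\<^sup>2 \<le> ?N\<^sup>2"
      using test_pointwise_bound[OF t, of x] by (simp add: abs_le_square_iff[symmetric])
  qed (use s in \<open>auto simp: square_integrable_def\<close>)
  also have "\<dots> = ?N\<^sup>2" by (simp add: measure_restrict_space)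
  finally show ?thesis by (rule power2_le_imp_le) simp
qed

lemma W12_0_poincare:
  assumes "u \<in> W12_0" "has_weak_deriv u u1"
  shows "norm u \<le> norm u1"
proof -
  obtain \<phi> where \<phi>: "\<And>n. \<phi> n \<in> test_functions {0<..<1}"
    "(\<lambda>n::nat. abs_L2 (\<phi> n)) \<longlonglongrightarrow> u" "(\<lambda>n. abs_L2 (deriv (\<phi> n))) \<longlonglongrightarrow> u1"
    using W12_0_iff[OF assms(2)] assms(1) by blast
  show ?thesis
    by (rule LIMSEQ_le[OF tendsto_norm[OF \<phi>(2)] tendsto_norm[OF \<phi>(3)]])
      (use test_poincare[OF \<phi>(1)] in blast)
qed

lemma W12_0_norm_deriv_le:
  assumes "u \<in> W12_0" "has_weak_deriv u u1" "has_weak_deriv u1 u2"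
  shows "norm u1 \<le> norm u2"
proof -
  obtain \<phi> where \<phi>: "\<And>n. \<phi> n \<in> test_functions {0<..<1}"
    "(\<lambda>n::nat. abs_L2 (\<phi> n)) \<longlonglongrightarrow> u" "(\<lambda>n. abs_L2 (deriv (\<phi> n))) \<longlonglongrightarrow> u1"
    using W12_0_iff[OF assms(2)] assms(1) by blast
  have "(\<lambda>n. inner u1 (abs_L2 (deriv (\<phi> n)))) \<longlonglongrightarrow> inner u1 u1"
    by (intro tendsto_intros \<phi>)
  moreover have "(\<lambda>n. - inner u2 (abs_L2 (\<phi> n))) \<longlonglongrightarrow> - inner u2 u"
    by (intro tendsto_intros \<phi>)
  moreover have "inner u1 (abs_L2 (deriv (\<phi> n))) = - inner u2 (abs_L2 (\<phi> n))" for n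
    using assms(3) \<phi>(1) by (simp add: has_weak_deriv_iff_inner)
  ultimately have "inner u1 u1 = - inner u2 u"
    using LIMSEQ_unique by simp
  also have "\<dots> \<le> norm u2 * norm u"
    using Cauchy_Schwarz_ineq2[of u2 u] by linarith
  also have "\<dots> \<le> norm u2 * norm u1"
    using W12_0_poincare[OF assms(1,2)] by (intro mult_left_mono) auto
  finally have "norm u1 * norm u1 \<le> norm u2 * norm u1"
    by (simp add: power2_norm_eq_inner[symmetric] power2_eq_square)
  then show ?thesis by (cases "u1 = 0") auto
qed

typedef W22 = "{u :: L2. \<exists>u1 u2. has_weak_deriv u u1 \<and> has_weak_deriv u1 u2}"
  morphisms W22_to_L2 Abs_W22
  using has_weak_deriv_zero by blast

setup_lifting type_definition_W22

definition D1 :: "W22 \<Rightarrow> L2" where "D1 u = weak_deriv (W22_to_L2 u)"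
definition D2 :: "W22 \<Rightarrow> L2" where "D2 u = weak_deriv (D1 u)"

lemma W22_has_weak_deriv:
  "has_weak_deriv (W22_to_L2 u) (D1 u)" "has_weak_deriv (D1 u) (D2 u)"
proof -
  obtain u1 u2 where "has_weak_deriv (W22_to_L2 u) u1" "has_weak_deriv u1 u2"
    using W22_to_L2[of u] by blast
  then show "has_weak_deriv (W22_to_L2 u) (D1 u)" "has_weak_deriv (D1 u) (D2 u)"
    using weak_deriv_eq by (auto simp: D1_def D2_def)
qed

lemma D1_D2_eqI:
  assumes "has_weak_deriv (W22_to_L2 u) u1" "has_weak_deriv u1 u2"
  shows "D1 u = u1" "D2 u = u2"
  using assms weak_deriv_eq by (auto simp: D1_def D2_def)

instantiation W22 :: real_vector
begin

lift_definition zero_W22 :: W22 is 0 using has_weak_deriv_zero by blast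

lift_definition plus_W22 :: "W22 \<Rightarrow> W22 \<Rightarrow> W22" is "(+)"
  using has_weak_deriv_add by blast

lift_definition scaleR_W22 :: "real \<Rightarrow> W22 \<Rightarrow> W22" is "(*\<^sub>R)"
  using has_weak_deriv_scaleR by blast

lift_definition uminus_W22 :: "W22 \<Rightarrow> W22" is uminus
  using has_weak_deriv_scaleR[of _ _ "-1"] by (simp add: scaleR_minus1_left) blast

lift_definition minus_W22 :: "W22 \<Rightarrow> W22 \<Rightarrow> W22" is "(-)"
proof -
  fix f g :: L2
  assume "\<exists>u1 u2. has_weak_deriv f u1 \<and> has_weak_deriv u1 u2"
    "\<exists>u1 u2. has_weak_deriv g u1 \<and> has_weak_deriv u1 u2"
  then obtain f1 f2 g1 g2 where "has_weak_deriv f f1" "has_weak_deriv f1 f2"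
    "has_weak_deriv g g1" "has_weak_deriv g1 g2" by blast
  then have "has_weak_deriv (f + (-1) *\<^sub>R g) (f1 + (-1) *\<^sub>R g1)"
    "has_weak_deriv (f1 + (-1) *\<^sub>R g1) (f2 + (-1) *\<^sub>R g2)"
    by (blast intro: has_weak_deriv_add has_weak_deriv_scaleR)+
  then show "\<exists>u1 u2. has_weak_deriv (f - g) u1 \<and> has_weak_deriv u1 u2" by auto
qed

instance
  by standard (transfer; simp add: algebra_simps)+

end

lemma W22_to_L2_simps:
  "W22_to_L2 0 = 0" "W22_to_L2 (u + v) = W22_to_L2 u + W22_to_L2 v"
  "W22_to_L2 (u - v) = W22_to_L2 u - W22_to_L2 v" "W22_to_L2 (c *\<^sub>R u) = c *\<^sub>R W22_to_L2 u"
  by (simp_all add: zero_W22.rep_eq plus_W22.rep_eq minus_W22.rep_eq scaleR_W22.rep_eq)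

lemma D1_D2_add: "D1 (u + v) = D1 u + D1 v" "D2 (u + v) = D2 u + D2 v"
proof -
  have "has_weak_deriv (W22_to_L2 (u + v)) (D1 u + D1 v)" "has_weak_deriv (D1 u + D1 v) (D2 u + D2 v)"
    by (simp_all add: W22_to_L2_simps has_weak_deriv_add W22_has_weak_deriv)
  then show "D1 (u + v) = D1 u + D1 v" "D2 (u + v) = D2 u + D2 v"
    by (blast intro: D1_D2_eqI)+
qed

lemma D1_D2_scaleR: "D1 (c *\<^sub>R u) = c *\<^sub>R D1 u" "D2 (c *\<^sub>R u) = c *\<^sub>R D2 u"
proof -
  have "has_weak_deriv (W22_to_L2 (c *\<^sub>R u)) (c *\<^sub>R D1 u)" "has_weak_deriv (c *\<^sub>R D1 u) (c *\<^sub>R D2 u)"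
    by (simp_all add: W22_to_L2_simps has_weak_deriv_scaleR W22_has_weak_deriv)
  then show "D1 (c *\<^sub>R u) = c *\<^sub>R D1 u" "D2 (c *\<^sub>R u) = c *\<^sub>R D2 u"
    by (blast intro: D1_D2_eqI)+
qed

lemma D1_D2_diff: "D1 (u - v) = D1 u - D1 v" "D2 (u - v) = D2 u - D2 v"
  using D1_D2_add[of u "(-1) *\<^sub>R v"] D1_D2_scaleR[of "-1" v] by simp_all

lemma D1_D2_zero: "D1 0 = 0" "D2 0 = 0"
  using D1_D2_scaleR[of 0 0] by simp_all

instantiation W22 :: real_inner
begin

(* The resulting norm is the full W^{2,2} norm. *)
definition inner_W22 :: "W22 \<Rightarrow> W22 \<Rightarrow> real" where
  "inner_W22 u v =
    inner (W22_to_L2 u) (W22_to_L2 v) + inner (D1 u) (D1 v) + inner (D2 u) (D2 v)"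
definition norm_W22 :: "W22 \<Rightarrow> real" where "norm_W22 u = sqrt (inner u u)"
definition dist_W22 :: "W22 \<Rightarrow> W22 \<Rightarrow> real" where "dist_W22 u v = norm (u - v)"
definition sgn_W22 :: "W22 \<Rightarrow> W22" where "sgn_W22 u = u /\<^sub>R norm u"
definition uniformity_W22 :: "(W22 \<times> W22) filter"
  where "uniformity_W22 = (INF e\<in>{0<..}. principal {(u, v). dist u v < e})"
definition open_W22 :: "W22 set \<Rightarrow> bool"
  where "open_W22 S = (\<forall>u\<in>S. \<forall>\<^sub>F (u', v) in uniformity. u' = u \<longrightarrow> v \<in> S)"

instance
proof
  fix u v w :: W22 and c :: real
  show "dist u v = norm (u - v)" by (rule dist_W22_def)
  show "sgn u = u /\<^sub>R norm u" by (rule sgn_W22_def)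
  show "uniformity = (INF e\<in>{0<..}. principal {(x::W22, y). dist x y < e})"
    by (rule uniformity_W22_def)
  show "open U = (\<forall>x\<in>U. \<forall>\<^sub>F (x', y) in uniformity. x' = x \<longrightarrow> y \<in> U)" for U :: "W22 set"
    by (rule open_W22_def)
  show "inner u v = inner v u"
    by (simp add: inner_W22_def inner_commute)
  show "inner (u + v) w = inner u w + inner v w"
    by (simp add: inner_W22_def W22_to_L2_simps D1_D2_add inner_add_left)
  show "inner (c *\<^sub>R u) v = c * inner u v"
    by (simp add: inner_W22_def W22_to_L2_simps D1_D2_scaleR algebra_simps)
  show "0 \<le> inner u u" by (simp add: inner_W22_def)
  show "(inner u u = 0) = (u = 0)"
  proof
    assume "inner u u = 0"
    then have "inner (W22_to_L2 u) (W22_to_L2 u) = 0"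
      using inner_ge_zero[of "W22_to_L2 u"] inner_ge_zero[of "D1 u"] inner_ge_zero[of "D2 u"]
      unfolding inner_W22_def by linarith
    then show "u = 0" by (metis W22_to_L2_inject W22_to_L2_simps(1) inner_eq_zero_iff)
  qed (simp add: inner_W22_def W22_to_L2_simps D1_D2_zero)
  show "norm u = sqrt (inner u u)" by (rule norm_W22_def)
qed

end

lemma W22_norm_eq: "(norm u)\<^sup>2 = (norm (W22_to_L2 u))\<^sup>2 + (norm (D1 u))\<^sup>2 + (norm (D2 u))\<^sup>2"
  by (simp add: power2_norm_eq_inner) (simp add: inner_W22_def)

lemma W22_norm_components:
  "norm (W22_to_L2 u) \<le> norm u" "norm (D1 u) \<le> norm u" "norm (D2 u) \<le> norm u"
  by (rule power2_le_imp_le, simp add: W22_norm_eq, simp)+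

lemma W22_tendstoI:
  assumes "(\<lambda>n. W22_to_L2 (X n)) \<longlonglongrightarrow> W22_to_L2 u" "(\<lambda>n. D1 (X n)) \<longlonglongrightarrow> D1 u"
    "(\<lambda>n. D2 (X n)) \<longlonglongrightarrow> D2 u"
  shows "X \<longlonglongrightarrow> u"
proof -
  have "(\<lambda>n. (norm (W22_to_L2 (X n) - W22_to_L2 u))\<^sup>2 + (norm (D1 (X n) - D1 u))\<^sup>2
      + (norm (D2 (X n) - D2 u))\<^sup>2) \<longlonglongrightarrow> 0\<^sup>2 + 0\<^sup>2 + 0\<^sup>2"
    by (intro tendsto_intros tendsto_norm_zero LIM_zero assms)
  then have "(\<lambda>n. sqrt ((norm (X n - u))\<^sup>2)) \<longlonglongrightarrow> sqrt 0"
    unfolding W22_norm_eq W22_to_L2_simps D1_D2_diff by (intro tendsto_real_sqrt) simp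
  then have "(\<lambda>n. norm (X n - u)) \<longlonglongrightarrow> 0" by simp
  then show ?thesis by (rule LIM_zero_cancel[OF tendsto_norm_zero_cancel])
qed

lemma L2_Cauchy_image:
  fixes X :: "nat \<Rightarrow> 'a::real_normed_vector" and T :: "'a \<Rightarrow> L2"
  assumes "Cauchy X" "\<And>u v. T (u - v) = T u - T v" "\<And>u. norm (T u) \<le> norm u"
  shows "Cauchy (\<lambda>n. T (X n))"
  using assms(1) unfolding Cauchy_def dist_norm
  by (metis (no_types, lifting) assms(2,3) le_less_trans)

instance W22 :: complete_space
proof
  fix X :: "nat \<Rightarrow> W22" assume X: "Cauchy X"
  obtain f where f: "(\<lambda>n. W22_to_L2 (X n)) \<longlonglongrightarrow> f"
    using L2_Cauchy_image[OF X W22_to_L2_simps(3) W22_norm_components(1)]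
      Cauchy_convergent convergent_def by blast
  obtain f1 where f1: "(\<lambda>n. D1 (X n)) \<longlonglongrightarrow> f1"
    using L2_Cauchy_image[OF X D1_D2_diff(1) W22_norm_components(2)]
      Cauchy_convergent convergent_def by blast
  obtain f2 where f2: "(\<lambda>n. D2 (X n)) \<longlonglongrightarrow> f2"
    using L2_Cauchy_image[OF X D1_D2_diff(2) W22_norm_components(3)]
      Cauchy_convergent convergent_def by blast
  have h: "has_weak_deriv f f1" "has_weak_deriv f1 f2"
    using has_weak_deriv_LIMSEQ[OF W22_has_weak_deriv(1) f f1]
      has_weak_deriv_LIMSEQ[OF W22_has_weak_deriv(2) f1 f2] by blast+
  define u where "u = Abs_W22 f"
  have u: "W22_to_L2 u = f" using h unfolding u_def by (intro Abs_W22_inverse) blast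
  have "D1 u = f1" "D2 u = f2" using D1_D2_eqI[of u f1 f2] h u by auto
  then have "X \<longlonglongrightarrow> u" using f f1 f2 u by (intro W22_tendstoI) auto
  then show "convergent X" by (rule convergentI)
qed

instance W22 :: banach ..

instance W22 :: second_countable_topology
proof
  have "dist (W22_to_L2 u, D1 u, D2 u) (W22_to_L2 v, D1 v, D2 v) = dist u v" for u v
  proof -
    have "(dist (W22_to_L2 u, D1 u, D2 u) (W22_to_L2 v, D1 v, D2 v))\<^sup>2 = (dist u v)\<^sup>2"
      by (simp add: dist_Pair_Pair) (simp add: dist_norm W22_norm_eq W22_to_L2_simps D1_D2_diff)
    then show ?thesis by (rule power2_eq_imp_eq) auto
  qed
  then show "\<exists>B::W22 set set. countable B \<and> open = generate_topology B"
    by (rule second_countable_if_isometry[of "\<lambda>u. (W22_to_L2 u, D1 u, D2 u)"])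
qed

typedef W22_W12_0 = "{u :: W22. W22_to_L2 u \<in> W12_0}"
  morphisms V_to_W22 Abs_V
  using zero_in_W12_0 W22_to_L2_simps(1) by (metis mem_Collect_eq)

setup_lifting type_definition_W22_W12_0

abbreviation V_to_L2 :: "W22_W12_0 \<Rightarrow> L2"
  where "V_to_L2 u \<equiv> W22_to_L2 (V_to_W22 u)"

instantiation W22_W12_0 :: real_vector
begin

lift_definition zero_W22_W12_0 :: W22_W12_0 is 0
  by (simp add: W22_to_L2_simps zero_in_W12_0)

lift_definition plus_W22_W12_0 :: "W22_W12_0 \<Rightarrow> W22_W12_0 \<Rightarrow> W22_W12_0" is "(+)"
  using W12_0_lincomb[of _ _ 1 1] by (simp add: W22_to_L2_simps)

lift_definition minus_W22_W12_0 :: "W22_W12_0 \<Rightarrow> W22_W12_0 \<Rightarrow> W22_W12_0" is "(-)"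
  using W12_0_lincomb[of _ _ 1 "-1"] by (simp add: W22_to_L2_simps)

lift_definition scaleR_W22_W12_0 :: "real \<Rightarrow> W22_W12_0 \<Rightarrow> W22_W12_0" is "(*\<^sub>R)"
  using W12_0_lincomb[of _ _ _ 0] by (force simp: W22_to_L2_simps)

lift_definition uminus_W22_W12_0 :: "W22_W12_0 \<Rightarrow> W22_W12_0" is uminus
proof -
  fix u assume "W22_to_L2 u \<in> W12_0"
  then show "W22_to_L2 (- u) \<in> W12_0"
    using W12_0_lincomb[of "W22_to_L2 u" "W22_to_L2 u" "-1" 0] W22_to_L2_simps(4)[of "-1" u]
    by simp
qed

instance
  by standard (transfer; simp add: algebra_simps)+

end

lemma V_to_W22_simps:
  "V_to_W22 0 = 0" "V_to_W22 (u + v) = V_to_W22 u + V_to_W22 v"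
  "V_to_W22 (u - v) = V_to_W22 u - V_to_W22 v" "V_to_W22 (c *\<^sub>R u) = c *\<^sub>R V_to_W22 u"
  by (simp_all add: zero_W22_W12_0.rep_eq plus_W22_W12_0.rep_eq minus_W22_W12_0.rep_eq
      scaleR_W22_W12_0.rep_eq)

lemma V_norms:
  "norm (W22_to_L2 (V_to_W22 u)) \<le> norm (D2 (V_to_W22 u))"
  "norm (D1 (V_to_W22 u)) \<le> norm (D2 (V_to_W22 u))"
proof -
  have u: "W22_to_L2 (V_to_W22 u) \<in> W12_0" using V_to_W22[of u] by simp
  show 1: "norm (D1 (V_to_W22 u)) \<le> norm (D2 (V_to_W22 u))"
    by (rule W12_0_norm_deriv_le[OF u]) (rule W22_has_weak_deriv)+
  show "norm (W22_to_L2 (V_to_W22 u)) \<le> norm (D2 (V_to_W22 u))"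
    using W12_0_poincare[OF u W22_has_weak_deriv(1)] 1 by linarith
qed

instantiation W22_W12_0 :: real_inner
begin

(* On the intersection of W^{2,2} and W_0^{1,2} the norm is the L2 norm of the second derivative. *)
definition inner_W22_W12_0 :: "W22_W12_0 \<Rightarrow> W22_W12_0 \<Rightarrow> real" where
  "inner_W22_W12_0 u v = inner (D2 (V_to_W22 u)) (D2 (V_to_W22 v))"
definition norm_W22_W12_0 :: "W22_W12_0 \<Rightarrow> real" where
  "norm_W22_W12_0 u = norm (D2 (V_to_W22 u))"
definition dist_W22_W12_0 :: "W22_W12_0 \<Rightarrow> W22_W12_0 \<Rightarrow> real" where
  "dist_W22_W12_0 u v = norm (u - v)"
definition sgn_W22_W12_0 :: "W22_W12_0 \<Rightarrow> W22_W12_0" where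
  "sgn_W22_W12_0 u = u /\<^sub>R norm u"
definition uniformity_W22_W12_0 :: "(W22_W12_0 \<times> W22_W12_0) filter"
  where "uniformity_W22_W12_0 = (INF e\<in>{0<..}. principal {(u, v). dist u v < e})"
definition open_W22_W12_0 :: "W22_W12_0 set \<Rightarrow> bool"
  where "open_W22_W12_0 S = (\<forall>u\<in>S. \<forall>\<^sub>F (u', v) in uniformity. u' = u \<longrightarrow> v \<in> S)"

instance
proof
  fix u v w :: W22_W12_0 and c :: real
  show "dist u v = norm (u - v)" by (rule dist_W22_W12_0_def)
  show "sgn u = u /\<^sub>R norm u" by (rule sgn_W22_W12_0_def)
  show "uniformity = (INF e\<in>{0<..}. principal {(x::W22_W12_0, y). dist x y < e})"
    by (rule uniformity_W22_W12_0_def)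
  show "open U = (\<forall>x\<in>U. \<forall>\<^sub>F (x', y) in uniformity. x' = x \<longrightarrow> y \<in> U)" for U :: "W22_W12_0 set"
    by (rule open_W22_W12_0_def)
  show "inner u v = inner v u"
    by (simp add: inner_W22_W12_0_def inner_commute)
  show "inner (u + v) w = inner u w + inner v w"
    by (simp add: inner_W22_W12_0_def V_to_W22_simps D1_D2_add inner_add_left)
  show "inner (c *\<^sub>R u) v = c * inner u v"
    by (simp add: inner_W22_W12_0_def V_to_W22_simps D1_D2_scaleR)
  show "0 \<le> inner u u" by (simp add: inner_W22_W12_0_def)
  show "(inner u u = 0) = (u = 0)"
  proof
    assume "inner u u = 0"
    then have "norm (D2 (V_to_W22 u)) = 0" by (simp add: inner_W22_W12_0_def)
    then have "W22_to_L2 (V_to_W22 u) = 0" using V_norms(1)[of u] by simp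
    then show "u = 0" by (metis W22_to_L2_inject W22_to_L2_simps(1) V_to_W22_inject V_to_W22_simps(1))
  qed (simp add: inner_W22_W12_0_def V_to_W22_simps D1_D2_zero)
  show "norm u = sqrt (inner u u)"
    by (simp add: norm_W22_W12_0_def inner_W22_W12_0_def norm_eq_sqrt_inner)
qed

end

instance W22_W12_0 :: complete_space
proof
  fix X :: "nat \<Rightarrow> W22_W12_0" assume X: "Cauchy X"
  define Y where "Y n = V_to_W22 (X n)" for n
  have le: "norm (W22_to_L2 (V_to_W22 u)) \<le> norm u" "norm (D1 (V_to_W22 u)) \<le> norm u"
    "norm (D2 (V_to_W22 u)) \<le> norm u" for u
    using V_norms[of u] by (simp_all add: norm_W22_W12_0_def)
  have "norm (V_to_W22 u) \<le> 2 * norm u" for u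
  proof (rule power2_le_imp_le)
    have "(norm (V_to_W22 u))\<^sup>2 \<le> (norm u)\<^sup>2 + (norm u)\<^sup>2 + (norm u)\<^sup>2"
      unfolding W22_norm_eq by (intro add_mono power_mono le norm_ge_zero)
    then show "(norm (V_to_W22 u))\<^sup>2 \<le> (2 * norm u)\<^sup>2"
      using zero_le_square[of "norm u"] unfolding power2_eq_square by linarith
  qed simp
  then have le2: "dist (Y m) (Y n) \<le> 2 * dist (X m) (X n)" for m n
    by (metis Y_def V_to_W22_simps(3) dist_norm)
  have "Cauchy Y"
  proof (rule metric_CauchyI)
    fix e :: real assume "e > 0"
    then obtain M where "\<forall>m\<ge>M. \<forall>n\<ge>M. dist (X m) (X n) < e / 2"
      using metric_CauchyD[OF X, of "e / 2"] by auto
    with le2 show "\<exists>M. \<forall>m\<ge>M. \<forall>n\<ge>M. dist (Y m) (Y n) < e"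
      by (smt (verit) field_sum_of_halves)
  qed
  then obtain w where w: "Y \<longlonglongrightarrow> w" using Cauchy_convergent convergent_def by blast
  have tend: "(\<lambda>n. T (Y n)) \<longlonglongrightarrow> T w"
    if "\<And>u v. T (u - v) = T u - T v" "\<And>u. norm (T u) \<le> norm u" for T :: "W22 \<Rightarrow> L2"
  proof -
    have "(\<lambda>n. norm (Y n - w)) \<longlonglongrightarrow> 0" using w by (simp add: LIM_zero tendsto_norm_zero)
    then have "(\<lambda>n. T (Y n) - T w) \<longlonglongrightarrow> 0"
      by (rule Lim_null_comparison[rotated]) (simp add: that(1)[symmetric] that(2))
    then show ?thesis by (rule LIM_zero_cancel)
  qed
  have t0: "(\<lambda>n. W22_to_L2 (Y n)) \<longlonglongrightarrow> W22_to_L2 w"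
    by (rule tend[OF W22_to_L2_simps(3) W22_norm_components(1)])
  have t1: "(\<lambda>n. D1 (Y n)) \<longlonglongrightarrow> D1 w"
    by (rule tend[OF D1_D2_diff(1) W22_norm_components(2)])
  have t2: "(\<lambda>n. D2 (Y n)) \<longlonglongrightarrow> D2 w"
    by (rule tend[OF D1_D2_diff(2) W22_norm_components(3)])
  have "\<exists>\<phi>. \<phi> \<in> test_functions {0<..<1} \<and>
      norm (abs_L2 \<phi> - W22_to_L2 (Y n)) < 1 / real (Suc n) \<and>
      norm (abs_L2 (deriv \<phi>) - D1 (Y n)) < 1 / real (Suc n)" for n
  proof -
    have "W22_to_L2 (Y n) \<in> W12_0" using V_to_W22[of "X n"] by (simp add: Y_def)
    then obtain \<phi> where \<phi>: "\<And>n. \<phi> n \<in> test_functions {0<..<1}"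
      "(\<lambda>k::nat. abs_L2 (\<phi> k)) \<longlonglongrightarrow> W22_to_L2 (Y n)" "(\<lambda>k. abs_L2 (deriv (\<phi> k))) \<longlonglongrightarrow> D1 (Y n)"
      using W12_0_iff[OF W22_has_weak_deriv(1)] by blast
    have "\<forall>\<^sub>F k in sequentially. dist (abs_L2 (\<phi> k)) (W22_to_L2 (Y n)) < 1 / real (Suc n)"
      "\<forall>\<^sub>F k in sequentially. dist (abs_L2 (deriv (\<phi> k))) (D1 (Y n)) < 1 / real (Suc n)"
      using \<phi>(2,3) by (auto intro!: tendstoD)
    then have "\<forall>\<^sub>F k in sequentially. dist (abs_L2 (\<phi> k)) (W22_to_L2 (Y n)) < 1 / real (Suc n) \<and>
        dist (abs_L2 (deriv (\<phi> k))) (D1 (Y n)) < 1 / real (Suc n)"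
      by (rule eventually_conj)
    then obtain k where "dist (abs_L2 (\<phi> k)) (W22_to_L2 (Y n)) < 1 / real (Suc n)"
      "dist (abs_L2 (deriv (\<phi> k))) (D1 (Y n)) < 1 / real (Suc n)"
      using eventually_happens by force
    then show ?thesis using \<phi>(1) by (intro exI[of _ "\<phi> k"]) (simp add: dist_norm)
  qed
  then obtain \<phi> where \<phi>: "\<And>n. \<phi> n \<in> test_functions {0<..<1}"
    "\<And>n. norm (abs_L2 (\<phi> n) - W22_to_L2 (Y n)) < 1 / real (Suc n)"
    "\<And>n. norm (abs_L2 (deriv (\<phi> n)) - D1 (Y n)) < 1 / real (Suc n)"
    by metis
  have inv: "(\<lambda>n. 1 / real (Suc n)) \<longlonglongrightarrow> 0" by (rule LIMSEQ_Suc[OF lim_1_over_n])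
  have "(\<lambda>n. abs_L2 (\<phi> n) - W22_to_L2 (Y n)) \<longlonglongrightarrow> 0"
    by (rule Lim_null_comparison[OF _ inv]) (intro always_eventually allI less_imp_le \<phi>)
  from tendsto_add[OF this t0] have a0: "(\<lambda>n. abs_L2 (\<phi> n)) \<longlonglongrightarrow> W22_to_L2 w" by simp
  have "(\<lambda>n. abs_L2 (deriv (\<phi> n)) - D1 (Y n)) \<longlonglongrightarrow> 0"
    by (rule Lim_null_comparison[OF _ inv]) (intro always_eventually allI less_imp_le \<phi>)
  from tendsto_add[OF this t1] have a1: "(\<lambda>n. abs_L2 (deriv (\<phi> n))) \<longlonglongrightarrow> D1 w" by simp
  have "W22_to_L2 w \<in> W12_0"
    using W12_0_iff[OF W22_has_weak_deriv(1)] \<phi>(1) a0 a1 by blast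
  then have wV: "V_to_W22 (Abs_V w) = w" by (simp add: Abs_V_inverse)
  have "(\<lambda>n. norm (X n - Abs_V w)) \<longlonglongrightarrow> 0"
    using tendsto_norm_zero[OF LIM_zero[OF t2]]
    by (simp add: norm_W22_W12_0_def V_to_W22_simps D1_D2_diff wV Y_def)
  then have "X \<longlonglongrightarrow> Abs_V w" by (rule LIM_zero_cancel[OF tendsto_norm_zero_cancel])
  then show "convergent X" by (rule convergentI)
qed

instance W22_W12_0 :: banach ..

instance W22_W12_0 :: second_countable_topology
proof
  show "\<exists>B::W22_W12_0 set set. countable B \<and> open = generate_topology B"
    by (rule second_countable_if_isometry[of "\<lambda>u. D2 (V_to_W22 u)"])
      (simp add: dist_norm norm_W22_W12_0_def V_to_W22_simps D1_D2_diff)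
qed


subsection \<open>The space \<open>C\<^sup>1([0,1])\<close>\<close>

definition C1_on_unit :: "(real \<Rightarrow> real) \<Rightarrow> bool" where
  "C1_on_unit f \<longleftrightarrow> (\<exists>f'. continuous_on {0..1} f' \<and>
    (\<forall>x\<in>{0..1}. (f has_real_derivative f' x) (at x within {0..1})))"

(* Elements of C^1([0,1]), with one-sided derivatives at the end points; they are extended by zero
   outside of [0,1] so that equality of elements is equality of functions on [0,1]. *)
typedef C1 = "{f :: real \<Rightarrow> real. C1_on_unit f \<and> (\<forall>x. x \<notin> {0..1} \<longrightarrow> f x = 0)}"
  morphisms C1_fun Abs_C1
proof
  show "(\<lambda>x. 0) \<in> {f. C1_on_unit f \<and> (\<forall>x. x \<notin> {0..1} \<longrightarrow> f x = 0)}"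
    by (auto simp: C1_on_unit_def intro!: exI[of _ "\<lambda>x. 0"])
qed

setup_lifting type_definition_C1

definition C1_deriv :: "C1 \<Rightarrow> real \<Rightarrow> real" where
  "C1_deriv f x = vector_derivative (C1_fun f) (at x within {0..1})"

lemma C1_deriv_eqI:
  assumes "(C1_fun f has_real_derivative d) (at x within {0..1})" "x \<in> {0..1}"
  shows "C1_deriv f x = d"
  using assms vector_derivative_within_closed_interval[of 0 1 x "C1_fun f" d]
  by (simp add: C1_deriv_def has_real_derivative_iff_has_vector_derivative)

lemma C1_props:
  shows C1_has_deriv: "x \<in> {0..1} \<Longrightarrow> (C1_fun f has_real_derivative C1_deriv f x) (at x within {0..1})"
    and C1_deriv_continuous: "continuous_on {0..1} (C1_deriv f)"
    and C1_continuous: "continuous_on {0..1} (C1_fun f)"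
    and C1_outside: "x \<notin> {0..1} \<Longrightarrow> C1_fun f x = 0"
proof -
  obtain f' where f': "continuous_on {0..1} f'"
    "\<And>x. x \<in> {0..1} \<Longrightarrow> (C1_fun f has_real_derivative f' x) (at x within {0..1})"
    using C1_fun[of f] unfolding C1_on_unit_def by blast
  have eq: "C1_deriv f x = f' x" if "x \<in> {0..1}" for x
    using C1_deriv_eqI f'(2) that by blast
  show *: "x \<in> {0..1} \<Longrightarrow> (C1_fun f has_real_derivative C1_deriv f x) (at x within {0..1})" for x
    using f'(2) eq by simp
  show "continuous_on {0..1} (C1_deriv f)"
    by (rule continuous_on_eq[OF f'(1)]) (rule eq[symmetric])
  show "continuous_on {0..1} (C1_fun f)"
    by (rule DERIV_continuous_on) (rule *)
  show "x \<notin> {0..1} \<Longrightarrow> C1_fun f x = 0"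
    using C1_fun[of f] by blast
qed

lemma C1_on_unit_I:
  "(\<And>x. x \<in> {0..1} \<Longrightarrow> (f has_real_derivative f' x) (at x within {0..1})) \<Longrightarrow>
    continuous_on {0..1} f' \<Longrightarrow> C1_on_unit f"
  unfolding C1_on_unit_def by blast

lemma C1_on_unit_lincomb:
  assumes "C1_on_unit f" "C1_on_unit g"
  shows "C1_on_unit (\<lambda>x. a * f x + b * g x)"
proof -
  obtain f' g' where "continuous_on {0..1} f'" "continuous_on {0..1} g'"
    "\<And>x. x \<in> {0..1} \<Longrightarrow> (f has_real_derivative f' x) (at x within {0..1})"
    "\<And>x. x \<in> {0..1} \<Longrightarrow> (g has_real_derivative g' x) (at x within {0..1})"
    using assms unfolding C1_on_unit_def by blast
  then show ?thesis
    by (intro C1_on_unit_I[of _ "\<lambda>x. a * f' x + b * g' x"] DERIV_add DERIV_cmult continuous_intros) auto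
qed

instantiation C1 :: real_vector
begin

lift_definition zero_C1 :: C1 is "\<lambda>x. 0"
  by (auto simp: C1_on_unit_def intro!: exI[of _ "\<lambda>x. 0"])

lift_definition plus_C1 :: "C1 \<Rightarrow> C1 \<Rightarrow> C1" is "\<lambda>f g x. f x + g x"
  using C1_on_unit_lincomb[of _ _ 1 1] by auto

lift_definition minus_C1 :: "C1 \<Rightarrow> C1 \<Rightarrow> C1" is "\<lambda>f g x. f x - g x"
  using C1_on_unit_lincomb[of _ _ 1 "-1"] by auto

lift_definition uminus_C1 :: "C1 \<Rightarrow> C1" is "\<lambda>f x. - f x"
  using C1_on_unit_lincomb[of _ _ "-1" 0] by auto

lift_definition scaleR_C1 :: "real \<Rightarrow> C1 \<Rightarrow> C1" is "\<lambda>c f x. c * f x"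
  using C1_on_unit_lincomb[of _ _ _ 0] by auto

instance
  by standard (transfer; simp add: algebra_simps)+

end

lemma C1_fun_simps:
  "C1_fun 0 x = 0" "C1_fun (f + g) x = C1_fun f x + C1_fun g x"
  "C1_fun (f - g) x = C1_fun f x - C1_fun g x" "C1_fun (c *\<^sub>R f) x = c * C1_fun f x"
  by (simp_all add: zero_C1.rep_eq plus_C1.rep_eq minus_C1.rep_eq scaleR_C1.rep_eq)

lemma C1_deriv_simps:
  assumes x: "x \<in> {0..1}"
  shows "C1_deriv 0 x = 0" "C1_deriv (f + g) x = C1_deriv f x + C1_deriv g x"
    "C1_deriv (f - g) x = C1_deriv f x - C1_deriv g x" "C1_deriv (c *\<^sub>R f) x = c * C1_deriv f x"
proof -
  note h = C1_has_deriv[OF x]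
  have e: "C1_fun 0 = (\<lambda>x. 0)" "C1_fun (f + g) = (\<lambda>x. C1_fun f x + C1_fun g x)"
    "C1_fun (f - g) = (\<lambda>x. C1_fun f x - C1_fun g x)" "C1_fun (c *\<^sub>R f) = (\<lambda>x. c * C1_fun f x)"
    by (auto simp: C1_fun_simps)
  show "C1_deriv 0 x = 0"
    by (rule C1_deriv_eqI[OF _ x]) (simp add: e)
  show "C1_deriv (f + g) x = C1_deriv f x + C1_deriv g x"
    by (rule C1_deriv_eqI[OF _ x], unfold e, rule DERIV_add[OF h h])
  show "C1_deriv (f - g) x = C1_deriv f x - C1_deriv g x"
    by (rule C1_deriv_eqI[OF _ x], unfold e, rule DERIV_diff[OF h h])
  show "C1_deriv (c *\<^sub>R f) x = c * C1_deriv f x"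
    by (rule C1_deriv_eqI[OF _ x], unfold e, rule DERIV_cmult[OF h])
qed

definition sup_unit :: "(real \<Rightarrow> real) \<Rightarrow> real" where
  "sup_unit f = (SUP x\<in>{0..1}. \<bar>f x\<bar>)"

lemma sup_unit_upper:
  assumes "continuous_on {0..1} f" "x \<in> {0..1}"
  shows "\<bar>f x\<bar> \<le> sup_unit f"
proof -
  have "compact ((\<lambda>x. \<bar>f x\<bar>) ` {0..1})"
    using assms(1) by (intro compact_continuous_image continuous_on_rabs) auto
  then have "bdd_above ((\<lambda>x. \<bar>f x\<bar>) ` {0..1})"
    by (intro bounded_imp_bdd_above compact_imp_bounded)
  then show ?thesis unfolding sup_unit_def using assms(2) by (intro cSUP_upper)
qed

lemma sup_unit_least: "(\<And>x. x \<in> {0..1} \<Longrightarrow> \<bar>f x\<bar> \<le> b) \<Longrightarrow> sup_unit f \<le> b"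
  unfolding sup_unit_def by (intro cSUP_least) auto

lemma sup_unit_nonneg: "continuous_on {0..1} f \<Longrightarrow> 0 \<le> sup_unit f"
  using sup_unit_upper[of f 0] by force

lemma sup_unit_cong: "(\<And>x. x \<in> {0..1} \<Longrightarrow> f x = g x) \<Longrightarrow> sup_unit f = sup_unit g"
  unfolding sup_unit_def by (auto intro!: arg_cong[of _ _ Sup])

lemma sup_unit_add:
  assumes "continuous_on {0..1} f" "continuous_on {0..1} g"
  shows "sup_unit (\<lambda>x. f x + g x) \<le> sup_unit f + sup_unit g"
proof (rule sup_unit_least)
  fix x :: real assume x: "x \<in> {0..1}"
  show "\<bar>f x + g x\<bar> \<le> sup_unit f + sup_unit g"
    using sup_unit_upper[OF assms(1) x] sup_unit_upper[OF assms(2) x] by linarith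
qed

lemma sup_unit_scale_le:
  assumes "continuous_on {0..1} f"
  shows "sup_unit (\<lambda>x. c * f x) \<le> \<bar>c\<bar> * sup_unit f"
  by (rule sup_unit_least) (auto simp: abs_mult intro!: mult_left_mono sup_unit_upper assms)

lemma sup_unit_scale:
  assumes f: "continuous_on {0..1} f"
  shows "sup_unit (\<lambda>x. c * f x) = \<bar>c\<bar> * sup_unit f"
proof (cases "c = 0")
  case True
  then show ?thesis by (simp add: sup_unit_def)
next
  case False
  have c: "continuous_on {0..1} (\<lambda>x. c * f x)" using f by (intro continuous_intros)
  have "sup_unit f = sup_unit (\<lambda>x. inverse c * (c * f x))"
    using False by (simp add: mult.assoc[symmetric])
  also have "\<dots> \<le> \<bar>inverse c\<bar> * sup_unit (\<lambda>x. c * f x)" by (rule sup_unit_scale_le[OF c])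
  finally have "\<bar>c\<bar> * sup_unit f \<le> sup_unit (\<lambda>x. c * f x)"
    using False by (simp add: field_simps abs_mult)
  with sup_unit_scale_le[OF f, of c] show ?thesis by simp
qed

instantiation C1 :: real_normed_vector
begin

definition norm_C1 :: "C1 \<Rightarrow> real" where
  "norm_C1 f = (SUP x\<in>{0..1}. \<bar>C1_fun f x\<bar>) + (SUP x\<in>{0..1}. \<bar>C1_deriv f x\<bar>)"
definition dist_C1 :: "C1 \<Rightarrow> C1 \<Rightarrow> real" where "dist_C1 f g = norm (f - g)"
definition sgn_C1 :: "C1 \<Rightarrow> C1" where "sgn_C1 f = f /\<^sub>R norm f"
definition uniformity_C1 :: "(C1 \<times> C1) filter"
  where "uniformity_C1 = (INF e\<in>{0<..}. principal {(f, g). dist f g < e})"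
definition open_C1 :: "C1 set \<Rightarrow> bool"
  where "open_C1 S = (\<forall>f\<in>S. \<forall>\<^sub>F (f', g) in uniformity. f' = f \<longrightarrow> g \<in> S)"

lemma norm_C1_sup: "norm f = sup_unit (C1_fun f) + sup_unit (C1_deriv f)" for f :: C1
  by (simp add: norm_C1_def sup_unit_def)

instance
proof
  fix f g :: C1 and a :: real
  show "dist f g = norm (f - g)" by (rule dist_C1_def)
  show "sgn f = f /\<^sub>R norm f" by (rule sgn_C1_def)
  show "uniformity = (INF e\<in>{0<..}. principal {(x::C1, y). dist x y < e})"
    by (rule uniformity_C1_def)
  show "open U = (\<forall>x\<in>U. \<forall>\<^sub>F (x', y) in uniformity. x' = x \<longrightarrow> y \<in> U)" for U :: "C1 set"
    by (rule open_C1_def)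
  show "(norm f = 0) = (f = 0)"
  proof
    assume "norm f = 0"
    then have "sup_unit (C1_fun f) = 0"
      using sup_unit_nonneg[OF C1_continuous[of f]] sup_unit_nonneg[OF C1_deriv_continuous[of f]]
      unfolding norm_C1_sup by linarith
    then have "C1_fun f x = 0" for x
      using sup_unit_upper[OF C1_continuous[of f], of x] C1_outside[of x f] by (cases "x \<in> {0..1}") auto
    then have "C1_fun f = C1_fun 0" by (auto simp: C1_fun_simps)
    then show "f = 0" by (simp add: C1_fun_inject)
  next
    assume "f = 0"
    moreover have "sup_unit (C1_deriv 0) = sup_unit (\<lambda>x. 0)"
      by (rule sup_unit_cong) (simp add: C1_deriv_simps)
    ultimately show "norm f = 0"
      unfolding norm_C1_sup by (simp add: sup_unit_def C1_fun_simps)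
  qed
  have 1: "sup_unit (C1_fun (f + g)) \<le> sup_unit (C1_fun f) + sup_unit (C1_fun g)"
    using sup_unit_add[OF C1_continuous[of f] C1_continuous[of g]]
    by (simp add: sup_unit_def C1_fun_simps)
  have "sup_unit (C1_deriv (f + g)) = sup_unit (\<lambda>x. C1_deriv f x + C1_deriv g x)"
    by (rule sup_unit_cong) (simp add: C1_deriv_simps)
  then show "norm (f + g) \<le> norm f + norm g"
    using 1 sup_unit_add[OF C1_deriv_continuous[of f] C1_deriv_continuous[of g]]
    unfolding norm_C1_sup by linarith
  have 2: "sup_unit (C1_fun (a *\<^sub>R f)) = \<bar>a\<bar> * sup_unit (C1_fun f)"
    using sup_unit_scale[OF C1_continuous[of f], of a] by (simp add: sup_unit_def C1_fun_simps)
  have "sup_unit (C1_deriv (a *\<^sub>R f)) = sup_unit (\<lambda>x. a * C1_deriv f x)"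
    by (rule sup_unit_cong) (simp add: C1_deriv_simps)
  then show "norm (a *\<^sub>R f) = \<bar>a\<bar> * norm f"
    using 2 sup_unit_scale[OF C1_deriv_continuous[of f], of a]
    unfolding norm_C1_sup by (simp add: distrib_left)
qed

end

lemma C1_le_norm:
  assumes "x \<in> {0..1}"
  shows "\<bar>C1_fun f x\<bar> \<le> norm f" "\<bar>C1_deriv f x\<bar> \<le> norm f"
  using sup_unit_upper[OF C1_continuous[of f] assms] sup_unit_upper[OF C1_deriv_continuous[of f] assms]
    sup_unit_nonneg[OF C1_continuous[of f]] sup_unit_nonneg[OF C1_deriv_continuous[of f]]
  unfolding norm_C1_sup by linarith+

lemma norm_C1_leI:
  assumes "\<And>x. x \<in> {0..1} \<Longrightarrow> \<bar>C1_fun f x\<bar> \<le> a" "\<And>x. x \<in> {0..1} \<Longrightarrow> \<bar>C1_deriv f x\<bar> \<le> b"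
  shows "norm f \<le> a + b"
  unfolding norm_C1_sup by (intro add_mono sup_unit_least assms)

instance C1 :: complete_space
proof
  fix X :: "nat \<Rightarrow> C1" assume X: "Cauchy X"
  have bd: "\<exists>N. \<forall>m\<ge>N. \<forall>n\<ge>N. \<forall>x\<in>{0..1}. \<bar>C1_fun (X m) x - C1_fun (X n) x\<bar> < e \<and>
      \<bar>C1_deriv (X m) x - C1_deriv (X n) x\<bar> < e" if "e > 0" for e
  proof -
    obtain N where "\<forall>m\<ge>N. \<forall>n\<ge>N. norm (X m - X n) < e"
      using X \<open>e > 0\<close> unfolding Cauchy_def dist_norm by blast
    then have "\<bar>C1_fun (X m) x - C1_fun (X n) x\<bar> < e \<and> \<bar>C1_deriv (X m) x - C1_deriv (X n) x\<bar> < e"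
      if "m \<ge> N" "n \<ge> N" "x \<in> {0..1}" for m n x
      using C1_le_norm[OF that(3), of "X m - X n"] that
      by (auto simp: C1_fun_simps C1_deriv_simps intro: le_less_trans)
    then show ?thesis by blast
  qed
  have "uniformly_convergent_on {0..1} (\<lambda>n. C1_fun (X n))"
    "uniformly_convergent_on {0..1} (\<lambda>n. C1_deriv (X n))"
    by (intro Cauchy_uniformly_convergent; unfold uniformly_Cauchy_on_def dist_real_def; metis bd)+
  then obtain F G where F: "uniform_limit {0..1} (\<lambda>n. C1_fun (X n)) F sequentially"
    and G: "uniform_limit {0..1} (\<lambda>n. C1_deriv (X n)) G sequentially"
    unfolding uniformly_convergent_on_def by blast
  have Gc: "continuous_on {0..1} G"
    by (rule uniform_limit_theorem[OF _ G]) (simp_all add: C1_deriv_continuous)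
  have Fp: "(\<lambda>n. C1_fun (X n) x) \<longlonglongrightarrow> F x" if "x \<in> {0..1}" for x
    using tendsto_uniform_limitI[OF F that] .
  have "\<exists>g. \<forall>x\<in>{0..1}. (\<lambda>n. C1_fun (X n) x) \<longlonglongrightarrow> g x \<and>
      (g has_derivative (\<lambda>h. G x * h)) (at x within {0..1})"
  proof (rule has_derivative_sequence)
    show "convex {0..1 :: real}" by simp
    show "(C1_fun (X n) has_derivative (\<lambda>h. C1_deriv (X n) x * h)) (at x within {0..1})"
      if "x \<in> {0..1}" for n x
      using C1_has_deriv[OF that, of "X n"] by (simp add: has_field_derivative_def)
    show "\<forall>\<^sub>F n in sequentially. \<forall>x\<in>{0..1}. \<forall>h. norm (C1_deriv (X n) x * h - G x * h) \<le> e * norm h"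
      if "e > 0" for e
      using uniform_limitD[OF G that]
    proof eventually_elim
      case (elim n)
      then have "\<bar>C1_deriv (X n) x - G x\<bar> \<le> e" if "x \<in> {0..1}" for x
        using that by (auto simp: dist_real_def intro: less_imp_le)
      then show ?case
        by (auto simp: left_diff_distrib[symmetric] abs_mult intro!: mult_right_mono)
    qed
    show "(0::real) \<in> {0..1}" by simp
    then show "(\<lambda>n. C1_fun (X n) 0) \<longlonglongrightarrow> F 0" by (rule Fp)
  qed
  then obtain g where g: "\<And>x. x \<in> {0..1} \<Longrightarrow> (\<lambda>n. C1_fun (X n) x) \<longlonglongrightarrow> g x"
    "\<And>x. x \<in> {0..1} \<Longrightarrow> (g has_real_derivative G x) (at x within {0..1})"
    unfolding has_field_derivative_def by blast
  define k where "k x = (if x \<in> {0..1} then g x else 0)" for x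
  have kd: "(k has_real_derivative G x) (at x within {0..1})" if "x \<in> {0..1}" for x
    using g(2)[OF that] by (rule has_field_derivative_transform_within[of _ _ _ _ 1]) (use that in \<open>auto simp: k_def\<close>)
  have "C1_on_unit k" using kd Gc by (rule C1_on_unit_I)
  then have kfun: "C1_fun (Abs_C1 k) = k"
    by (intro Abs_C1_inverse) (auto simp: k_def)
  have der: "C1_deriv (Abs_C1 k) x = G x" if "x \<in> {0..1}" for x
    by (rule C1_deriv_eqI[OF _ that]) (use that in \<open>simp add: kfun kd\<close>)
  have Fk: "F x = k x" if "x \<in> {0..1}" for x
    using LIMSEQ_unique[OF Fp[OF that] g(1)[OF that]] that by (simp add: k_def)
  have "X \<longlonglongrightarrow> Abs_C1 k"
  proof (rule tendstoI)
    fix e :: real assume "e > 0"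
    then have "\<forall>\<^sub>F n in sequentially. \<forall>x\<in>{0..1}. dist (C1_fun (X n) x) (F x) < e / 4"
      "\<forall>\<^sub>F n in sequentially. \<forall>x\<in>{0..1}. dist (C1_deriv (X n) x) (G x) < e / 4"
      by (intro uniform_limitD[OF F] uniform_limitD[OF G]; simp)+
    then show "\<forall>\<^sub>F n in sequentially. dist (X n) (Abs_C1 k) < e"
    proof eventually_elim
      case (elim n)
      have "norm (X n - Abs_C1 k) \<le> e / 4 + e / 4"
        by (rule norm_C1_leI) (use elim in \<open>auto simp: C1_fun_simps C1_deriv_simps kfun der Fk
            dist_real_def intro: less_imp_le\<close>)
      then show ?case using \<open>e > 0\<close> by (simp add: dist_norm)
    qed
  qed
  then show "convergent X" by (rule convergentI)
qed

instance C1 :: banach ..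

lemma C1_square_integrable: "C1_fun f \<in> square_integrable"
proof (rule square_integrable_bounded)
  have "C1_fun f \<in> borel_measurable (lebesgue_on {0..1})"
    by (rule continuous_imp_measurable_on_sets_lebesgue[OF C1_continuous]) simp
  then show "C1_fun f \<in> borel_measurable unit_leb"
    by (rule measurable_restrict_mono) auto
  show "\<bar>C1_fun f x\<bar> \<le> norm f" if "0 < x" "x < 1" for x
    using C1_le_norm(1)[of x f] that by simp
qed

definition C1_to_L2 :: "C1 \<Rightarrow> L2" where
  "C1_to_L2 f = abs_L2 (C1_fun f)"


subsection \<open>The elastic energy and the obstacle\<close>

definition elastic_energy :: "W22_W12_0 \<Rightarrow> real" where
  "elastic_energy u =
    (LINT x|unit_leb. (rep_L2 (D2 (V_to_W22 u)) x)\<^sup>2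
      / (1 + (rep_L2 (D1 (V_to_W22 u)) x)\<^sup>2) powr (5 / 2))"

(* Frechet derivative for the norm of W22_W12_0, i.e. for the L2 norm of the second derivative. *)
definition energy_deriv :: "W22_W12_0 \<Rightarrow> W22_W12_0 \<Rightarrow> real" where
  "energy_deriv u = frechet_derivative elastic_energy (at u)"

definition c0 :: real where
  "c0 = (LINT t|lborel. (1 + t\<^sup>2) powr (- (5 / 4)))"

definition obstacle :: "(real \<Rightarrow> real) \<Rightarrow> bool" where
  "obstacle \<psi> \<longleftrightarrow>
    continuous_on {0..1} \<psi> \<and> \<psi> 0 < 0 \<and> \<psi> 1 < 0 \<and> (\<exists>x0\<in>{0<..<1}. \<psi> x0 > 0)"

definition admissible :: "(real \<Rightarrow> real) \<Rightarrow> W22_W12_0 set" where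
  "admissible \<psi> = {u. AE x in unit_leb. rep_L2 (V_to_L2 u) x \<ge> \<psi> x}"

definition M_crit :: "(real \<Rightarrow> real) \<Rightarrow> W22_W12_0 \<Rightarrow> W22_W12_0 set" where
  "M_crit \<psi> u0 =
    {w \<in> admissible \<psi>. (\<forall>v\<in>admissible \<psi>. energy_deriv w (v - w) \<ge> 0) \<and>
      elastic_energy w \<le> elastic_energy u0}"


subsection \<open>Functions of time\<close>

abbreviation time_leb :: "real measure"
  where "time_leb \<equiv> lebesgue_on {0<..}"

(* The target spaces are separable, so Borel measurability is strong measurability. *)
definition Linf_time :: "(real \<Rightarrow> 'v::{banach, second_countable_topology}) set" where
  "Linf_time = {u \<in> borel_measurable time_leb. \<exists>C. AE t in time_leb. norm (u t) \<le> C}"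

definition L2_time :: "(real \<Rightarrow> 'v::{banach, second_countable_topology}) set" where
  "L2_time = {u \<in> borel_measurable time_leb. integrable time_leb (\<lambda>t. (norm (u t))\<^sup>2)}"

definition L1_loc_time :: "(real \<Rightarrow> 'v::{banach, second_countable_topology}) set" where
  "L1_loc_time = {u. \<forall>K. compact K \<and> K \<subseteq> {0<..} \<longrightarrow> set_integrable lebesgue K u}"

(* u is in the local W^{1,1} space and ud is (a representative of) its weak derivative. *)
definition has_weak_time_deriv ::
    "(real \<Rightarrow> 'v::{banach, second_countable_topology}) \<Rightarrow> (real \<Rightarrow> 'v) \<Rightarrow> bool" where
  "has_weak_time_deriv u ud \<longleftrightarrow> u \<in> L1_loc_time \<and> ud \<in> L1_loc_time \<and>
    (\<forall>\<phi>\<in>test_functions {0<..}.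
      (LINT t|time_leb. deriv \<phi> t *\<^sub>R u t) = - (LINT t|time_leb. \<phi> t *\<^sub>R ud t))"

(* The flow is an element of a Lebesgue space, hence u is one of its representatives and only its
   values at almost every t > 0 matter. *)
definition FVI_flow :: "(real \<Rightarrow> real) \<Rightarrow> W22_W12_0 \<Rightarrow> (real \<Rightarrow> W22_W12_0) \<Rightarrow> bool" where
  "FVI_flow \<psi> u0 u \<longleftrightarrow>
    u \<in> Linf_time \<and>
    (AE t in time_leb. u t \<in> admissible \<psi>) \<and>
    (\<exists>\<phi>. antimono_on {0..} \<phi> \<and> \<phi> 0 = elastic_energy u0 \<and>
      (AE t in time_leb. elastic_energy (u t) = \<phi> t)) \<and>
    (\<exists>w. continuous_on {0..} w \<and> (AE t in time_leb. w t = V_to_L2 (u t)) \<and>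
      w 0 = V_to_L2 u0) \<and>
    (\<exists>ud. has_weak_time_deriv (\<lambda>t. V_to_L2 (u t)) ud \<and> ud \<in> L2_time \<and>
      (AE t in time_leb. \<forall>v\<in>admissible \<psi>.
        inner (ud t) (V_to_L2 (v - u t)) + energy_deriv (u t) (v - u t) \<ge> 0))"

definition is_C1_rep :: "(real \<Rightarrow> W22_W12_0) \<Rightarrow> (real \<Rightarrow> C1) \<Rightarrow> bool" where
  "is_C1_rep u U \<longleftrightarrow>
    continuous_on {0..} U \<and> (AE t in time_leb. C1_to_L2 (U t) = V_to_L2 (u t))"

(* The value at t of the unique continuous representative [0,\<infinity>) \<Rightarrow> C1; meaningful for t \<ge> 0. *)
definition C1_rep :: "(real \<Rightarrow> W22_W12_0) \<Rightarrow> real \<Rightarrow> C1" where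
  "C1_rep u t = (THE f. \<exists>U. is_C1_rep u U \<and> U t = f)"

lemma AE_eq_continuous_imp_eq:
  fixes f g :: "real \<Rightarrow> 'b::real_normed_vector"
  assumes S: "open S" and fc: "continuous_on S f" and gc: "continuous_on S g"
    and ae: "AE x in lebesgue. x \<in> S \<longrightarrow> f x = g x" and x: "x \<in> S"
  shows "f x = g x"
proof (rule ccontr)
  assume ne: "f x \<noteq> g x"
  let ?U = "{y \<in> S. f y - g y \<in> - {0}}"
  have "open ?U"
    using continuous_open_preimage[OF continuous_on_diff[OF fc gc] S open_Compl[OF closed_singleton[of 0]]]
    by (simp add: Int_def vimage_def)
  moreover have "?U \<noteq> {}" using ne x by auto
  moreover have "negligible ?U"
  proof -
    have "AE y in lebesgue. y \<notin> ?U" using ae by eventually_elim auto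
    moreover have "?U \<in> sets lebesgue" using \<open>open ?U\<close> by auto
    ultimately show ?thesis
      by (simp add: AE_iff_null_sets negligible_iff_null_sets)
  qed
  ultimately show False using open_not_negligible by blast
qed

lemma inj_C1_to_L2:
  assumes "C1_to_L2 f = C1_to_L2 g"
  shows "f = g"
proof -
  have "AE x in unit_leb. C1_fun f x = C1_fun g x"
    using assms abs_L2_eq_iff[OF C1_square_integrable C1_square_integrable]
    unfolding C1_to_L2_def by blast
  then have ae: "AE x in lebesgue. x \<in> {0<..<1} \<longrightarrow> C1_fun f x = C1_fun g x"
    by (simp only: AE_unit_leb_iff)
  have c: "continuous_on {0<..<1} (C1_fun h)" for h
    using C1_continuous[of h] by (rule continuous_on_subset) auto
  have *: "C1_fun f x = C1_fun g x" if "x \<in> {0<..<1}" for x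
    by (rule AE_eq_continuous_imp_eq[OF _ c c ae that]) simp
  have "C1_fun f x = C1_fun g x" if "x \<in> {0..1}" for x
  proof -
    have "C1_fun f x - C1_fun g x = 0"
      by (rule continuous_constant_on_closure[of "{0<..<1}" "\<lambda>x. C1_fun f x - C1_fun g x"])
        (use * that in \<open>auto intro!: continuous_on_diff C1_continuous\<close>)
    then show ?thesis by simp
  qed
  then have "C1_fun f = C1_fun g" using C1_outside by (metis ext)
  then show ?thesis by (simp add: C1_fun_inject)
qed

lemma C1_rep_eq:
  assumes U: "is_C1_rep u U" and t: "t \<ge> 0"
  shows "C1_rep u t = U t"
  unfolding C1_rep_def
proof (rule the_equality)
  show "\<exists>U'. is_C1_rep u U' \<and> U' t = U t" using U by blast
next
  fix f assume "\<exists>U'. is_C1_rep u U' \<and> U' t = f"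
  then obtain U' where U': "is_C1_rep u U'" "U' t = f" by blast
  have c: "continuous_on {0..} U" "continuous_on {0..} U'"
    using U U' by (auto simp: is_C1_rep_def)
  have "AE t in time_leb. C1_to_L2 (U t) = V_to_L2 (u t)"
    "AE t in time_leb. C1_to_L2 (U' t) = V_to_L2 (u t)"
    using U U' by (auto simp: is_C1_rep_def)
  then have "AE t in time_leb. U t = U' t"
    by eventually_elim (rule inj_C1_to_L2, simp)
  then have ae: "AE t in lebesgue. t \<in> {0<..} \<longrightarrow> U t = U' t"
    by (subst (asm) AE_restrict_space_iff) auto
  have *: "U s = U' s" if "s \<in> {0<..}" for s
    by (rule AE_eq_continuous_imp_eq[OF _ _ _ ae that])
      (auto intro: continuous_on_subset[OF c(1)] continuous_on_subset[OF c(2)])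
  have "U t - U' t = 0"
    by (rule continuous_constant_on_closure[of "{0<..}" "\<lambda>t. U t - U' t"])
      (use * t in \<open>auto intro!: continuous_on_diff c\<close>)
  then have "U t = U' t" by simp
  with U'(2) show "f = U t" by simp
qed

definition subconvergent :: "real set \<Rightarrow> (real \<Rightarrow> 'x::banach) \<Rightarrow> 'x set \<Rightarrow> bool" where
  "subconvergent A u M \<longleftrightarrow> A \<subseteq> {0..} \<and> \<not> bounded A \<and>
    (\<forall>\<theta> :: nat \<Rightarrow> real. (\<forall>n. \<theta> n \<in> A) \<and> filterlim \<theta> at_top sequentially \<longrightarrow>
      (\<exists>k. strict_mono k \<and> (\<exists>m\<in>M. (\<lambda>n. u (\<theta> (k n))) \<longlonglongrightarrow> m)))"

end

theory Submission
  imports Defs "HOL-Complex_Analysis.Great_Picard"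
begin

text \<open>Let \<open>u(t\<^sub>n)\<close> be values of the flow at times \<open>t\<^sub>n \<rightarrow> \<infinity>\<close> at which the variational inequality holds and
  \<open>u'(t\<^sub>n) \<rightarrow> 0\<close> in \<open>L\<^sup>2\<close>. They are bounded in \<open>W\<^sup>2\<^sup>,\<^sup>2\<close>, hence (Green's function and Arzela-Ascoli) a
  subsequence converges in \<open>C\<^sup>1\<close>. Testing the inequality at \<open>u(t\<^sub>n)\<close> with \<open>u(t\<^sub>m)\<close> and vice versa, the
  quadratic leading term of the energy shows that this subsequence is even Cauchy in \<open>W\<^sup>2\<^sup>,\<^sup>2\<close>, and its limit is
  critical by continuity of the derivative of the energy.
  Square integrability of the time derivative yields \<open>u'(t) \<rightarrow> 0\<close> off a set of small measure. An
  arbitrary time is within distance 1 of a time off that set, and over such a distance the \<open>L\<^sup>2\<close>-increment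
  of \<open>u\<close> tends to 0; on bounded sets of \<open>W\<^sup>2\<^sup>,\<^sup>2\<close> the \<open>L\<^sup>2\<close> and \<open>C\<^sup>1\<close> topologies agree.\<close>

subsection \<open>Primitives and weak derivatives\<close>

text \<open>Boundedness in W^{2,2} yields only weak convergence of second derivatives, while the
  derivative of the energy is quadratic in u'' and so cannot be passed to weak limits. This is why
  the members of the sequence are tested against each other: in the sum of the two derivatives the
  curvatures enter as -2 \<open>weight\<close> (u'' - v'')^2, and every other term has a factor
  bounded by sup |u' - v'|, which C^1 convergence makes small. The resulting convergence is strong,
  so the obstacle constraint, the inequality and the energy bound all survive in the limit.
  Pointwise values are expressed by inner products in L^2. The indicators of (0,x) form a curve in
  L^2 that is Hoelder continuous with exponent 1/2; the differentiability of Green's function and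
  the equicontinuity of the slopes are both read off from it. The change from L^2 to C^1 rests on
  compactness: a Hoelder ball is compact in C^1, hence the inverse of its injection into L^2 is
  continuous. The same fact provides the continuous C^1 representative of the flow.\<close>

lemma smooth_primitive:
  assumes "smooth f"
  obtains F where "smooth F" "\<And>x. (F has_field_derivative f x) (at x)" "F a = 0"
proof -
  have "isCont f x" for x using smooth_deriv(2)[OF assms] DERIV_isCont by blast
  then obtain F0 where F0: "\<And>x. (F0 has_vector_derivative f x) (at x)"
    using einterval_antiderivative[of "-\<infinity>" "\<infinity>" f] by auto
  define F where "F x = F0 x - F0 a" for x
  have d: "(F has_field_derivative f x) (at x)" for x
    using F0[of x] unfolding F_def has_real_derivative_iff_has_vector_derivative
    by (auto intro!: derivative_eq_intros)
  have "smooth F"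
  proof (rule smooth_coinduct[of _ "insert F (Collect smooth)"])
    fix h assume "h \<in> insert F (Collect smooth)"
    then show "\<exists>h'\<in>insert F (Collect smooth). \<forall>x. (h has_field_derivative h' x) (at x)"
    proof
      assume "h = F"
      then show ?thesis using d assms by (intro bexI[of _ f]) auto
    next
      assume "h \<in> Collect smooth"
      then show ?thesis using smooth_deriv[of h] by (intro bexI[of _ "deriv h"]) auto
    qed
  qed simp
  then show thesis using that[of F] d by (auto simp: F_def)
qed

text \<open>The indicator is kept as a factor because inner products with \<open>step q\<close> have
  exactly this form.\<close>

lemma LINT_unit_leb_FTC:
  assumes q: "0 \<le> q" "q \<le> 1" and fc: "continuous_on {0..q} f"
    and d: "\<And>x. x \<in> {0..q} \<Longrightarrow> (F has_real_derivative f x) (at x within {0..q})"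
  shows "(LINT x|unit_leb. indicator {0<..<q} x * f x) = F q - F 0"
proof -
  have ai: "f absolutely_integrable_on {0..q}"
    using fc by (rule absolutely_integrable_continuous_real)
  have "(LINT x|unit_leb. indicator {0<..<q} x * f x)
      = (LINT x|lebesgue. indicator {0<..<1} x *\<^sub>R (indicator {0<..<q} x * f x))"
    by (rule integral_restrict_space) simp
  also have "\<dots> = (LINT x:{0<..<q}|lebesgue. f x)"
    unfolding set_lebesgue_integral_def using q
    by (intro Bochner_Integration.integral_cong) (auto simp: indicator_def)
  also have "\<dots> = integral {0<..<q} f"
    by (intro set_lebesgue_integral_eq_integral set_integrable_subset[OF ai]) auto
  also have "\<dots> = integral {0..q} f" by (simp add: integral_open_interval_real)
  also have "\<dots> = F q - F 0"
    using q d by (intro integral_unique fundamental_theorem_of_calculus)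
      (auto simp: has_real_derivative_iff_has_vector_derivative)
  finally show ?thesis .
qed

lemma LINT_unit_leb_FTC_1:
  assumes "continuous_on {0..1} f"
    and "\<And>x. x \<in> {0..1} \<Longrightarrow> (F has_real_derivative f x) (at x within {0..1})"
  shows "(LINT x|unit_leb. f x) = F 1 - F 0"
proof -
  have "(LINT x|unit_leb. f x) = (LINT x|unit_leb. indicator {0<..<1} x * f x)"
    by (rule Bochner_Integration.integral_cong) auto
  also have "\<dots> = F 1 - F 0"
    by (rule LINT_unit_leb_FTC) (use assms in auto)
  finally show ?thesis .
qed

lemma test_zero_outside:
  "f \<in> test_functions S \<Longrightarrow> y \<notin> S \<Longrightarrow> f y = 0"
  using closure_subset[of "{x. f x \<noteq> 0}"] unfolding test_functions_def by blast

text \<open>The primitive vanishing at 0 is constant on both sides of the support of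
  \<open>g\<close>; its value on the right is the mean of \<open>g\<close>, which is zero, so the
  primitive has compact support as well.\<close>

lemma test_primitive:
  assumes g: "g \<in> test_functions {0<..<1}" and z: "(LINT x|unit_leb. g x) = 0"
  obtains G where "G \<in> test_functions {0<..<1}" "deriv G = g"
proof -
  have sg: "smooth g" using g by (simp add: test_functions_def)
  obtain F where F: "smooth F" "\<And>x. (F has_field_derivative g x) (at x)" "F 0 = 0"
    using smooth_primitive[OF sg] by metis
  \<comment> \<open>Inserting 1/2 makes \<open>K\<close> nonempty, so that its minimum and maximum
    exist for \<open>g = 0\<close> as well.\<close>
  define K where "K = insert (1/2) (closure {x. g x \<noteq> 0})"
  have K: "compact K" "K \<subseteq> {0<..<1}" "K \<noteq> {}"
    using g by (auto simp: test_functions_def K_def)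
  obtain a where a: "a \<in> K" "\<And>x. x \<in> K \<Longrightarrow> a \<le> x"
    using compact_attains_inf[OF K(1,3)] by blast
  obtain b where b: "b \<in> K" "\<And>x. x \<in> K \<Longrightarrow> x \<le> b"
    using compact_attains_sup[OF K(1,3)] by blast
  have ab: "0 < a" "b < 1" using a(1) b(1) K(2) by auto
  have supp: "{x. g x \<noteq> 0} \<subseteq> K" using closure_subset[of "{x. g x \<noteq> 0}"] by (auto simp: K_def)
  have g0: "g x = 0" if "x < a \<or> b < x" for x
    using supp a(2)[of x] b(2)[of x] that by fastforce
  have "F 1 = 0"
    using LINT_unit_leb_FTC_1[OF test_continuous[OF g] has_field_derivative_at_within[OF F(2)]] z F(3)
    by simp
  have "F x = F 0" if "x < a" for x
  proof -
    have "\<exists>c. \<forall>y\<in>{..<a}. F y = c"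
    proof (rule has_field_derivative_zero_constant)
      fix y assume "y \<in> {..<a}"
      then show "(F has_field_derivative 0) (at y within {..<a})"
        using has_field_derivative_at_within[OF F(2)[of y]] g0[of y] by auto
    qed simp
    then show ?thesis using that ab by auto
  qed
  moreover have "F x = F 1" if "b < x" for x
  proof -
    have "\<exists>c. \<forall>y\<in>{b<..}. F y = c"
    proof (rule has_field_derivative_zero_constant)
      fix y assume "y \<in> {b<..}"
      then show "(F has_field_derivative 0) (at y within {b<..})"
        using has_field_derivative_at_within[OF F(2)[of y]] g0[of y] by auto
    qed simp
    then show ?thesis using that ab by auto
  qed
  ultimately have "{x. F x \<noteq> 0} \<subseteq> {a..b}"
    using \<open>F 1 = 0\<close> F(3) by force
  then have sub: "closure {x. F x \<noteq> 0} \<subseteq> {a..b}" by (simp add: closure_minimal)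
  then have "compact (closure {x. F x \<noteq> 0})"
    by (rule compact_closed_subset_aux[rotated 2]) auto
  then have "F \<in> test_functions {0<..<1}"
    using F(1) sub ab unfolding test_functions_def by auto
  moreover have "deriv F = g" using F(2) DERIV_imp_deriv by blast
  ultimately show thesis using that by blast
qed

section \<open>Primitives as inner products in L^2\<close>

lemma continuous_square_integrable:
  assumes f: "continuous_on {0..1} f"
  shows "f \<in> square_integrable"
proof (rule square_integrable_bounded)
  have "f \<in> borel_measurable (lebesgue_on {0..1})"
    by (rule continuous_imp_measurable_on_sets_lebesgue[OF f]) simp
  then show "f \<in> borel_measurable unit_leb"
    by (rule measurable_restrict_mono) auto
  show "\<bar>f x\<bar> \<le> sup_unit f" if "0 < x" "x < 1" for x
    using sup_unit_upper[OF f, of x] that by simp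
qed

lemma square_integrable_const: "(\<lambda>x. c) \<in> square_integrable"
  by (rule square_integrable_bounded[of _ "\<bar>c\<bar>"]) auto

lemma abs_L2_cong:
  assumes "f \<in> square_integrable" "\<And>x. 0 < x \<Longrightarrow> x < 1 \<Longrightarrow> f x = g x"
  shows "abs_L2 f = abs_L2 g" "g \<in> square_integrable"
proof -
  have eq: "AE x in unit_leb. f x = g x" using assms(2) by (intro AE_I2) auto
  have "f \<in> borel_measurable unit_leb" using assms(1) by (simp add: square_integrable_def)
  then have "g \<in> borel_measurable unit_leb"
    by (rule measurable_cong[THEN iffD1, rotated]) (use assms(2) in auto)
  then show g: "g \<in> square_integrable"
    by (rule square_integrable_dominated[OF _ assms(1)]) (use eq in \<open>auto elim: eventually_mono\<close>)
  show "abs_L2 f = abs_L2 g" using abs_L2_eq_iff[OF assms(1) g] eq by simp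
qed

lemma norm_abs_L2_mono:
  assumes f: "f \<in> square_integrable" and g: "g \<in> square_integrable"
    and le: "\<And>x. 0 < x \<Longrightarrow> x < 1 \<Longrightarrow> \<bar>f x\<bar> \<le> \<bar>g x\<bar>"
  shows "norm (abs_L2 f) \<le> norm (abs_L2 g)"
proof (rule power2_le_imp_le)
  show "(norm (abs_L2 f))\<^sup>2 \<le> (norm (abs_L2 g))\<^sup>2"
    unfolding norm_abs_L2[OF f] norm_abs_L2[OF g]
    by (rule integral_mono)
      (use f g le in \<open>auto simp: square_integrable_def abs_le_square_iff[symmetric]\<close>)
qed simp

text \<open>Pairing with \<open>step x\<close> integrates over (0,x). Viewed as a curve in L^2,
  \<open>step\<close> turns statements about primitives into statements about bounded functionals,
  and the norms of its increments produce the Hoelder exponent 1/2.\<close>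

definition step :: "real \<Rightarrow> L2" where
  "step x = abs_L2 (indicator {0<..<x})"

lemma square_integrable_step: "indicator {0<..<x :: real} \<in> square_integrable"
  by (rule square_integrable_bounded[of _ 1]) (auto intro!: borel_measurable_unit_leb simp: indicator_def)

lemma inner_step_abs:
  "f \<in> square_integrable \<Longrightarrow> inner (step x) (abs_L2 f) = (LINT y|unit_leb. indicator {0<..<x} y * f y)"
  unfolding step_def by (rule inner_abs_L2[OF square_integrable_step])

lemma inner_step_step:
  assumes "0 \<le> x" "x \<le> 1" "0 \<le> y" "y \<le> 1"
  shows "inner (step x) (step y) = min x y"
proof -
  have "inner (step x) (step y) = (LINT z|unit_leb. indicator {0<..<min x y} z * 1)"
    unfolding step_def inner_abs_L2[OF square_integrable_step square_integrable_step]
    by (rule Bochner_Integration.integral_cong) (auto simp: indicator_def)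
  also have "\<dots> = min x y - 0"
    by (rule LINT_unit_leb_FTC[where F = "\<lambda>x. x"]) (use assms in \<open>auto intro!: derivative_eq_intros\<close>)
  finally show ?thesis by simp
qed

lemma norm_step_diff:
  assumes "0 \<le> x" "x \<le> 1" "0 \<le> y" "y \<le> 1"
  shows "norm (step x - step y) = sqrt \<bar>x - y\<bar>"
  unfolding norm_eq_sqrt_inner
  using assms by (simp add: inner_diff_left inner_diff_right inner_step_step min_def)

lemma norm_step_le: "0 \<le> x \<Longrightarrow> x \<le> 1 \<Longrightarrow> norm (step x) \<le> 1"
  by (simp add: norm_eq_sqrt_inner inner_step_step)

lemma continuous_on_step: "continuous_on {0..1} step"
  unfolding continuous_on_def
proof
  fix x :: real assume x: "x \<in> {0..1}"
  have "((\<lambda>y. sqrt \<bar>y - x\<bar>) \<longlongrightarrow> sqrt \<bar>x - x\<bar>) (at x within {0..1})"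
    by (intro tendsto_intros)
  then have l: "((\<lambda>y. sqrt \<bar>y - x\<bar>) \<longlongrightarrow> 0) (at x within {0..1})" by simp
  have "((\<lambda>y. step y - step x) \<longlongrightarrow> 0) (at x within {0..1})"
  proof (rule Lim_null_comparison[OF _ l])
    show "\<forall>\<^sub>F y in at x within {0..1}. norm (step y - step x) \<le> sqrt \<bar>y - x\<bar>"
      using x by (auto simp: eventually_at_filter norm_step_diff)
  qed
  then show "(step \<longlongrightarrow> step x) (at x within {0..1})" by (rule LIM_zero_cancel)
qed

definition primitive :: "L2 \<Rightarrow> real \<Rightarrow> real" where
  "primitive g x = inner (step x) g"

lemma continuous_on_primitive: "continuous_on {0..1} (primitive g)"
  unfolding primitive_def by (intro continuous_intros continuous_on_step)

lemma primitive_square_integrable: "primitive g \<in> square_integrable"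
  by (rule continuous_square_integrable[OF continuous_on_primitive])

lemma abs_primitive_le: "0 \<le> x \<Longrightarrow> x \<le> 1 \<Longrightarrow> \<bar>primitive g x\<bar> \<le> norm g"
  unfolding primitive_def using Cauchy_Schwarz_ineq2[of "step x" g] norm_step_le[of x]
    mult_right_mono[of "norm (step x)" 1 "norm g"] by auto

lemma test_eq_primitive:
  assumes t: "\<phi> \<in> test_functions {0<..<1}" and x: "0 \<le> x" "x \<le> 1"
  shows "primitive (abs_L2 (deriv \<phi>)) x = \<phi> x"
proof -
  have sm: "smooth \<phi>" using t by (simp add: test_functions_def)
  have "primitive (abs_L2 (deriv \<phi>)) x = \<phi> x - \<phi> 0"
    unfolding primitive_def inner_step_abs[OF test_square_integrable[OF test_deriv[OF t]]]
    by (rule LINT_unit_leb_FTC[OF x test_continuous[OF test_deriv[OF t]]])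
      (rule has_field_derivative_at_within[OF smooth_deriv(2)[OF sm]])
  then show ?thesis using test_zero_outside[OF t, of 0] by simp
qed

lemma bounded_linear_abs_primitive: "bounded_linear (\<lambda>g. abs_L2 (primitive g))"
proof (rule bounded_linear_intro[where K = 1])
  show "abs_L2 (primitive (f + g)) = abs_L2 (primitive f) + abs_L2 (primitive g)" for f g
    by (simp add: abs_L2_add primitive_square_integrable) (simp add: primitive_def[abs_def] inner_add_right)
  show "abs_L2 (primitive (c *\<^sub>R g)) = c *\<^sub>R abs_L2 (primitive g)" for c g
    by (simp add: abs_L2_scaleR primitive_square_integrable) (simp add: primitive_def[abs_def])
  show "norm (abs_L2 (primitive g)) \<le> norm g * 1" for g
  proof -
    have 1: "norm (abs_L2 (\<lambda>x. 1 :: real)) \<le> 1"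
    proof (rule power2_le_imp_le)
      show "(norm (abs_L2 (\<lambda>x. 1 :: real)))\<^sup>2 \<le> 1\<^sup>2"
        by (simp add: norm_abs_L2 square_integrable_const measure_restrict_space)
    qed simp
    have "norm (abs_L2 (primitive g)) \<le> norm (abs_L2 (\<lambda>x. norm g * 1))"
      by (rule norm_abs_L2_mono[OF primitive_square_integrable square_integrable_const])
        (use abs_primitive_le in auto)
    also have "abs_L2 (\<lambda>x. norm g * 1) = norm g *\<^sub>R abs_L2 (\<lambda>x. 1)"
      by (rule abs_L2_scaleR[OF square_integrable_const, symmetric])
    also have "norm \<dots> \<le> norm g * 1" using 1 mult_left_mono[OF 1, of "norm g"] by simp
    finally show ?thesis .
  qed
qed

lemma step_1_eq: "step 1 = abs_L2 (\<lambda>x. 1)"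
  unfolding step_def by (rule abs_L2_cong[OF square_integrable_step]) auto

text \<open>Testing with functions of the form \<open>g - c \<eta>\<close> of vanishing mean: a weak derivative determines
  the function up to an additive constant.\<close>

lemma weak_deriv_integration_by_parts:
  assumes pf: "has_weak_deriv p f"
  obtains c where "\<And>g. inner p g + inner f (abs_L2 (primitive g)) = c * inner (step 1) g"
proof -
  define \<Phi> where "\<Phi> g = inner p g + inner f (abs_L2 (primitive g))" for g
  have bl: "bounded_linear \<Phi>"
    unfolding \<Phi>_def
    by (intro bounded_linear_add bounded_linear_inner_right
        bounded_linear_compose[OF bounded_linear_inner_right bounded_linear_abs_primitive])
  interpret \<Phi>: bounded_linear \<Phi> by (rule bl)
  have z: "\<Phi> (abs_L2 g) = 0" if g: "g \<in> test_functions {0<..<1}" "inner (step 1) (abs_L2 g) = 0" for g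
  proof -
    have "(LINT x|unit_leb. g x) = 0"
      using g inner_abs_L2[of "\<lambda>x. 1" g] test_square_integrable[OF g(1)]
        square_integrable_const[of 1] by (auto simp: step_1_eq)
    then obtain G where G: "G \<in> test_functions {0<..<1}" "deriv G = g"
      using test_primitive[OF g(1)] by blast
    have "abs_L2 (primitive (abs_L2 g)) = abs_L2 G"
      by (rule abs_L2_cong[OF primitive_square_integrable])
        (use test_eq_primitive[OF G(1)] G(2) in auto)
    moreover have "inner p (abs_L2 g) = - inner f (abs_L2 G)"
      using pf G unfolding has_weak_deriv_iff_inner by auto
    ultimately show ?thesis by (simp add: \<Phi>_def)
  qed
  have "inner (step 1) (step 1) = 1" by (simp add: inner_step_step)
  then have "step 1 \<noteq> 0" by auto
  then obtain \<eta> where \<eta>: "\<eta> \<in> test_functions {0<..<1}" "inner (step 1) (abs_L2 \<eta>) \<noteq> 0"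
    using L2_test_orthogonal_zero by blast
  \<comment> \<open>With this \<open>c\<close>, the functionals \<open>\<Phi>\<close> and
    \<open>c * inner (step 1)\<close> agree at \<open>\<eta>\<close>. As \<open>\<Phi>\<close>
    vanishes on test functions of mean zero, they agree on all test functions and, by density,
    everywhere.\<close>
  define c where "c = \<Phi> (abs_L2 \<eta>) / inner (step 1) (abs_L2 \<eta>)"
  have "{g. \<Phi> g - c * inner (step 1) g = 0} = UNIV"
  proof (rule L2_closed_subspace_test_UNIV)
    show "subspace {g. \<Phi> g - c * inner (step 1) g = 0}"
      by (rule subspaceI)
        (auto simp: \<Phi>.zero \<Phi>.add \<Phi>.scaleR inner_add_right algebra_simps)
    show "closed {g. \<Phi> g - c * inner (step 1) g = 0}"
      by (intro closed_Collect_eq continuous_intros linear_continuous_on[OF bl])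
    fix g assume g: "g \<in> test_functions {0<..<1}"
    define r where "r = inner (step 1) (abs_L2 g) / inner (step 1) (abs_L2 \<eta>)"
    have l: "abs_L2 (\<lambda>x. 1 * g x + (- r) * \<eta> x) = 1 *\<^sub>R abs_L2 g + (- r) *\<^sub>R abs_L2 \<eta>"
      by (intro abs_L2_lincomb test_square_integrable[OF g] test_square_integrable[OF \<eta>(1)])
    have "\<Phi> (abs_L2 (\<lambda>x. 1 * g x + (- r) * \<eta> x)) = 0"
      by (rule z[OF test_lincomb[OF g \<eta>(1)]], unfold l)
        (use \<eta>(2) in \<open>simp add: inner_diff_right r_def\<close>)
    then show "abs_L2 g \<in> {g. \<Phi> g - c * inner (step 1) g = 0}"
      unfolding l using \<eta>(2) by (simp add: \<Phi>.diff \<Phi>.scaleR r_def c_def)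
  qed
  then show thesis using that[of c] unfolding \<Phi>_def by fastforce
qed


subsection \<open>Green's function and the embedding into \<open>C\<^sup>1\<close>\<close>

text \<open>The kernel of a double integration: pairing min(x,y) with f gives the integral over s in
  (0,x) of the integral of f over (s,1). Its derivative in x is therefore represented by
  \<open>step 1 - step x\<close>.\<close>

definition min_L2 :: "real \<Rightarrow> L2" where
  "min_L2 x = abs_L2 (\<lambda>y. min x y)"

lemma square_integrable_min_L2: "(\<lambda>y. min x y) \<in> square_integrable"
  by (rule continuous_square_integrable) (intro continuous_intros)

lemma abs_primitive_step:
  assumes "0 \<le> x" "x \<le> 1"
  shows "abs_L2 (primitive (step x)) = min_L2 x"
  unfolding min_L2_def
  by (rule abs_L2_cong[OF primitive_square_integrable])
    (use assms in \<open>simp add: primitive_def inner_step_step min.commute\<close>)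

text \<open>For y outside the interval between x and z the linearisation is exact (up to endpoints).
  On that interval, of length |z - x|, the error is at most |z - x|, which makes an L^2 norm of at
  most |z - x|^(3/2).\<close>

lemma norm_min_L2_diff_le:
  assumes "0 \<le> x" "x \<le> 1" "0 \<le> z" "z \<le> 1"
  shows "norm (min_L2 z - min_L2 x - (z - x) *\<^sub>R (step 1 - step x)) \<le> \<bar>z - x\<bar> * sqrt \<bar>z - x\<bar>"
proof -
  have 1: "(\<lambda>y. 1 - indicator {0<..<x} y) \<in> square_integrable"
    by (intro square_integrable_diff square_integrable_step square_integrable_const)
  have s: "step 1 - step x = abs_L2 (\<lambda>y. 1 - indicator {0<..<x} y)"
    unfolding step_1_eq unfolding step_def
    by (intro abs_L2_diff square_integrable_step square_integrable_const)
  have d: "(\<lambda>y. min z y - min x y - (z - x) * (1 - indicator {0<..<x} y)) \<in> square_integrable"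
    by (intro square_integrable_diff square_integrable_min_L2 square_integrable_scale 1)
  have "min_L2 z - min_L2 x - (z - x) *\<^sub>R (step 1 - step x)
      = abs_L2 (\<lambda>y. min z y - min x y - (z - x) * (1 - indicator {0<..<x} y))"
    unfolding s min_L2_def
    by (simp add: abs_L2_diff abs_L2_scaleR square_integrable_min_L2 1 square_integrable_scale
        square_integrable_diff)
  also have "norm \<dots> \<le> norm (abs_L2 (\<lambda>y. (z - x) * (indicator {0<..<z} y - indicator {0<..<x} y)))"
    by (rule norm_abs_L2_mono[OF d])
      (intro square_integrable_scale square_integrable_diff square_integrable_step,
        auto simp: indicator_def abs_mult)
  also have "abs_L2 (\<lambda>y. (z - x) * (indicator {0<..<z} y - indicator {0<..<x} y))
      = (z - x) *\<^sub>R (step z - step x)"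
    unfolding step_def
    by (simp add: abs_L2_diff abs_L2_scaleR square_integrable_diff square_integrable_step)
  also have "norm \<dots> = \<bar>z - x\<bar> * sqrt \<bar>z - x\<bar>"
    using assms by (simp add: norm_step_diff)
  finally show ?thesis .
qed

text \<open>Green's function of \<open>v'' = f\<close>, \<open>v(0) = v(1) = 0\<close> at \<open>x\<close>, and its derivative in \<open>x\<close>.\<close>

definition green :: "real \<Rightarrow> L2" where
  "green x = x *\<^sub>R min_L2 1 - min_L2 x"

definition green' :: "real \<Rightarrow> L2" where
  "green' x = min_L2 1 - (step 1 - step x)"

lemma green_0 [simp]: "green 0 = 0"
proof -
  have "min_L2 0 = abs_L2 (\<lambda>x. 0)"
    unfolding min_L2_def by (rule abs_L2_cong[OF square_integrable_min_L2]) auto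
  then show ?thesis by (simp add: green_def zero_L2_eq[symmetric])
qed

lemma norm_green'_diff:
  "0 \<le> x \<Longrightarrow> x \<le> 1 \<Longrightarrow> 0 \<le> y \<Longrightarrow> y \<le> 1 \<Longrightarrow> norm (green' x - green' y) = sqrt \<bar>x - y\<bar>"
  by (simp add: green'_def norm_step_diff)

lemma norm_green'_le:
  assumes "0 \<le> x" "x \<le> 1"
  shows "norm (green' x) \<le> 1"
proof -
  have i: "(\<lambda>y. 1 - indicator {0<..<x} y) \<in> square_integrable"
    by (intro square_integrable_diff square_integrable_step square_integrable_const)
  have "green' x = abs_L2 (\<lambda>y. min 1 y - (1 - indicator {0<..<x} y))"
    unfolding green'_def step_1_eq unfolding step_def min_L2_def
    by (simp add: square_integrable_const abs_L2_diff square_integrable_step square_integrable_min_L2 i)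
  also have "norm \<dots> \<le> norm (abs_L2 (\<lambda>y. 1))"
    by (rule norm_abs_L2_mono[OF square_integrable_diff[OF square_integrable_min_L2 i] square_integrable_const])
      (auto simp: indicator_def)
  also have "\<dots> \<le> 1" using norm_step_le[of 1] by (simp add: step_1_eq)
  finally show ?thesis .
qed

lemma inner_green_deriv:
  assumes x: "x \<in> {0..1}"
  shows "((\<lambda>x. inner (green x) f) has_real_derivative inner (green' x) f) (at x within {0..1})"
  unfolding has_field_derivative_def has_derivative_within_alt
proof (intro conjI allI impI)
  show "bounded_linear ((*) (inner (green' x) f))" by (rule bounded_linear_mult_right)
next
  fix e :: real assume e: "e > 0"
  \<comment> \<open>The remainder is at most |y - x|^(3/2) times \<open>norm f\<close>, so the
    square root of |y - x| has to be at most e / \<open>norm f\<close>; adding 1 avoids a division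
    by zero.\<close>
  define d where "d = (e / (norm f + 1))\<^sup>2"
  have nf: "0 < norm f + 1" using norm_ge_zero[of f] by linarith
  have d: "d > 0" using e nf by (simp add: d_def)
  show "\<exists>d>0. \<forall>y\<in>{0..1}. norm (y - x) < d \<longrightarrow>
      norm (inner (green y) f - inner (green x) f - inner (green' x) f * (y - x)) \<le> e * norm (y - x)"
  proof (intro exI[of _ d] conjI d ballI impI)
    fix y :: real assume y: "y \<in> {0..1}" "norm (y - x) < d"
    have eq: "inner (green y) f - inner (green x) f - inner (green' x) f * (y - x)
        = - inner (min_L2 y - min_L2 x - (y - x) *\<^sub>R (step 1 - step x)) f"
      by (simp add: green_def green'_def inner_diff_left algebra_simps)
    have s: "sqrt \<bar>y - x\<bar> \<le> e / (norm f + 1)"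
      using y(2) e nf by (intro real_le_lsqrt) (auto simp: d_def)
    have "norm (inner (green y) f - inner (green x) f - inner (green' x) f * (y - x))
        \<le> norm (min_L2 y - min_L2 x - (y - x) *\<^sub>R (step 1 - step x)) * norm f"
      unfolding eq using Cauchy_Schwarz_ineq2 by simp
    also have "\<dots> \<le> (\<bar>y - x\<bar> * sqrt \<bar>y - x\<bar>) * (norm f + 1)"
      using x y by (intro mult_mono norm_min_L2_diff_le) auto
    also have "\<dots> \<le> (\<bar>y - x\<bar> * (e / (norm f + 1))) * (norm f + 1)"
      using s nf by (intro mult_right_mono mult_left_mono) auto
    also have "\<dots> = e * norm (y - x)" using nf by simp
    finally show "norm (inner (green y) f - inner (green x) f - inner (green' x) f * (y - x)) \<le> e * norm (y - x)" .
  qed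
qed

lemma continuous_on_green': "continuous_on {0..1} green'"
  unfolding green'_def by (intro continuous_intros continuous_on_step)

definition green_C1 :: "L2 \<Rightarrow> C1" where
  "green_C1 f = Abs_C1 (\<lambda>x. if x \<in> {0..1} then inner (green x) f else 0)"

lemma C1_fun_green_C1:
  "C1_fun (green_C1 f) = (\<lambda>x. if x \<in> {0..1} then inner (green x) f else 0)"
  unfolding green_C1_def
proof (rule Abs_C1_inverse, intro CollectI conjI)
  show "C1_on_unit (\<lambda>x. if x \<in> {0..1} then inner (green x) f else 0)"
  proof (rule C1_on_unit_I[where f' = "\<lambda>x. inner (green' x) f"])
    show "((\<lambda>x. if x \<in> {0..1} then inner (green x) f else 0) has_real_derivative inner (green' x) f)
        (at x within {0..1})" if "x \<in> {0..1}" for x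
      by (rule has_field_derivative_transform_within[OF inner_green_deriv[OF that], where d = 1])
        (use that in auto)
    show "continuous_on {0..1} (\<lambda>x. inner (green' x) f)"
      by (intro continuous_intros continuous_on_green')
  qed
qed simp

lemma C1_deriv_green_C1: "x \<in> {0..1} \<Longrightarrow> C1_deriv (green_C1 f) x = inner (green' x) f"
  by (rule C1_deriv_eqI[OF has_field_derivative_transform_within[OF inner_green_deriv, where d = 1]])
    (auto simp: C1_fun_green_C1)

text \<open>Both facts hold for test functions and are stable under L^2 convergence of functions and
  derivatives. Together they encode the boundary values: the one at 0 through the choice of the
  primitive, the one at 1 through the second equation.\<close>

lemma V_primitive_D1:
  shows "V_to_L2 v = abs_L2 (primitive (D1 (V_to_W22 v)))"
    and "primitive (D1 (V_to_W22 v)) 1 = 0"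
proof -
  let ?p = "D1 (V_to_W22 v)"
  obtain \<phi> where \<phi>: "\<And>n. \<phi> n \<in> test_functions {0<..<1}"
    "(\<lambda>n::nat. abs_L2 (\<phi> n)) \<longlonglongrightarrow> V_to_L2 v" "(\<lambda>n. abs_L2 (deriv (\<phi> n))) \<longlonglongrightarrow> ?p"
    using W12_0_iff[OF W22_has_weak_deriv(1)] V_to_W22[of v] by blast
  have "(\<lambda>n. abs_L2 (primitive (abs_L2 (deriv (\<phi> n))))) \<longlonglongrightarrow> abs_L2 (primitive ?p)"
    by (rule bounded_linear.tendsto[OF bounded_linear_abs_primitive \<phi>(3)])
  moreover have "abs_L2 (primitive (abs_L2 (deriv (\<phi> n)))) = abs_L2 (\<phi> n)" for n
    by (rule abs_L2_cong[OF primitive_square_integrable]) (use test_eq_primitive[OF \<phi>(1)] in auto)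
  ultimately show "V_to_L2 v = abs_L2 (primitive ?p)"
    using LIMSEQ_unique[OF \<phi>(2)] by simp
  have "(\<lambda>n. primitive (abs_L2 (deriv (\<phi> n))) 1) \<longlonglongrightarrow> primitive ?p 1"
    unfolding primitive_def by (intro tendsto_intros \<phi>(3))
  then show "primitive ?p 1 = 0"
    using test_eq_primitive[OF \<phi>(1)] test_zero_outside[OF \<phi>(1)]
    by (simp add: LIMSEQ_const_iff)
qed

text \<open>Integration by parts against \<open>step y\<close> determines the primitive of the slope
  up to a multiple \<open>c * y\<close>, and the boundary condition at 1 fixes
  \<open>c\<close>.\<close>

lemma V_green:
  assumes x: "0 \<le> x" "x \<le> 1"
  shows "primitive (D1 (V_to_W22 v)) x = inner (green x) (D2 (V_to_W22 v))"
proof -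
  let ?p = "D1 (V_to_W22 v)" and ?f = "D2 (V_to_W22 v)"
  obtain c where c: "\<And>g. inner ?p g + inner ?f (abs_L2 (primitive g)) = c * inner (step 1) g"
    using weak_deriv_integration_by_parts[OF W22_has_weak_deriv(2)] by blast
  have *: "primitive ?p y = c * y - inner (min_L2 y) ?f" if "0 \<le> y" "y \<le> 1" for y
    using c[of "step y"] that inner_commute[of ?p "step y"] inner_commute[of ?f "min_L2 y"]
    by (simp add: abs_primitive_step inner_step_step primitive_def)
  show ?thesis
    using *[OF x] *[of 1] V_primitive_D1(2)[of v]
    by (simp add: green_def inner_diff_left)
qed

lemma has_weak_deriv_C1: "has_weak_deriv (C1_to_L2 f) (abs_L2 (C1_deriv f))"
  unfolding has_weak_deriv_iff_inner
proof
  fix \<phi> assume \<phi>: "\<phi> \<in> test_functions {0<..<1}"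
  have sm: "smooth \<phi>" using \<phi> by (simp add: test_functions_def)
  have dd: "C1_deriv f \<in> square_integrable"
    by (rule continuous_square_integrable[OF C1_deriv_continuous])
  have "(LINT x|unit_leb. C1_fun f x * deriv \<phi> x + C1_deriv f x * \<phi> x)
      = C1_fun f 1 * \<phi> 1 - C1_fun f 0 * \<phi> 0"
  proof (rule LINT_unit_leb_FTC_1)
    show "continuous_on {0..1} (\<lambda>x. C1_fun f x * deriv \<phi> x + C1_deriv f x * \<phi> x)"
      by (intro continuous_intros C1_continuous C1_deriv_continuous test_continuous[OF \<phi>]
          test_continuous[OF test_deriv[OF \<phi>]])
    show "((\<lambda>x. C1_fun f x * \<phi> x) has_real_derivative C1_fun f x * deriv \<phi> x + C1_deriv f x * \<phi> x)
        (at x within {0..1})" if "x \<in> {0..1}" for x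
      by (rule DERIV_mult'[OF C1_has_deriv[OF that] has_field_derivative_at_within[OF smooth_deriv(2)[OF sm]]])
  qed
  also have "\<dots> = 0" using test_zero_outside[OF \<phi>] by simp
  finally have "(LINT x|unit_leb. C1_fun f x * deriv \<phi> x) + (LINT x|unit_leb. C1_deriv f x * \<phi> x) = 0"
    by (subst (asm) Bochner_Integration.integral_add)
      (auto intro!: square_integrable_prod dd C1_square_integrable test_square_integrable[OF \<phi>]
        test_square_integrable[OF test_deriv[OF \<phi>]])
  then show "inner (C1_to_L2 f) (abs_L2 (deriv \<phi>)) = - inner (abs_L2 (C1_deriv f)) (abs_L2 \<phi>)"
    unfolding C1_to_L2_def
    by (simp add: inner_abs_L2 dd C1_square_integrable test_square_integrable[OF \<phi>]
        test_square_integrable[OF test_deriv[OF \<phi>]])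
qed

section \<open>Compactness of the embedding into C^1\<close>

definition V_to_C1 :: "W22_W12_0 \<Rightarrow> C1" where
  "V_to_C1 v = green_C1 (D2 (V_to_W22 v))"

lemma C1_to_L2_V_to_C1: "C1_to_L2 (V_to_C1 v) = V_to_L2 v"
  unfolding C1_to_L2_def V_primitive_D1(1)
  by (rule abs_L2_cong[OF C1_square_integrable])
    (simp add: V_to_C1_def C1_fun_green_C1 V_green)

lemma D1_V_to_C1: "D1 (V_to_W22 v) = abs_L2 (C1_deriv (V_to_C1 v))"
  using has_weak_deriv_C1[of "V_to_C1 v"] W22_has_weak_deriv(1)[of "V_to_W22 v"] has_weak_deriv_unique
  unfolding C1_to_L2_V_to_C1 by blast

lemma AE_D1_V_to_C1: "AE x in unit_leb. rep_L2 (D1 (V_to_W22 v)) x = C1_deriv (V_to_C1 v) x"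
  unfolding D1_V_to_C1
  by (rule rep_abs_L2[OF continuous_square_integrable[OF C1_deriv_continuous]])

lemma V_to_C1_diff: "V_to_C1 (u - v) = V_to_C1 u - V_to_C1 v"
proof -
  have "C1_fun (V_to_C1 (u - v)) = C1_fun (V_to_C1 u - V_to_C1 v)"
    by (rule ext) (simp add: V_to_C1_def C1_fun_green_C1 C1_fun_simps V_to_W22_simps D1_D2_diff inner_diff_right)
  then show ?thesis by (simp add: C1_fun_inject)
qed

lemma C1_deriv_V_to_C1_le:
  assumes "x \<in> {0..1}"
  shows "\<bar>C1_deriv (V_to_C1 v) x\<bar> \<le> norm v"
proof -
  have "\<bar>C1_deriv (V_to_C1 v) x\<bar> \<le> norm (green' x) * norm v"
    using assms Cauchy_Schwarz_ineq2 by (simp add: V_to_C1_def C1_deriv_green_C1 norm_W22_W12_0_def)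
  also have "\<dots> \<le> 1 * norm v" using assms by (intro mult_right_mono norm_green'_le) auto
  finally show ?thesis by simp
qed

text \<open>A compact subset of C^1 that contains the representatives of a ball of
  \<open>W22_W12_0\<close>. Value and slope at 0 together with the Hoelder seminorm of the slope
  control the whole C^1 norm, and all three conditions are closed.\<close>

definition C1_holder_ball :: "real \<Rightarrow> C1 set" where
  "C1_holder_ball C = {f. C1_fun f 0 = 0 \<and> \<bar>C1_deriv f 0\<bar> \<le> C \<and>
    (\<forall>x\<in>{0..1}. \<forall>y\<in>{0..1}. \<bar>C1_deriv f x - C1_deriv f y\<bar> \<le> C * sqrt \<bar>x - y\<bar>)}"

lemma V_to_C1_holder:
  assumes "norm v \<le> C"
  shows "V_to_C1 v \<in> C1_holder_ball C"
  unfolding C1_holder_ball_def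
proof (intro CollectI conjI ballI)
  show "C1_fun (V_to_C1 v) 0 = 0" by (simp add: V_to_C1_def C1_fun_green_C1)
  show "\<bar>C1_deriv (V_to_C1 v) 0\<bar> \<le> C" using C1_deriv_V_to_C1_le[of 0 v] assms by simp
  fix x y :: real assume xy: "x \<in> {0..1}" "y \<in> {0..1}"
  have "\<bar>C1_deriv (V_to_C1 v) x - C1_deriv (V_to_C1 v) y\<bar> \<le> norm (green' x - green' y) * norm v"
    using xy Cauchy_Schwarz_ineq2[of "green' x - green' y"]
    by (simp add: V_to_C1_def C1_deriv_green_C1 norm_W22_W12_0_def inner_diff_left)
  also have "\<dots> \<le> sqrt \<bar>x - y\<bar> * C"
    using xy assms by (intro mult_mono) (auto simp: norm_green'_diff)
  finally show "\<bar>C1_deriv (V_to_C1 v) x - C1_deriv (V_to_C1 v) y\<bar> \<le> C * sqrt \<bar>x - y\<bar>"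
    by (simp add: mult.commute)
qed

lemma norm_C1_le_deriv:
  assumes "C1_fun f 0 = 0" "\<And>x. x \<in> {0..1} \<Longrightarrow> \<bar>C1_deriv f x\<bar> \<le> b"
  shows "norm f \<le> 2 * b"
proof -
  have "\<bar>C1_fun f x\<bar> \<le> b" if x: "x \<in> {0..1}" for x
  proof -
    have b0: "0 \<le> b" using assms(2)[of 0] by auto
    have "norm (C1_fun f x - C1_fun f 0) \<le> b * norm (x - 0)"
    proof (rule field_differentiable_bound)
      show "convex {0..1::real}" by simp
    qed (use x assms C1_has_deriv in auto)
    also have "\<dots> \<le> b * 1" using b0 x by (intro mult_left_mono) auto
    finally show ?thesis using assms(1) by simp
  qed
  from norm_C1_leI[OF this assms(2)] show ?thesis by simp
qed

lemma tendsto_C1_fun: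
  assumes "X \<longlonglongrightarrow> f" "x \<in> {0..1}"
  shows "(\<lambda>n. C1_fun (X n) x) \<longlonglongrightarrow> C1_fun f x" "(\<lambda>n. C1_deriv (X n) x) \<longlonglongrightarrow> C1_deriv f x"
proof -
  have l: "(\<lambda>n. norm (X n - f)) \<longlonglongrightarrow> 0" using assms(1) by (simp add: LIM_zero tendsto_norm_zero)
  have "\<bar>C1_fun (X n) x - C1_fun f x\<bar> \<le> norm (X n - f)"
    "\<bar>C1_deriv (X n) x - C1_deriv f x\<bar> \<le> norm (X n - f)" for n
    using C1_le_norm[OF assms(2), of "X n - f"] by (simp_all add: C1_fun_simps C1_deriv_simps[OF assms(2)])
  then have "(\<lambda>n. C1_fun (X n) x - C1_fun f x) \<longlonglongrightarrow> 0" "(\<lambda>n. C1_deriv (X n) x - C1_deriv f x) \<longlonglongrightarrow> 0"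
    by (intro Lim_null_comparison[OF _ l] always_eventually allI; simp)+
  then show "(\<lambda>n. C1_fun (X n) x) \<longlonglongrightarrow> C1_fun f x" "(\<lambda>n. C1_deriv (X n) x) \<longlonglongrightarrow> C1_deriv f x"
    by (auto intro: LIM_zero_cancel)
qed

text \<open>The Arzela-Ascoli theorem is applied to the derivatives only: the functions vanish at 0,
  so uniform convergence of the derivatives already gives a Cauchy sequence in C^1.\<close>

lemma compact_C1_holder_ball: "compact (C1_holder_ball C)"
  unfolding compact_eq_seq_compact_metric seq_compact_def
proof (intro allI impI)
  fix X :: "nat \<Rightarrow> C1" assume X: "\<forall>n. X n \<in> C1_holder_ball C"
  have X0: "C1_fun (X n) 0 = 0" and Xd0: "\<bar>C1_deriv (X n) 0\<bar> \<le> C"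
    and Xh: "\<lbrakk>x \<in> {0..1}; y \<in> {0..1}\<rbrakk> \<Longrightarrow> \<bar>C1_deriv (X n) x - C1_deriv (X n) y\<bar> \<le> C * sqrt \<bar>x - y\<bar>"
    for n x y using X by (auto simp: C1_holder_ball_def)
  have C0: "0 \<le> C" using Xd0[of 0] by linarith
  obtain g k where k: "strict_mono (k :: nat \<Rightarrow> nat)"
    and g: "\<And>e. 0 < e \<Longrightarrow> \<exists>N. \<forall>n x. n \<ge> N \<and> x \<in> {0..1} \<longrightarrow> norm (C1_deriv (X (k n)) x - g x) < e"
  proof (rule Arzela_Ascoli[of "{0..1}" "\<lambda>n. C1_deriv (X n)" "2 * C"])
    \<comment> \<open>One \<open>C\<close> bounds the slope at 0, the other its oscillation over a
      distance of at most 1.\<close>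
    show "norm (C1_deriv (X n) x) \<le> 2 * C" if "x \<in> {0..1}" for n x
    proof -
      have "C * sqrt \<bar>x - 0\<bar> \<le> C * 1" using that C0 by (intro mult_left_mono) auto
      then show ?thesis using Xd0[of n] Xh[of x 0 n] that by auto
    qed
    fix x e :: real assume x: "x \<in> {0..1}" "0 < e"
    define d where "d = (e / (C + 1))\<^sup>2"
    have "d > 0" using x C0 by (simp add: d_def)
    moreover have "norm (C1_deriv (X n) x - C1_deriv (X n) y) < e"
      if y: "y \<in> {0..1}" "norm (x - y) < d" for n y
    proof -
      have s: "sqrt \<bar>x - y\<bar> < e / (C + 1)"
        using y(2) x C0 by (intro real_less_lsqrt) (auto simp: d_def)
      have "norm (C1_deriv (X n) x - C1_deriv (X n) y) \<le> C * sqrt \<bar>x - y\<bar>" using Xh x y by simp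
      also have "\<dots> \<le> C * (e / (C + 1))" using s C0 by (intro mult_left_mono) auto
      also have "\<dots> < e" using x C0 by (simp add: field_simps)
      finally show ?thesis .
    qed
    ultimately show "\<exists>d>0. \<forall>n y. y \<in> {0..1} \<and> norm (x - y) < d \<longrightarrow>
        norm (C1_deriv (X n) x - C1_deriv (X n) y) < e" by blast
  qed auto
  have "Cauchy (X \<circ> k)"
  proof (rule metric_CauchyI)
    fix e :: real assume e: "e > 0"
    \<comment> \<open>Two slopes then differ by at most e / 3, and \<open>norm_C1_le_deriv\<close>
      doubles this to 2 e / 3, which is less than e.\<close>
    obtain N where N: "\<And>n x. n \<ge> N \<Longrightarrow> x \<in> {0..1} \<Longrightarrow> norm (C1_deriv (X (k n)) x - g x) < e / 6"
      using g[of "e / 6"] e by auto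
    have "dist ((X \<circ> k) m) ((X \<circ> k) n) < e" if mn: "m \<ge> N" "n \<ge> N" for m n
    proof -
      have "norm (X (k m) - X (k n)) \<le> 2 * (e / 3)"
      proof (rule norm_C1_le_deriv)
        show "\<bar>C1_deriv (X (k m) - X (k n)) x\<bar> \<le> e / 3" if x: "x \<in> {0..1}" for x
          using N[OF mn(1) x] N[OF mn(2) x] unfolding C1_deriv_simps[OF x] real_norm_def by linarith
      qed (simp add: C1_fun_simps X0)
      then show ?thesis using e by (simp add: dist_norm)
    qed
    then show "\<exists>M. \<forall>m\<ge>M. \<forall>n\<ge>M. dist ((X \<circ> k) m) ((X \<circ> k) n) < e" by blast
  qed
  then obtain f where f: "(X \<circ> k) \<longlonglongrightarrow> f" using Cauchy_convergent convergent_def by blast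
  note t = tendsto_C1_fun[OF f, unfolded comp_def]
  have "f \<in> C1_holder_ball C"
    unfolding C1_holder_ball_def
  proof (intro CollectI conjI ballI)
    show "C1_fun f 0 = 0" using t(1)[of 0] X0 by (simp add: LIMSEQ_const_iff)
    show "\<bar>C1_deriv f 0\<bar> \<le> C"
      by (rule LIMSEQ_le_const2[OF tendsto_rabs[OF t(2)]]) (use Xd0 in auto)
    fix x y :: real assume xy: "x \<in> {0..1}" "y \<in> {0..1}"
    show "\<bar>C1_deriv f x - C1_deriv f y\<bar> \<le> C * sqrt \<bar>x - y\<bar>"
      by (rule LIMSEQ_le_const2[OF tendsto_rabs[OF tendsto_diff[OF t(2)[OF xy(1)] t(2)[OF xy(2)]]]])
        (use Xh xy in blast)
  qed
  then show "\<exists>l\<in>C1_holder_ball C. \<exists>r. strict_mono r \<and> (X \<circ> r) \<longlonglongrightarrow> l"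
    using k f by blast
qed

lemma continuous_on_C1_to_L2: "continuous_on A C1_to_L2"
proof -
  have 1: "norm (C1_to_L2 f) \<le> norm f" for f
  proof -
    have "norm (C1_to_L2 f) \<le> norm (abs_L2 (\<lambda>x. norm f * 1))"
      unfolding C1_to_L2_def by (rule norm_abs_L2_mono[OF C1_square_integrable square_integrable_const]) (simp add: C1_le_norm)
    also have "abs_L2 (\<lambda>x. norm f * 1) = norm f *\<^sub>R step 1"
      unfolding step_1_eq by (rule abs_L2_scaleR[OF square_integrable_const, symmetric])
    also have "norm \<dots> \<le> norm f * 1" using norm_step_le[of 1] mult_left_mono[of _ 1 "norm f"] by simp
    finally show ?thesis by simp
  qed
  have "bounded_linear C1_to_L2"
  proof (rule bounded_linear_intro[where K = 1])
    show "C1_to_L2 (f + g) = C1_to_L2 f + C1_to_L2 g" for f g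
      by (simp add: C1_to_L2_def abs_L2_add C1_square_integrable) (simp add: C1_fun_simps[abs_def] plus_C1.rep_eq)
    show "C1_to_L2 (c *\<^sub>R f) = c *\<^sub>R C1_to_L2 f" for c f
      by (simp add: C1_to_L2_def abs_L2_scaleR C1_square_integrable) (simp add: scaleR_C1.rep_eq)
  qed (simp add: 1)
  then show ?thesis by (rule linear_continuous_on)
qed


subsection \<open>The derivative of the energy\<close>

definition weight :: "real \<Rightarrow> real" where
  "weight p = (1 + p\<^sup>2) powr (- 5 / 2)"

definition weight' :: "real \<Rightarrow> real" where
  "weight' p = - 5 * p * (1 + p\<^sup>2) powr (- 7 / 2)"

lemma one_plus_square_pos: "0 < 1 + (p :: real)\<^sup>2"
  using zero_le_power2[of p] by linarith

lemma weight_pos: "0 < weight p"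
  unfolding weight_def using one_plus_square_pos[of p] by simp

lemma one_plus_square_powr_le_1:
  assumes "a \<le> 0"
  shows "(1 + (p :: real)\<^sup>2) powr a \<le> 1"
proof -
  have "(1 + p\<^sup>2) powr a \<le> (1 + p\<^sup>2) powr 0"
    using assms by (intro powr_mono) auto
  then show ?thesis using one_plus_square_pos[of p] by simp
qed

lemma weight_le_1: "weight p \<le> 1"
  unfolding weight_def by (rule one_plus_square_powr_le_1) simp

lemma weight_antimono:
  assumes "\<bar>p\<bar> \<le> C"
  shows "weight C \<le> weight p"
  unfolding weight_def
proof (rule powr_mono2')
  show "1 + p\<^sup>2 \<le> 1 + C\<^sup>2" using assms power_mono[of "\<bar>p\<bar>" C 2] by simp
qed (use one_plus_square_pos[of p] in auto)

text \<open>One power of 1 + p^2 absorbs a factor of at most quadratic growth in p. This bounds the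
  first and second derivatives of \<open>weight\<close> uniformly on the whole line.\<close>

lemma powr_absorb: "x * (1 + (p :: real)\<^sup>2) powr a \<le> y"
  if "0 \<le> x" "x \<le> c * (1 + p\<^sup>2)" "a \<le> -1" "0 \<le> c" "c \<le> y" for x y
proof -
  have "x * (1 + p\<^sup>2) powr a \<le> (c * (1 + p\<^sup>2)) * (1 + p\<^sup>2) powr a"
    using that by (intro mult_right_mono) auto
  also have "\<dots> = c * ((1 + p\<^sup>2) powr 1 * (1 + p\<^sup>2) powr a)"
    using one_plus_square_pos[of p] by simp
  also have "(1 + p\<^sup>2) powr 1 * (1 + p\<^sup>2) powr a = (1 + p\<^sup>2) powr (1 + a)"
    by (rule powr_add[symmetric])
  also have "c * \<dots> \<le> c * 1"
    using that by (intro mult_left_mono one_plus_square_powr_le_1) auto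
  finally show ?thesis using that by simp
qed

lemma abs_le_one_plus_square: "\<bar>p\<bar> \<le> 1 + (p :: real)\<^sup>2"
proof -
  have "0 \<le> (1 - \<bar>p\<bar>)\<^sup>2" by simp
  then have "2 * \<bar>p\<bar> \<le> 1 + p\<^sup>2" by (simp add: power2_diff)
  then show ?thesis by linarith
qed

lemma abs_weight'_le: "\<bar>weight' p\<bar> \<le> 5"
proof -
  have "\<bar>weight' p\<bar> = (5 * \<bar>p\<bar>) * (1 + p\<^sup>2) powr (- 7 / 2)"
    by (simp add: weight'_def abs_mult)
  also have "\<dots> \<le> 5"
    by (rule powr_absorb[where c = 5]) (use abs_le_one_plus_square[of p] in auto)
  finally show ?thesis .
qed

lemma DERIV_weight: "(weight has_real_derivative weight' p) (at p)"
proof -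
  have "((\<lambda>p. 1 + p\<^sup>2) has_real_derivative 2 * p) (at p)"
    by (auto intro!: derivative_eq_intros)
  from DERIV_fun_powr[OF this one_plus_square_pos, of "- 5 / 2"]
  show ?thesis unfolding weight_def[abs_def] weight'_def by (simp add: mult.assoc)
qed

lemma DERIV_weight':
  "(weight' has_real_derivative - 5 * (1 + p\<^sup>2) powr (- 7 / 2) + 35 * p\<^sup>2 * (1 + p\<^sup>2) powr (- 9 / 2)) (at p)"
proof -
  have a: "((\<lambda>p. 1 + p\<^sup>2) has_real_derivative 2 * p) (at p)"
    by (auto intro!: derivative_eq_intros)
  have b: "((\<lambda>p. - 5 * p) has_real_derivative - 5) (at p)"
    by (auto intro!: derivative_eq_intros)
  from DERIV_mult[OF b DERIV_fun_powr[OF a one_plus_square_pos, of "- 7 / 2"]]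
  show ?thesis unfolding weight'_def[abs_def] by (simp add: power2_eq_square algebra_simps)
qed

lemma weight_lipschitz: "\<bar>weight x - weight y\<bar> \<le> 5 * \<bar>x - y\<bar>"
  using field_differentiable_bound[of UNIV weight weight' 5 x y] DERIV_weight abs_weight'_le by auto

lemma weight'_lipschitz: "\<bar>weight' x - weight' y\<bar> \<le> 40 * \<bar>x - y\<bar>"
proof -
  \<comment> \<open>The two terms of the second derivative of \<open>weight\<close> are at most 5
    and 35 in absolute value.\<close>
  have "\<bar>- 5 * (1 + p\<^sup>2) powr (- 7 / 2) + 35 * p\<^sup>2 * (1 + p\<^sup>2) powr (- 9 / 2)\<bar> \<le> 40" for p :: real
  proof -
    have "(35 * p\<^sup>2) * (1 + p\<^sup>2) powr (- 9 / 2) \<le> 35"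
      by (rule powr_absorb[where c = 35]) auto
    moreover have "0 \<le> (35 * p\<^sup>2) * (1 + p\<^sup>2) powr (- 9 / 2)" by simp
    moreover have "(1 + p\<^sup>2) powr (- 7 / 2) \<le> 1" by (rule one_plus_square_powr_le_1) simp
    moreover have "0 \<le> (1 + p\<^sup>2) powr (- 7 / 2)" by simp
    ultimately show ?thesis unfolding abs_le_iff by linarith
  qed
  then have "norm (weight' x - weight' y) \<le> 40 * norm (x - y)"
    by (intro field_differentiable_bound[OF convex_UNIV DERIV_weight']) simp_all
  then show ?thesis by simp
qed

text \<open>Mean value inequality for \<open>weight s - weight' p * s\<close> on the ball of radius
  |a| around p, where the derivative of this function is at most 40 |a|.\<close>

lemma weight_taylor: "\<bar>weight (p + a) - weight p - weight' p * a\<bar> \<le> 40 * a\<^sup>2"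
proof -
  have "norm ((weight (p + a) - weight' p * (p + a)) - (weight p - weight' p * p)) \<le> (40 * \<bar>a\<bar>) * norm ((p + a) - p)"
  proof (rule field_differentiable_bound)
    show "convex (cball p \<bar>a\<bar>)" by (rule convex_cball)
    show "((\<lambda>s. weight s - weight' p * s) has_field_derivative weight' s - weight' p) (at s within cball p \<bar>a\<bar>)"
      if "s \<in> cball p \<bar>a\<bar>" for s
      by (rule has_field_derivative_at_within) (auto intro!: derivative_eq_intros DERIV_weight)
    show "norm (weight' s - weight' p) \<le> 40 * \<bar>a\<bar>" if "s \<in> cball p \<bar>a\<bar>" for s
    proof -
      have "\<bar>s - p\<bar> \<le> \<bar>a\<bar>" using that by (simp add: dist_real_def abs_minus_commute)
      then show ?thesis using weight'_lipschitz[of s p] by simp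
    qed
  qed (auto simp: dist_real_def)
  then show ?thesis by (simp add: algebra_simps power2_eq_square)
qed

lemma continuous_on_weight: "continuous_on A weight" "continuous_on A weight'"
  by (rule DERIV_continuous_on[OF has_field_derivative_at_within[OF DERIV_weight]],
      rule DERIV_continuous_on[OF has_field_derivative_at_within[OF DERIV_weight']])

section \<open>Energy and first variation in terms of slope and curvature\<close>

abbreviation curv :: "W22_W12_0 \<Rightarrow> real \<Rightarrow> real" where
  "curv u \<equiv> rep_L2 (D2 (V_to_W22 u))"

text \<open>The continuous representative of u', available at every point through Green's function.
  In contrast, \<open>curv\<close> is an arbitrary representative of u'', so identities for it hold
  only almost everywhere.\<close>

definition slope :: "W22_W12_0 \<Rightarrow> real \<Rightarrow> real" where
  "slope u x = inner (green' x) (D2 (V_to_W22 u))"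

lemma C1_deriv_V_to_C1: "x \<in> {0..1} \<Longrightarrow> C1_deriv (V_to_C1 u) x = slope u x"
  by (simp add: V_to_C1_def C1_deriv_green_C1 slope_def)

lemma continuous_on_slope: "continuous_on {0..1} (slope u)"
  unfolding slope_def by (intro continuous_intros continuous_on_green')

lemma abs_slope_le: "x \<in> {0..1} \<Longrightarrow> \<bar>slope u x\<bar> \<le> norm u"
  using C1_deriv_V_to_C1_le[of x u] by (simp add: C1_deriv_V_to_C1)

lemma slope_simps:
  "slope (u + v) x = slope u x + slope v x" "slope (u - v) x = slope u x - slope v x"
  "slope (c *\<^sub>R u) x = c * slope u x"
  by (simp_all add: slope_def V_to_W22_simps D1_D2_add D1_D2_diff D1_D2_scaleR inner_add_right inner_diff_right)

lemma AE_unit_I: "(\<And>x. x \<in> {0..1} \<Longrightarrow> P x) \<Longrightarrow> AE x in unit_leb. P x"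
  by (rule AE_I2) auto

lemma AE_rep_L2:
  "AE x in unit_leb. rep_L2 (f + g) x = rep_L2 f x + rep_L2 g x"
  "AE x in unit_leb. rep_L2 (f - g) x = rep_L2 f x - rep_L2 g x"
  "AE x in unit_leb. rep_L2 (c *\<^sub>R f) x = c * rep_L2 f x"
  using rep_abs_L2[OF square_integrable_add[OF rep_L2_mem[of f] rep_L2_mem[of g]]]
    rep_abs_L2[OF square_integrable_diff[OF rep_L2_mem[of f] rep_L2_mem[of g]]]
    rep_abs_L2[OF square_integrable_scale[OF rep_L2_mem[of f], of c]]
  by (simp_all add: abs_L2_add[OF rep_L2_mem rep_L2_mem, symmetric] abs_L2_diff[OF rep_L2_mem rep_L2_mem, symmetric]
      abs_L2_scaleR[OF rep_L2_mem, symmetric] abs_rep_L2)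

lemma AE_curv:
  "AE x in unit_leb. curv (u + v) x = curv u x + curv v x"
  "AE x in unit_leb. curv (u - v) x = curv u x - curv v x"
  "AE x in unit_leb. curv (c *\<^sub>R u) x = c * curv u x"
  using AE_rep_L2(1,2)[of "D2 (V_to_W22 u)" "D2 (V_to_W22 v)"] AE_rep_L2(3)[of c "D2 (V_to_W22 u)"]
  by (simp_all add: V_to_W22_simps D1_D2_add D1_D2_diff D1_D2_scaleR)

lemma AE_D1_slope: "AE x in unit_leb. rep_L2 (D1 (V_to_W22 u)) x = slope u x"
proof -
  have "AE x in unit_leb. C1_deriv (V_to_C1 u) x = slope u x"
    by (intro AE_unit_I C1_deriv_V_to_C1)
  with AE_D1_V_to_C1[of u] show ?thesis by eventually_elim simp
qed

lemma norm_V_sq: "(norm u)\<^sup>2 = (LINT x|unit_leb. (curv u x)\<^sup>2)" for u :: W22_W12_0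
  using norm_abs_L2[OF rep_L2_mem[of "D2 (V_to_W22 u)"]]
  by (simp add: abs_rep_L2 norm_W22_W12_0_def)

lemma square_integrable_continuous_mult:
  assumes b: "continuous_on {0..1} b" and f: "f \<in> square_integrable"
  shows "(\<lambda>x. b x * f x) \<in> square_integrable"
proof (rule square_integrable_dominated)
  show "(\<lambda>x. b x * f x) \<in> borel_measurable unit_leb"
    using continuous_square_integrable[OF b] f by (auto simp: square_integrable_def)
  show "(\<lambda>x. sup_unit b * f x) \<in> square_integrable"
    by (rule square_integrable_scale[OF f])
  show "AE x in unit_leb. \<bar>b x * f x\<bar> \<le> \<bar>sup_unit b * f x\<bar>"
    using sup_unit_upper[OF b] sup_unit_nonneg[OF b]
    by (intro AE_unit_I) (auto simp: abs_mult intro!: mult_right_mono)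
qed

lemma integrable_continuous_mult:
  assumes "continuous_on {0..1} b" "f \<in> square_integrable" "g \<in> square_integrable"
  shows "integrable unit_leb (\<lambda>x. b x * (f x * g x))"
  using square_integrable_prod[OF square_integrable_continuous_mult[OF assms(1,2)] assms(3)]
  by (simp add: mult.assoc)

lemma integrable_rep_L2_prod:
  "continuous_on {0..1} b \<Longrightarrow> integrable unit_leb (\<lambda>x. b x * (rep_L2 f x * rep_L2 g x))"
  by (rule integrable_continuous_mult[OF _ rep_L2_mem rep_L2_mem])

lemma LINT_abs_prod_le:
  "integrable unit_leb (\<lambda>x. \<bar>rep_L2 f x * rep_L2 g x\<bar>)"
  "(LINT x|unit_leb. \<bar>rep_L2 f x * rep_L2 g x\<bar>) \<le> norm f * norm g"
proof -
  have a: "(\<lambda>x. \<bar>rep_L2 h x\<bar>) \<in> square_integrable" for h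
    using rep_L2_mem[of h] by (auto simp: square_integrable_def)
  have n: "norm (abs_L2 (\<lambda>x. \<bar>rep_L2 h x\<bar>)) = norm h" for h
    by (rule power2_eq_imp_eq)
      (use norm_abs_L2[OF a[of h]] norm_abs_L2[OF rep_L2_mem[of h]] in \<open>auto simp: abs_rep_L2\<close>)
  show "integrable unit_leb (\<lambda>x. \<bar>rep_L2 f x * rep_L2 g x\<bar>)"
    by (intro integrable_abs square_integrable_prod rep_L2_mem)
  have "(LINT x|unit_leb. \<bar>rep_L2 f x * rep_L2 g x\<bar>)
      = inner (abs_L2 (\<lambda>x. \<bar>rep_L2 f x\<bar>)) (abs_L2 (\<lambda>x. \<bar>rep_L2 g x\<bar>))"
    by (simp add: inner_abs_L2[OF a a] abs_mult)
  also have "\<dots> \<le> norm f * norm g"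
    using norm_cauchy_schwarz n by metis
  finally show "(LINT x|unit_leb. \<bar>rep_L2 f x * rep_L2 g x\<bar>) \<le> norm f * norm g" .
qed

text \<open>The common form of the bounds on the first variation, its increments and the Taylor
  remainder: the integrand is dominated by a combination of products of L^2 functions, listed in
  \<open>L\<close> with their coefficients, and the Cauchy-Schwarz inequality is applied to each
  product.\<close>

lemma abs_LINT_le_norms:
  assumes ae: "AE x in unit_leb. \<bar>F x\<bar> \<le> (\<Sum>(c, f, g)\<leftarrow>L. c * \<bar>rep_L2 f x * rep_L2 g x\<bar>)"
    and nn: "\<And>c f g. (c, f, g) \<in> set L \<Longrightarrow> 0 \<le> c"
  shows "\<bar>LINT x|unit_leb. F x\<bar> \<le> (\<Sum>(c, f, g)\<leftarrow>L. c * (norm f * norm g))"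
proof -
  have *: "integrable unit_leb (\<lambda>x. \<Sum>(c, f, g)\<leftarrow>L. c * \<bar>rep_L2 f x * rep_L2 g x\<bar>) \<and>
      (LINT x|unit_leb. (\<Sum>(c, f, g)\<leftarrow>L. c * \<bar>rep_L2 f x * rep_L2 g x\<bar>))
        \<le> (\<Sum>(c, f, g)\<leftarrow>L. c * (norm f * norm g))"
    using nn
  proof (induction L)
    case (Cons a L)
    obtain c f g where a: "a = (c, f, g)" by (cases a)
    have c: "0 \<le> c" using Cons.prems[of c f g] a by simp
    have IH: "integrable unit_leb (\<lambda>x. \<Sum>(c, f, g)\<leftarrow>L. c * \<bar>rep_L2 f x * rep_L2 g x\<bar>)"
      "(LINT x|unit_leb. (\<Sum>(c, f, g)\<leftarrow>L. c * \<bar>rep_L2 f x * rep_L2 g x\<bar>))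
        \<le> (\<Sum>(c, f, g)\<leftarrow>L. c * (norm f * norm g))"
      using Cons by auto
    have i: "integrable unit_leb (\<lambda>x. c * \<bar>rep_L2 f x * rep_L2 g x\<bar>)"
      using LINT_abs_prod_le(1) by (rule integrable_mult_right)
    have "(LINT x|unit_leb. c * \<bar>rep_L2 f x * rep_L2 g x\<bar>) = c * (LINT x|unit_leb. \<bar>rep_L2 f x * rep_L2 g x\<bar>)"
      by (rule integral_mult_right_zero)
    also have "\<dots> \<le> c * (norm f * norm g)"
      by (rule mult_left_mono[OF LINT_abs_prod_le(2) c])
    finally have le: "(LINT x|unit_leb. c * \<bar>rep_L2 f x * rep_L2 g x\<bar>) \<le> c * (norm f * norm g)" .
    show ?case
      unfolding a list.map sum_list.Cons prod.case
      using Bochner_Integration.integral_add[OF i IH(1)] Bochner_Integration.integrable_add[OF i IH(1)] le IH(2)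
      by linarith
  qed simp
  have "\<bar>LINT x|unit_leb. F x\<bar> \<le> (LINT x|unit_leb. \<bar>F x\<bar>)" by (rule integral_abs_bound)
  also have "\<dots> \<le> (LINT x|unit_leb. (\<Sum>(c, f, g)\<leftarrow>L. c * \<bar>rep_L2 f x * rep_L2 g x\<bar>))"
    using ae by (intro integral_mono_AE' conjunct1[OF *]) (auto elim!: eventually_mono)
  finally show ?thesis using * by linarith
qed

lemma continuous_on_weight_slope:
  "continuous_on {0..1} (\<lambda>x. weight (slope u x))" "continuous_on {0..1} (\<lambda>x. weight' (slope u x))"
  by (rule continuous_on_compose2[OF continuous_on_weight(1)[of UNIV] continuous_on_slope subset_UNIV],
      rule continuous_on_compose2[OF continuous_on_weight(2)[of UNIV] continuous_on_slope subset_UNIV])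

lemma elastic_energy_eq: "elastic_energy u = (LINT x|unit_leb. weight (slope u x) * (curv u x * curv u x))"
  unfolding elastic_energy_def
proof (rule integral_cong_AE)
  show "(\<lambda>x. (curv u x)\<^sup>2 / (1 + (rep_L2 (D1 (V_to_W22 u)) x)\<^sup>2) powr (5 / 2)) \<in> borel_measurable unit_leb"
  proof -
    have [measurable]: "rep_L2 f \<in> borel_measurable unit_leb" for f
      using rep_L2_mem[of f] by (simp add: square_integrable_def)
    show ?thesis by measurable
  qed
  show "(\<lambda>x. weight (slope u x) * (curv u x * curv u x)) \<in> borel_measurable unit_leb"
    by (rule borel_measurable_integrable[OF integrable_rep_L2_prod[OF continuous_on_weight_slope(1)]])
  show "AE x in unit_leb. (curv u x)\<^sup>2 / (1 + (rep_L2 (D1 (V_to_W22 u)) x)\<^sup>2) powr (5 / 2)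
      = weight (slope u x) * (curv u x * curv u x)"
    using AE_D1_slope[of u]
  proof eventually_elim
    case (elim x)
    have "(1 + (slope u x)\<^sup>2) powr (- 5 / 2) = 1 / (1 + (slope u x)\<^sup>2) powr (5 / 2)"
      using powr_minus_divide[of "1 + (slope u x)\<^sup>2" "5 / 2"] by simp
    then show ?case unfolding elim by (simp add: weight_def power2_eq_square)
  qed
qed

text \<open>The first variation, obtained formally by differentiating \<open>weight\<close> (u' + s
  h') (u'' + s h'')^2 at s = 0.\<close>

definition energy_diff :: "W22_W12_0 \<Rightarrow> W22_W12_0 \<Rightarrow> real" where
  "energy_diff u h = (LINT x|unit_leb. 2 * weight (slope u x) * (curv u x * curv h x)
    + weight' (slope u x) * slope h x * (curv u x * curv u x))"

lemma energy_diff_integrable: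
  "integrable unit_leb (\<lambda>x. 2 * weight (slope u x) * (curv u x * curv h x)
    + weight' (slope u x) * slope h x * (curv u x * curv u x))"
  by (intro Bochner_Integration.integrable_add integrable_rep_L2_prod continuous_intros
      continuous_on_weight_slope continuous_on_slope)

lemma elastic_energy_integrable:
  "integrable unit_leb (\<lambda>x. weight (slope u x) * (curv u x * curv u x))"
  by (intro integrable_rep_L2_prod continuous_on_weight_slope)

lemma energy_diff_bound: "\<bar>energy_diff u h\<bar> \<le> (2 * norm u + 5 * (norm u)\<^sup>2) * norm h"
proof -
  have "\<bar>energy_diff u h\<bar> \<le> (\<Sum>(c, f, g)\<leftarrow>[(2, D2 (V_to_W22 u), D2 (V_to_W22 h)),
      (5 * norm h, D2 (V_to_W22 u), D2 (V_to_W22 u))]. c * (norm f * norm g))"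
    unfolding energy_diff_def
  proof (rule abs_LINT_le_norms)
    have "\<bar>2 * weight (slope u x) * (curv u x * curv h x) + weight' (slope u x) * slope h x * (curv u x * curv u x)\<bar>
        \<le> 2 * \<bar>curv u x * curv h x\<bar> + 5 * norm h * \<bar>curv u x * curv u x\<bar>" if x: "x \<in> {0..1}" for x
    proof -
      have "\<bar>2 * weight (slope u x) * (curv u x * curv h x)\<bar> \<le> 2 * \<bar>curv u x * curv h x\<bar>"
        using weight_pos[of "slope u x"] weight_le_1[of "slope u x"]
        unfolding abs_mult by (intro mult_right_mono) auto
      moreover have "\<bar>weight' (slope u x) * slope h x * (curv u x * curv u x)\<bar> \<le> 5 * norm h * \<bar>curv u x * curv u x\<bar>"
        unfolding abs_mult[of "_ * _" "curv u x * curv u x"] abs_mult[of "weight' _"]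
        by (intro mult_right_mono mult_mono abs_weight'_le abs_slope_le x) auto
      ultimately show ?thesis by linarith
    qed
    then show "AE x in unit_leb. \<bar>2 * weight (slope u x) * (curv u x * curv h x) + weight' (slope u x) * slope h x * (curv u x * curv u x)\<bar>
        \<le> (\<Sum>(c, f, g)\<leftarrow>[(2, D2 (V_to_W22 u), D2 (V_to_W22 h)),
          (5 * norm h, D2 (V_to_W22 u), D2 (V_to_W22 u))]. c * \<bar>rep_L2 f x * rep_L2 g x\<bar>)"
      by (intro AE_unit_I) simp
  qed auto
  then show ?thesis by (simp add: norm_W22_W12_0_def[symmetric] algebra_simps power2_eq_square)
qed

lemma energy_diff_linear:
  "energy_diff u (h + k) = energy_diff u h + energy_diff u k"
  "energy_diff u (c *\<^sub>R h) = c * energy_diff u h"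
proof -
  have "energy_diff u (h + k) = (LINT x|unit_leb.
      (2 * weight (slope u x) * (curv u x * curv h x) + weight' (slope u x) * slope h x * (curv u x * curv u x)) +
      (2 * weight (slope u x) * (curv u x * curv k x) + weight' (slope u x) * slope k x * (curv u x * curv u x)))"
    unfolding energy_diff_def
  proof (rule integral_cong_AE)
    show "AE x in unit_leb. 2 * weight (slope u x) * (curv u x * curv (h + k) x) + weight' (slope u x) * slope (h + k) x * (curv u x * curv u x)
      = (2 * weight (slope u x) * (curv u x * curv h x) + weight' (slope u x) * slope h x * (curv u x * curv u x)) +
      (2 * weight (slope u x) * (curv u x * curv k x) + weight' (slope u x) * slope k x * (curv u x * curv u x))"
      using AE_curv(1)[of h k] by eventually_elim (simp add: slope_simps algebra_simps)
  qed (intro borel_measurable_integrable Bochner_Integration.integrable_add[OF energy_diff_integrable energy_diff_integrable]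
      energy_diff_integrable)+
  then show "energy_diff u (h + k) = energy_diff u h + energy_diff u k"
    unfolding Bochner_Integration.integral_add[OF energy_diff_integrable energy_diff_integrable] energy_diff_def .
  have "energy_diff u (c *\<^sub>R h) = (LINT x|unit_leb.
      c * (2 * weight (slope u x) * (curv u x * curv h x) + weight' (slope u x) * slope h x * (curv u x * curv u x)))"
    unfolding energy_diff_def
  proof (rule integral_cong_AE)
    show "AE x in unit_leb. 2 * weight (slope u x) * (curv u x * curv (c *\<^sub>R h) x) + weight' (slope u x) * slope (c *\<^sub>R h) x * (curv u x * curv u x)
      = c * (2 * weight (slope u x) * (curv u x * curv h x) + weight' (slope u x) * slope h x * (curv u x * curv u x))"
      using AE_curv(3)[of c h] by eventually_elim (simp add: slope_simps algebra_simps)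
  qed (intro borel_measurable_integrable integrable_mult_right energy_diff_integrable)+
  then show "energy_diff u (c *\<^sub>R h) = c * energy_diff u h"
    unfolding integral_mult_right_zero energy_diff_def .
qed

lemma bounded_linear_energy_diff: "bounded_linear (energy_diff u)"
proof (rule bounded_linear_intro[where K = "2 * norm u + 5 * (norm u)\<^sup>2"])
  show "norm (energy_diff u h) \<le> norm h * (2 * norm u + 5 * (norm u)\<^sup>2)" for h
    using energy_diff_bound[of u h] by (simp add: mult.commute)
qed (simp_all add: energy_diff_linear)

text \<open>Here p, q stand for slope and curvature of u, and a, b for those of h. The three terms
  come from the Taylor remainder of \<open>weight\<close>, from its Lipschitz constant 5 in the
  mixed term 2 q b, and from \<open>weight\<close> being at most 1.\<close>

lemma energy_integrand_taylor:
  "\<bar>weight (p + a) * ((q + b) * (q + b)) - weight p * (q * q) - (2 * weight p * (q * b) + weight' p * a * (q * q))\<bar>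
    \<le> 40 * a\<^sup>2 * \<bar>q * q\<bar> + 10 * \<bar>a\<bar> * \<bar>q * b\<bar> + 1 * \<bar>b * b\<bar>"
proof -
  have eq: "weight (p + a) * ((q + b) * (q + b)) - weight p * (q * q) - (2 * weight p * (q * b) + weight' p * a * (q * q))
      = (weight (p + a) - weight p - weight' p * a) * (q * q) + 2 * (weight (p + a) - weight p) * (q * b) + weight (p + a) * (b * b)"
    by (simp add: algebra_simps)
  have "\<bar>(weight (p + a) - weight p - weight' p * a) * (q * q)\<bar> \<le> 40 * a\<^sup>2 * \<bar>q * q\<bar>"
    unfolding abs_mult[of _ "q * q"] by (intro mult_right_mono weight_taylor) auto
  moreover have "\<bar>2 * (weight (p + a) - weight p) * (q * b)\<bar> \<le> 10 * \<bar>a\<bar> * \<bar>q * b\<bar>"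
    unfolding abs_mult[of _ "q * b"] using weight_lipschitz[of "p + a" p] by (intro mult_right_mono) auto
  moreover have "\<bar>weight (p + a) * (b * b)\<bar> \<le> 1 * \<bar>b * b\<bar>"
    unfolding abs_mult[of _ "b * b"] using weight_le_1[of "p + a"] weight_pos[of "p + a"] by (intro mult_right_mono) auto
  ultimately show ?thesis unfolding eq by linarith
qed

text \<open>Since sup |h'| is at most \<open>norm h\<close>, the remainder is quadratic in
  \<open>norm h\<close> for all h, not merely for small ones.\<close>

lemma elastic_energy_remainder:
  "\<bar>elastic_energy (u + h) - elastic_energy u - energy_diff u h\<bar>
    \<le> (40 * (norm u)\<^sup>2 + 10 * norm u + 1) * (norm h)\<^sup>2"
proof -
  let ?R = "\<lambda>x. weight (slope (u + h) x) * (curv (u + h) x * curv (u + h) x) - weight (slope u x) * (curv u x * curv u x)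
      - (2 * weight (slope u x) * (curv u x * curv h x) + weight' (slope u x) * slope h x * (curv u x * curv u x))"
  have eq: "elastic_energy (u + h) - elastic_energy u - energy_diff u h = (LINT x|unit_leb. ?R x)"
    unfolding elastic_energy_eq energy_diff_def
    by (subst Bochner_Integration.integral_diff[OF Bochner_Integration.integrable_diff[OF elastic_energy_integrable elastic_energy_integrable]
          energy_diff_integrable],
        subst Bochner_Integration.integral_diff[OF elastic_energy_integrable elastic_energy_integrable]) (rule refl)
  have "\<bar>LINT x|unit_leb. ?R x\<bar> \<le> (\<Sum>(c, f, g)\<leftarrow>[(40 * (norm h)\<^sup>2, D2 (V_to_W22 u), D2 (V_to_W22 u)),
      (10 * norm h, D2 (V_to_W22 u), D2 (V_to_W22 h)), (1, D2 (V_to_W22 h), D2 (V_to_W22 h))]. c * (norm f * norm g))"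
  proof (rule abs_LINT_le_norms)
    have sl: "AE x in unit_leb. \<bar>slope h x\<bar> \<le> norm h"
      by (intro AE_unit_I abs_slope_le)
    show "AE x in unit_leb. \<bar>?R x\<bar> \<le> (\<Sum>(c, f, g)\<leftarrow>[(40 * (norm h)\<^sup>2, D2 (V_to_W22 u), D2 (V_to_W22 u)),
      (10 * norm h, D2 (V_to_W22 u), D2 (V_to_W22 h)), (1, D2 (V_to_W22 h), D2 (V_to_W22 h))].
        c * \<bar>rep_L2 f x * rep_L2 g x\<bar>)"
      using sl AE_curv(1)[of u h]
    proof eventually_elim
      case (elim x)
      have "40 * (slope h x)\<^sup>2 * \<bar>curv u x * curv u x\<bar> \<le> 40 * (norm h)\<^sup>2 * \<bar>curv u x * curv u x\<bar>"
        using elim(1) power_mono[OF elim(1), of 2] by (intro mult_right_mono) auto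
      moreover have "10 * \<bar>slope h x\<bar> * \<bar>curv u x * curv h x\<bar> \<le> 10 * norm h * \<bar>curv u x * curv h x\<bar>"
        using elim(1) by (intro mult_right_mono) auto
      ultimately show ?case
        using energy_integrand_taylor[of "slope u x" "slope h x" "curv u x" "curv h x"]
        unfolding elim(2) slope_simps list.map sum_list.Cons sum_list.Nil prod.case by linarith
    qed
  qed auto
  also have "\<dots> = (40 * (norm u)\<^sup>2 + 10 * norm u + 1) * (norm h)\<^sup>2"
    unfolding list.map sum_list.Cons sum_list.Nil prod.case norm_W22_W12_0_def[symmetric]
    by (simp add: power2_eq_square distrib_right distrib_left mult_ac)
  finally show ?thesis unfolding eq .
qed

lemma has_derivative_quadratic_remainder:
  assumes "bounded_linear D" "\<And>h. norm (f (u + h) - f u - D h) \<le> K * (norm h)\<^sup>2"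
  shows "(f has_derivative D) (at u)"
  unfolding has_derivative_within_alt
proof (intro conjI allI impI assms(1))
  fix e :: real assume e: "e > 0"
  define d where "d = e / (\<bar>K\<bar> + 1)"
  have d: "d > 0" using e by (simp add: d_def)
  have "K * d \<le> (\<bar>K\<bar> + 1) * d" using d by (intro mult_right_mono) auto
  also have "\<dots> = e" by (simp add: d_def)
  finally have d: "d > 0" "K * d \<le> e" using d by auto
  show "\<exists>d>0. \<forall>y\<in>UNIV. norm (y - u) < d \<longrightarrow> norm (f y - f u - D (y - u)) \<le> e * norm (y - u)"
  proof (intro exI[of _ d] conjI d(1) ballI impI)
    fix y assume y: "norm (y - u) < d"
    have "K * norm (y - u) \<le> e"
    proof (cases "K \<ge> 0")
      case True
      then show ?thesis using mult_left_mono[of "norm (y - u)" d K] y d(2) by linarith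
    next
      case False
      then show ?thesis using e mult_nonpos_nonneg[of K "norm (y - u)"] by simp
    qed
    then have "K * norm (y - u) * norm (y - u) \<le> e * norm (y - u)" by (rule mult_right_mono) simp
    then show "norm (f y - f u - D (y - u)) \<le> e * norm (y - u)"
      using assms(2)[of "y - u"] by (simp add: power2_eq_square mult.assoc)
  qed
qed

lemma elastic_energy_has_derivative: "(elastic_energy has_derivative energy_diff u) (at u)"
  using elastic_energy_remainder
  by (intro has_derivative_quadratic_remainder[OF bounded_linear_energy_diff]) (simp only: real_norm_def)

lemma energy_deriv_eq: "energy_deriv u = energy_diff u"
  unfolding energy_deriv_def using frechet_derivative_at[OF elastic_energy_has_derivative] by simp

lemma isCont_elastic_energy: "isCont elastic_energy u"
  by (rule has_derivative_continuous[OF elastic_energy_has_derivative])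

text \<open>Here p, r are slope and curvature at the base point, s, d their increments, and a, b
  slope and curvature of the direction. The difference telescopes into five products, each estimated
  by the bound or the Lipschitz constant of \<open>weight\<close> or \<open>weight'\<close>.\<close>

lemma energy_diff_integrand_continuity:
  assumes "\<bar>s\<bar> \<le> S" "\<bar>a\<bar> \<le> N"
  shows "\<bar>(2 * weight (p + s) * ((r + d) * b) + weight' (p + s) * a * ((r + d) * (r + d)))
      - (2 * weight p * (r * b) + weight' p * a * (r * r))\<bar>
    \<le> 2 * \<bar>d * b\<bar> + 10 * S * \<bar>r * b\<bar> + 10 * N * \<bar>r * d\<bar> + 5 * N * \<bar>d * d\<bar> + 40 * S * N * \<bar>r * r\<bar>"
proof -
  have eq: "(2 * weight (p + s) * ((r + d) * b) + weight' (p + s) * a * ((r + d) * (r + d)))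
      - (2 * weight p * (r * b) + weight' p * a * (r * r))
    = 2 * weight (p + s) * (d * b) + 2 * (weight (p + s) - weight p) * (r * b) + 2 * weight' (p + s) * a * (r * d)
      + weight' (p + s) * a * (d * d) + (weight' (p + s) - weight' p) * a * (r * r)"
    by (simp add: algebra_simps)
  have S: "0 \<le> S" "0 \<le> N" using assms by linarith+
  have "\<bar>2 * weight (p + s) * (d * b)\<bar> \<le> 2 * \<bar>d * b\<bar>"
    unfolding abs_mult[of _ "d * b"] using weight_le_1[of "p + s"] weight_pos[of "p + s"] by (intro mult_right_mono) auto
  moreover have "\<bar>2 * (weight (p + s) - weight p) * (r * b)\<bar> \<le> 10 * S * \<bar>r * b\<bar>"
    unfolding abs_mult[of _ "r * b"] using weight_lipschitz[of "p + s" p] assms by (intro mult_right_mono) auto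
  moreover have a: "\<bar>weight' (p + s) * a\<bar> \<le> 5 * N"
    unfolding abs_mult by (intro mult_mono abs_weight'_le assms) auto
  then have "\<bar>2 * weight' (p + s) * a * (r * d)\<bar> \<le> 10 * N * \<bar>r * d\<bar>"
    unfolding abs_mult[of _ "r * d"] by (intro mult_right_mono) auto
  moreover have "\<bar>weight' (p + s) * a * (d * d)\<bar> \<le> 5 * N * \<bar>d * d\<bar>"
    unfolding abs_mult[of _ "d * d"] using a by (intro mult_right_mono) auto
  moreover have "\<bar>(weight' (p + s) - weight' p) * a * (r * r)\<bar> \<le> 40 * S * N * \<bar>r * r\<bar>"
  proof -
    have "\<bar>weight' (p + s) - weight' p\<bar> \<le> 40 * S" using weight'_lipschitz[of "p + s" p] assms by simp
    then show ?thesis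
      unfolding abs_mult[of _ "r * r"] abs_mult[of _ a] using assms S by (intro mult_right_mono mult_mono) auto
  qed
  ultimately show ?thesis unfolding eq
    by (intro order_trans[OF abs_triangle_ineq add_mono])
qed

text \<open>Local Lipschitz continuity of the derivative in the dual norm, by which the variational
  inequality passes to strong limits.\<close>

lemma energy_diff_continuity:
  "\<bar>energy_diff u h - energy_diff m h\<bar>
    \<le> (2 + 20 * norm m + 5 * norm (u - m) + 40 * (norm m)\<^sup>2) * norm (u - m) * norm h"
proof -
  let ?R = "\<lambda>x. (2 * weight (slope u x) * (curv u x * curv h x) + weight' (slope u x) * slope h x * (curv u x * curv u x))
      - (2 * weight (slope m x) * (curv m x * curv h x) + weight' (slope m x) * slope h x * (curv m x * curv m x))"
  let ?L = "[(2, D2 (V_to_W22 (u - m)), D2 (V_to_W22 h)), (10 * norm (u - m), D2 (V_to_W22 m), D2 (V_to_W22 h)),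
     (10 * norm h, D2 (V_to_W22 m), D2 (V_to_W22 (u - m))), (5 * norm h, D2 (V_to_W22 (u - m)), D2 (V_to_W22 (u - m))),
     (40 * norm (u - m) * norm h, D2 (V_to_W22 m), D2 (V_to_W22 m))]"
  have eq: "energy_diff u h - energy_diff m h = (LINT x|unit_leb. ?R x)"
    unfolding energy_diff_def by (rule Bochner_Integration.integral_diff[OF energy_diff_integrable energy_diff_integrable, symmetric])
  have "\<bar>LINT x|unit_leb. ?R x\<bar> \<le> (\<Sum>(c, f, g)\<leftarrow>?L. c * (norm f * norm g))"
  proof (rule abs_LINT_le_norms)
    have sl: "AE x in unit_leb. \<bar>slope h x\<bar> \<le> norm h \<and> \<bar>slope (u - m) x\<bar> \<le> norm (u - m)"
      by (intro AE_unit_I conjI abs_slope_le)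
    show "AE x in unit_leb. \<bar>?R x\<bar> \<le> (\<Sum>(c, f, g)\<leftarrow>?L. c * \<bar>rep_L2 f x * rep_L2 g x\<bar>)"
      using sl AE_curv(2)[of u m]
    proof eventually_elim
      case (elim x)
      then have split: "curv u x = curv m x + curv (u - m) x" "slope u x = slope m x + slope (u - m) x"
        by (simp_all add: slope_simps)
      show ?case
        unfolding split list.map sum_list.Cons sum_list.Nil prod.case
        using energy_diff_integrand_continuity[of "slope (u - m) x" "norm (u - m)" "slope h x" "norm h"
            "slope m x" "curv m x" "curv (u - m) x" "curv h x"] elim(1) by linarith
    qed
  qed auto
  also have "\<dots> = (2 + 20 * norm m + 5 * norm (u - m) + 40 * (norm m)\<^sup>2) * norm (u - m) * norm h"
    unfolding list.map sum_list.Cons sum_list.Nil prod.case norm_W22_W12_0_def[symmetric]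
    by (simp add: power2_eq_square distrib_right distrib_left mult_ac)
  finally show ?thesis unfolding eq .
qed

text \<open>Slope and curvature are p, q for one function and s, r for the other. Freezing the
  weight at p leaves the negative square of q - r; the rest is of order |p - s|. The coefficient 20
  is 5 from the terms with \<open>weight'\<close> plus 15 = 10 * 3/2, where 10 is twice the
  Lipschitz constant of \<open>weight\<close> and 3/2 comes from |r (q - r)| <= 3/2 (q^2 +
  r^2).\<close>

lemma energy_diff_monotone_integrand:
  assumes "\<bar>p - s\<bar> \<le> \<sigma>" "\<bar>p\<bar> \<le> C"
  shows "(2 * weight p * (q * (r - q)) + weight' p * (s - p) * (q * q)) + (2 * weight s * (r * (q - r)) + weight' s * (p - s) * (r * r))
    \<le> 20 * \<sigma> * (q * q) + 20 * \<sigma> * (r * r) - 2 * weight C * ((q - r) * (q - r))"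
proof -
  have eq: "(2 * weight p * (q * (r - q)) + weight' p * (s - p) * (q * q)) + (2 * weight s * (r * (q - r)) + weight' s * (p - s) * (r * r))
    = - 2 * weight p * ((q - r) * (q - r)) + 2 * (weight s - weight p) * (r * (q - r)) + weight' p * (s - p) * (q * q)
      + weight' s * (p - s) * (r * r)"
    by (simp add: algebra_simps)
  have \<sigma>: "0 \<le> \<sigma>" using assms by linarith
  have "2 * weight C * ((q - r) * (q - r)) \<le> 2 * weight p * ((q - r) * (q - r))"
    using weight_antimono[OF assms(2)] by (intro mult_right_mono) auto
  moreover have "weight' p * (s - p) * (q * q) \<le> 5 * \<sigma> * (q * q)" "weight' s * (p - s) * (r * r) \<le> 5 * \<sigma> * (r * r)"
  proof -
    have "\<bar>weight' p * (s - p)\<bar> \<le> 5 * \<sigma>" "\<bar>weight' s * (p - s)\<bar> \<le> 5 * \<sigma>"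
      unfolding abs_mult using assms by (intro mult_mono abs_weight'_le; linarith)+
    then show "weight' p * (s - p) * (q * q) \<le> 5 * \<sigma> * (q * q)" "weight' s * (p - s) * (r * r) \<le> 5 * \<sigma> * (r * r)"
      by (auto intro!: mult_right_mono)
  qed
  moreover have "2 * (weight s - weight p) * (r * (q - r)) \<le> 15 * \<sigma> * (q * q) + 15 * \<sigma> * (r * r)"
  proof -
    have 1: "\<bar>r * (q - r)\<bar> \<le> 3 / 2 * (q * q + r * r)"
    proof -
      have "0 \<le> (q - r) * (q - r)" "0 \<le> (q + r) * (q + r)" "0 \<le> q * q" "0 \<le> r * r" by simp_all
      moreover from this have "2 * (r * q) \<le> q * q + r * r" "- 2 * (r * q) \<le> q * q + r * r"
        by (simp_all add: algebra_simps)
      ultimately have "r * q - r * r \<le> 3 / 2 * (q * q) + 3 / 2 * (r * r)"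
        "- (r * q - r * r) \<le> 3 / 2 * (q * q) + 3 / 2 * (r * r)"
        by linarith+
      then show ?thesis by (simp add: abs_le_iff right_diff_distrib distrib_left)
    qed
    have "2 * (weight s - weight p) * (r * (q - r)) \<le> \<bar>2 * (weight s - weight p)\<bar> * \<bar>r * (q - r)\<bar>"
      by (metis abs_ge_self abs_mult)
    also have "\<dots> \<le> (10 * \<sigma>) * (3 / 2 * (q * q + r * r))"
    proof (rule mult_mono[OF _ 1])
      have "\<bar>weight s - weight p\<bar> \<le> 5 * \<sigma>"
        using weight_lipschitz[of s p] assms(1) unfolding abs_minus_commute[of s p] by simp
      then show "\<bar>2 * (weight s - weight p)\<bar> \<le> 10 * \<sigma>"
        unfolding abs_mult by simp
    qed (use \<sigma> in auto)
    finally show ?thesis by (simp add: algebra_simps)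
  qed
  ultimately have "- 2 * weight p * ((q - r) * (q - r)) + 2 * (weight s - weight p) * (r * (q - r)) + weight' p * (s - p) * (q * q)
      + weight' s * (p - s) * (r * r) \<le> - (2 * weight C * ((q - r) * (q - r))) + (15 * \<sigma> * (q * q) + 15 * \<sigma> * (r * r))
      + 5 * \<sigma> * (q * q) + 5 * \<sigma> * (r * r)"
    by (intro add_mono) simp_all
  also have "\<dots> = 20 * \<sigma> * (q * q) + 20 * \<sigma> * (r * r) - 2 * weight C * ((q - r) * (q - r))" by simp
  finally show ?thesis unfolding eq .
qed

text \<open>Uniform closeness of the slopes makes the leading part of the energy a monotone operator up to a
  small error.\<close>

lemma energy_diff_almost_monotone:
  assumes \<sigma>: "\<And>x. x \<in> {0..1} \<Longrightarrow> \<bar>slope u x - slope v x\<bar> \<le> \<sigma>"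
  shows "2 * weight (norm u) * (norm (u - v))\<^sup>2
    \<le> 20 * \<sigma> * ((norm u)\<^sup>2 + (norm v)\<^sup>2) - (energy_diff u (v - u) + energy_diff v (u - v))"
proof -
  let ?I = "\<lambda>x. (2 * weight (slope u x) * (curv u x * curv (v - u) x) + weight' (slope u x) * slope (v - u) x * (curv u x * curv u x))
      + (2 * weight (slope v x) * (curv v x * curv (u - v) x) + weight' (slope v x) * slope (u - v) x * (curv v x * curv v x))"
  let ?J = "\<lambda>x. 20 * \<sigma> * (curv u x * curv u x) + 20 * \<sigma> * (curv v x * curv v x)
    - 2 * weight (norm u) * (curv (u - v) x * curv (u - v) x)"
  have i: "integrable unit_leb (\<lambda>x. curv w x * curv w x)" for w
    by (intro square_integrable_prod rep_L2_mem)
  have Ii: "integrable unit_leb ?I"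
    by (intro Bochner_Integration.integrable_add[OF energy_diff_integrable energy_diff_integrable])
  have Ji: "integrable unit_leb ?J" by (intro Bochner_Integration.integrable_add Bochner_Integration.integrable_diff integrable_mult_right i)
  have "energy_diff u (v - u) + energy_diff v (u - v) = (LINT x|unit_leb. ?I x)"
    unfolding energy_diff_def by (rule Bochner_Integration.integral_add[OF energy_diff_integrable energy_diff_integrable, symmetric])
  also have "\<dots> \<le> (LINT x|unit_leb. ?J x)"
  proof (rule integral_mono_AE[OF Ii Ji])
    have sl: "AE x in unit_leb. \<bar>slope u x - slope v x\<bar> \<le> \<sigma> \<and> \<bar>slope u x\<bar> \<le> norm u"
      by (intro AE_unit_I conjI abs_slope_le \<sigma>)
    show "AE x in unit_leb. ?I x \<le> ?J x"
      using sl AE_curv(2)[of u v] AE_curv(2)[of v u]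
    proof eventually_elim
      case (elim x)
      show ?case
        unfolding elim(2,3) slope_simps
        by (rule energy_diff_monotone_integrand) (use elim(1) in auto)
    qed
  qed
  also have "\<dots> = 20 * \<sigma> * (norm u)\<^sup>2 + 20 * \<sigma> * (norm v)\<^sup>2 - 2 * weight (norm u) * (norm (u - v))\<^sup>2"
    unfolding norm_V_sq power2_eq_square[of "curv _ _"] by (simp add: i)
  finally show ?thesis by (simp add: algebra_simps)
qed


subsection \<open>Almost critical sequences\<close>

lemma AE_V_to_C1: "AE x in unit_leb. rep_L2 (V_to_L2 u) x = C1_fun (V_to_C1 u) x"
  using rep_abs_L2[OF C1_square_integrable, of "V_to_C1 u"] C1_to_L2_V_to_C1[of u]
  by (simp add: C1_to_L2_def)

lemma norm_V_to_C1_le: "norm (V_to_C1 u) \<le> 2 * norm u"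
  by (rule norm_C1_le_deriv[OF _ C1_deriv_V_to_C1_le]) (simp add: V_to_C1_def C1_fun_green_C1)

lemma tendsto_V_to_C1:
  assumes "X \<longlonglongrightarrow> m"
  shows "(\<lambda>n. V_to_C1 (X n)) \<longlonglongrightarrow> V_to_C1 m"
proof -
  have "(\<lambda>n. 2 * norm (X n - m)) \<longlonglongrightarrow> 2 * norm (m - m)" by (intro tendsto_intros assms)
  then have l: "(\<lambda>n. 2 * norm (X n - m)) \<longlonglongrightarrow> 0" by simp
  have "(\<lambda>n. V_to_C1 (X n) - V_to_C1 m) \<longlonglongrightarrow> 0"
    by (rule Lim_null_comparison[OF _ l])
      (intro always_eventually allI, simp add: V_to_C1_diff[symmetric] norm_V_to_C1_le)
  then show ?thesis by (rule LIM_zero_cancel)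
qed

text \<open>Convergence in the energy space gives pointwise convergence of the C^1 representatives,
  and the countably many exceptional null sets can be united.\<close>

lemma admissible_LIMSEQ:
  assumes X: "\<And>n. X n \<in> admissible \<psi>" and lim: "X \<longlonglongrightarrow> m"
  shows "m \<in> admissible \<psi>"
proof -
  have "AE x in unit_leb. \<psi> x \<le> C1_fun (V_to_C1 (X n)) x" for n
    using X[of n] AE_V_to_C1[of "X n"] unfolding admissible_def by (auto elim: eventually_elim2)
  then have "AE x in unit_leb. \<forall>n. \<psi> x \<le> C1_fun (V_to_C1 (X n)) x"
    by (simp add: AE_all_countable)
  moreover have "AE x in unit_leb. (\<lambda>n. C1_fun (V_to_C1 (X n)) x) \<longlonglongrightarrow> C1_fun (V_to_C1 m) x"
    by (intro AE_unit_I tendsto_C1_fun tendsto_V_to_C1 lim)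
  ultimately have "AE x in unit_leb. \<psi> x \<le> rep_L2 (V_to_L2 m) x"
    using AE_V_to_C1[of m]
  proof eventually_elim
    case (elim x)
    then show ?case using LIMSEQ_le_const[OF elim(2)] by simp
  qed
  then show ?thesis by (simp add: admissible_def)
qed

lemma tendsto_energy_diff:
  assumes "X \<longlonglongrightarrow> m" "H \<longlonglongrightarrow> h"
  shows "(\<lambda>n. energy_diff (X n) (H n)) \<longlonglongrightarrow> energy_diff m h"
proof -
  have "(\<lambda>n. (2 + 20 * norm m + 5 * norm (X n - m) + 40 * (norm m)\<^sup>2) * norm (X n - m) * norm (H n))
      \<longlonglongrightarrow> (2 + 20 * norm m + 5 * norm (m - m) + 40 * (norm m)\<^sup>2) * norm (m - m) * norm h"
    by (intro tendsto_intros assms)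
  then have "(\<lambda>n. (2 + 20 * norm m + 5 * norm (X n - m) + 40 * (norm m)\<^sup>2) * norm (X n - m) * norm (H n)) \<longlonglongrightarrow> 0"
    by simp
  then have "(\<lambda>n. energy_diff (X n) (H n) - energy_diff m (H n)) \<longlonglongrightarrow> 0"
    by (rule Lim_null_comparison[rotated]) (simp add: energy_diff_continuity)
  from tendsto_add[OF this bounded_linear.tendsto[OF bounded_linear_energy_diff assms(2), of m]]
  show ?thesis by simp
qed

text \<open>Testing the variational inequality at each of two members of the sequence with the other one
  and adding up makes the \<open>C\<^sup>1\<close>-convergent subsequence a Cauchy sequence.\<close>

lemma almost_critical_subsequence:
  assumes adm: "\<And>n. X n \<in> admissible \<psi>" and C: "\<And>n. norm (X n) \<le> C"
    and \<delta>: "\<delta> \<longlonglongrightarrow> 0"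
    and vi: "\<And>n v. v \<in> admissible \<psi> \<Longrightarrow> energy_diff (X n) (v - X n) \<ge> - (\<delta> n * norm (v - X n))"
  obtains r m where "strict_mono r" "(\<lambda>n. X (r n)) \<longlonglongrightarrow> m" "m \<in> admissible \<psi>"
    "\<And>v. v \<in> admissible \<psi> \<Longrightarrow> energy_diff m (v - m) \<ge> 0"
proof -
  have C0: "0 \<le> C" using C[of 0] norm_ge_zero[of "X 0"] by linarith
  have "seq_compact (C1_holder_ball C)"
    using compact_C1_holder_ball[of C] by (simp only: compact_eq_seq_compact_metric)
  moreover have "\<forall>n. V_to_C1 (X n) \<in> C1_holder_ball C" using V_to_C1_holder[OF C] by blast
  ultimately obtain f r where r: "strict_mono (r :: nat \<Rightarrow> nat)"
    and "((\<lambda>n. V_to_C1 (X n)) \<circ> r) \<longlonglongrightarrow> f"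
    by (rule seq_compactE)
  then have f: "(\<lambda>n. V_to_C1 (X (r n))) \<longlonglongrightarrow> f" by (simp add: comp_def)
  have "Cauchy (\<lambda>n. X (r n))"
  proof (rule metric_CauchyI)
    fix e :: real assume e: "e > 0"
    \<comment> \<open>With slopes and defects both below \<open>\<eta>\<close>, the two tested
      inequalities give an upper bound \<open>\<eta> * (40 * C\<^sup>2 + 4 * C)\<close>: the first
      part is the error of monotonicity, the second the two defects, as members are at most 2 C
      apart. The additional 1 makes the comparison with \<open>2 * weight C * e\<^sup>2\<close>
      strict.\<close>
    define \<eta> where "\<eta> = 2 * weight C * e\<^sup>2 / (40 * C\<^sup>2 + 4 * C + 1)"
    have den: "0 < 40 * C\<^sup>2 + 4 * C + 1" using C0 zero_le_power2[of C] by linarith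
    have \<eta>: "\<eta> > 0" unfolding \<eta>_def using e weight_pos[of C] den by simp
    have "(\<lambda>n. \<delta> (r n)) \<longlonglongrightarrow> 0" using LIMSEQ_subseq_LIMSEQ[OF \<delta> r] by (simp add: comp_def)
    then obtain N1 where N1: "\<And>n. n \<ge> N1 \<Longrightarrow> \<bar>\<delta> (r n)\<bar> < \<eta>"
      using LIMSEQ_D[OF _ \<eta>] by fastforce
    obtain N2 where N2: "\<And>i j. i \<ge> N2 \<Longrightarrow> j \<ge> N2 \<Longrightarrow> dist (V_to_C1 (X (r i))) (V_to_C1 (X (r j))) < \<eta>"
      using metric_CauchyD[OF LIMSEQ_imp_Cauchy[OF f] \<eta>] by blast
    have "dist (X (r i)) (X (r j)) < e" if i: "i \<ge> max N1 N2" and j: "j \<ge> max N1 N2" for i j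
    proof -
      let ?u = "X (r i)" and ?v = "X (r j)"
      have sl: "\<bar>slope ?u x - slope ?v x\<bar> \<le> \<eta>" if "x \<in> {0..1}" for x
        using C1_le_norm(2)[OF that, of "V_to_C1 ?u - V_to_C1 ?v"] N2[of i j] i j
        by (simp add: C1_deriv_simps(3)[OF that] C1_deriv_V_to_C1[OF that] dist_norm)
      have n: "(norm ?u)\<^sup>2 \<le> C\<^sup>2" "(norm ?v)\<^sup>2 \<le> C\<^sup>2" "norm (?u - ?v) \<le> 2 * C"
        using C[of "r i"] C[of "r j"] norm_triangle_ineq4[of ?u ?v] by (auto intro: power_mono)
      have d: "\<delta> (r k) * norm (?u - ?v) \<le> \<eta> * (2 * C)" if "k \<ge> max N1 N2" for k
        using N1[of k] that n(3) \<eta> by (intro mult_mono) auto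
      have "energy_diff ?u (?v - ?u) \<ge> - (\<eta> * (2 * C))" "energy_diff ?v (?u - ?v) \<ge> - (\<eta> * (2 * C))"
        using vi[OF adm, of "r i" "r j"] vi[OF adm, of "r j" "r i"] d[OF i] d[OF j]
        unfolding norm_minus_commute[of ?v ?u] by linarith+
      moreover have "2 * weight C * (norm (?u - ?v))\<^sup>2 \<le> 2 * weight (norm ?u) * (norm (?u - ?v))\<^sup>2"
        using weight_antimono[of "norm ?u" C] C by (intro mult_right_mono) auto
      moreover have "20 * \<eta> * ((norm ?u)\<^sup>2 + (norm ?v)\<^sup>2) \<le> 20 * \<eta> * (C\<^sup>2 + C\<^sup>2)"
        using n \<eta> by (intro mult_left_mono add_mono) auto
      ultimately have "2 * weight C * (norm (?u - ?v))\<^sup>2 \<le> 20 * \<eta> * (C\<^sup>2 + C\<^sup>2) + 2 * (\<eta> * (2 * C))"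
        using energy_diff_almost_monotone[OF sl] by linarith
      also have "\<dots> < \<eta> * (40 * C\<^sup>2 + 4 * C + 1)"
        using \<eta> by (simp add: algebra_simps)
      also have "\<dots> = 2 * weight C * e\<^sup>2" using den by (simp add: \<eta>_def)
      finally have "(norm (?u - ?v))\<^sup>2 < e\<^sup>2" using weight_pos[of C] by simp
      then show ?thesis using e by (simp add: dist_norm power2_less_imp_less)
    qed
    then show "\<exists>M. \<forall>m\<ge>M. \<forall>n\<ge>M. dist (X (r m)) (X (r n)) < e" by blast
  qed
  then obtain m where m: "(\<lambda>n. X (r n)) \<longlonglongrightarrow> m" using Cauchy_convergent convergent_def by blast
  have "energy_diff m (v - m) \<ge> 0" if v: "v \<in> admissible \<psi>" for v
  proof (rule LIMSEQ_le)
    have "(\<lambda>n. \<delta> (r n)) \<longlonglongrightarrow> 0" using LIMSEQ_subseq_LIMSEQ[OF \<delta> r] by (simp add: comp_def)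
    then have "(\<lambda>n. - (\<delta> (r n) * norm (v - X (r n)))) \<longlonglongrightarrow> - (0 * norm (v - m))"
      by (intro tendsto_intros m)
    then show "(\<lambda>n. - (\<delta> (r n) * norm (v - X (r n)))) \<longlonglongrightarrow> 0" by simp
    show "(\<lambda>n. energy_diff (X (r n)) (v - X (r n))) \<longlonglongrightarrow> energy_diff m (v - m)"
      by (intro tendsto_energy_diff tendsto_intros m)
  qed (use vi[OF v] in auto)
  then show thesis using that[OF r m admissible_LIMSEQ[OF adm m]] by blast
qed


subsection \<open>Increments in time\<close>

text \<open>The primitive of a bump on (0,\<delta>), divided by its total increase. The difference
  of two translates is a test function whose derivative is a difference of two averaging kernels
  \<open>\<rho>\<close>.\<close>

lemma smooth_step_function:
  assumes "\<delta> > 0"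
  obtains R \<rho> :: "real \<Rightarrow> real" where "smooth R" "\<And>x. (R has_real_derivative \<rho> x) (at x)"
    "\<And>x. 0 \<le> \<rho> x" "\<And>x. x \<notin> {0..\<delta>} \<Longrightarrow> \<rho> x = 0" "continuous_on UNIV \<rho>"
    "\<And>x. x \<le> 0 \<Longrightarrow> R x = 0" "\<And>x. x \<ge> \<delta> \<Longrightarrow> R x = 1" "\<And>x. 0 \<le> R x" "\<And>x. R x \<le> 1"
proof -
  let ?b = "bump 1 0 \<delta>"
  have t: "?b \<in> test_functions UNIV" by (rule bump_test) (use assms in auto)
  then have sm: "smooth ?b" by (simp add: test_functions_def)
  obtain F where F: "smooth F" "\<And>x. (F has_real_derivative ?b x) (at x)" "F 0 = 0"
    using smooth_primitive[OF sm, of 0] by blast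
  have b0: "0 \<le> ?b x" for x by (simp add: bump_def hexp_def)
  have bz: "?b x = 0" if "x \<le> 0 \<or> x \<ge> \<delta>" for x using that by (auto simp: bump_def hexp_def)
  have Fc: "continuous_on A F" for A
    using F(2) by (meson DERIV_isCont continuous_at_imp_continuous_on)
  have mono: "F x \<le> F y" if "x \<le> y" for x y
    using F(2) b0 by (intro DERIV_nonneg_imp_nondecreasing[OF that]) blast
  have "F 0 < F \<delta>"
  proof (rule DERIV_pos_imp_increasing_open[OF assms])
    show "\<exists>y. (F has_real_derivative y) (at x) \<and> 0 < y" if "0 < x" "x < \<delta>" for x
      using that by (intro exI[of _ "?b x"] conjI F(2)) (simp add: bump_def hexp_def)
  qed (rule Fc)
  then have I: "F \<delta> > 0" using F(3) by simp
  have Fle: "F x = 0" if "x \<le> 0" for x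
  proof (cases "x = 0")
    case False
    with that have "x < 0" by simp
    have "F 0 = F x"
    proof (rule DERIV_isconst2[OF \<open>x < 0\<close> Fc])
      show "(F has_real_derivative 0) (at y)" if "y < 0" for y
        using F(2)[of y] bz[of y] that by simp
    qed (use \<open>x < 0\<close> in auto)
    then show ?thesis using F(3) by simp
  qed (simp add: F)
  have Fge: "F x = F \<delta>" if "x \<ge> \<delta>" for x
  proof (cases "x = \<delta>")
    case False
    with that have "\<delta> < x" by simp
    show ?thesis
    proof (rule DERIV_isconst2[OF \<open>\<delta> < x\<close> Fc])
      show "(F has_real_derivative 0) (at y)" if "\<delta> < y" for y
        using F(2)[of y] bz[of y] that by simp
    qed (use \<open>\<delta> < x\<close> in auto)
  qed simp
  have "smooth (\<lambda>x. (1 / F \<delta>) * F x + 0 * F x)" by (rule smooth_lincomb[OF F(1) F(1)])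
  then have sR: "smooth (\<lambda>x. F x / F \<delta>)" by simp
  show thesis
  proof (rule that[OF sR DERIV_cdivide[OF F(2)]])
    show "0 \<le> ?b x / F \<delta>" "x \<notin> {0..\<delta>} \<Longrightarrow> ?b x / F \<delta> = 0" for x
      using I b0[of x] bz[of x] by auto
    show "0 \<le> F x / F \<delta>" for x
      using mono[of 0 x] F(3) Fle[of x] I by (cases "x \<ge> 0") auto
    show "F x / F \<delta> \<le> 1" for x
      using mono[of x \<delta>] Fge[of x] I by (cases "x \<ge> \<delta>") (simp, simp)
    show "continuous_on UNIV (\<lambda>x. ?b x / F \<delta>)"
      unfolding divide_inverse by (intro continuous_on_mult_right test_continuous[OF t])
    show "F x / F \<delta> = 0" if "x \<le> 0" for x
      using Fle[OF that] by simp
    show "F x / F \<delta> = 1" if "x \<ge> \<delta>" for x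
      unfolding Fge[OF that] using I by simp
  qed
qed

lemma LINT_time_eq:
  fixes f :: "real \<Rightarrow> 'v::{banach, second_countable_topology}"
  shows "(LINT t|time_leb. f t) = (LINT t|lebesgue. indicator {0<..} t *\<^sub>R f t)"
    and "integrable time_leb f \<longleftrightarrow> integrable lebesgue (\<lambda>t. indicator {0<..} t *\<^sub>R f t)"
  by (rule integral_restrict_space, simp, rule integrable_restrict_space, simp)

text \<open>Replaces the half line by the compact interval carrying the kernel, on which continuity
  suffices for integrability.\<close>

lemma time_indicator_mollifier:
  fixes v :: "'v::real_vector" and a y \<delta> :: real
  assumes "0 < a" "\<And>x. x \<notin> {0..\<delta>} \<Longrightarrow> \<rho> x = 0"
  shows "indicator {0<..} y *\<^sub>R (\<rho> (y - a) *\<^sub>R v) = indicator {a..a + \<delta>} y *\<^sub>R (\<rho> (y - a) *\<^sub>R v)"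
proof (cases "y \<in> {a..a + \<delta>}")
  case True
  then have "0 < y" using assms(1) by auto
  with True show ?thesis by simp
next
  case False
  then have "\<rho> (y - a) = 0" by (intro assms(2)) auto
  then show ?thesis by simp
qed

lemma integrable_mollifier:
  fixes f :: "real \<Rightarrow> 'v::{banach, second_countable_topology}"
  assumes a: "0 < a" and f: "continuous_on {a..a + \<delta>} f"
    and \<rho>z: "\<And>x. x \<notin> {0..\<delta>} \<Longrightarrow> \<rho> x = 0" and \<rho>c: "continuous_on UNIV \<rho>"
  shows "integrable time_leb (\<lambda>y. \<rho> (y - a) *\<^sub>R f y)"
proof -
  have "continuous_on {a..a + \<delta>} (\<lambda>y. \<rho> (y - a))"
    by (rule continuous_on_compose2[OF \<rho>c]) (auto intro!: continuous_intros)
  then have "integrable lborel (\<lambda>y. indicator {a..a + \<delta>} y *\<^sub>R (\<rho> (y - a) *\<^sub>R f y))"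
    by (intro borel_integrable_compact continuous_on_scaleR f) simp
  then have "integrable lebesgue (\<lambda>y. indicator {a..a + \<delta>} y *\<^sub>R (\<rho> (y - a) *\<^sub>R f y))"
    using integrable_completion borel_measurable_integrable by blast
  moreover have "indicator {0<..} y *\<^sub>R (\<rho> (y - a) *\<^sub>R f y) = indicator {a..a + \<delta>} y *\<^sub>R (\<rho> (y - a) *\<^sub>R f y)" for y
    by (rule time_indicator_mollifier[OF a]) (rule \<rho>z)
  ultimately show ?thesis unfolding LINT_time_eq by (simp only:)
qed

text \<open>The kernel is nonnegative and has mass one because \<open>R\<close> climbs from 0 to 1,
  so the integral is an average of values of \<open>w\<close> that are all close to
  \<open>w a\<close>.\<close>

lemma integral_mollifier:
  fixes w :: "real \<Rightarrow> 'v::{banach, second_countable_topology}"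
  assumes a: "0 < a" "0 < \<delta>" and w: "continuous_on {0..} w"
    and close: "\<And>y. y \<in> {a..a + \<delta>} \<Longrightarrow> norm (w y - w a) \<le> e"
    and R: "\<And>x. (R has_real_derivative \<rho> x) (at x)" and \<rho>0: "\<And>x. 0 \<le> \<rho> x"
    and \<rho>z: "\<And>x. x \<notin> {0..\<delta>} \<Longrightarrow> \<rho> x = 0" and \<rho>c: "continuous_on UNIV \<rho>"
    and R01: "R 0 = 0" "R \<delta> = 1"
  shows "integrable time_leb (\<lambda>y. \<rho> (y - a) *\<^sub>R w y)"
    "norm ((LINT y|time_leb. \<rho> (y - a) *\<^sub>R w y) - w a) \<le> e"
proof -
  have wc: "continuous_on {a..a + \<delta>} w" by (rule continuous_on_subset[OF w]) (use a in auto)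
  have \<rho>c': "continuous_on S (\<lambda>y. \<rho> (y - a))" for S
    by (intro continuous_on_compose2[OF \<rho>c]) (auto intro!: continuous_intros)
  show i: "integrable time_leb (\<lambda>y. \<rho> (y - a) *\<^sub>R w y)"
    by (rule integrable_mollifier[OF a(1) wc \<rho>z \<rho>c])
  have i1: "integrable time_leb (\<lambda>y. \<rho> (y - a) *\<^sub>R w a)"
    by (rule integrable_mollifier[OF a(1) continuous_on_const \<rho>z \<rho>c])
  have one: "(LINT y|time_leb. \<rho> (y - a)) = 1"
  proof -
    have "has_bochner_integral lborel (\<lambda>y. \<rho> (y - a) * indicator {a..a + \<delta>} y) (R (a + \<delta> - a) - R (a - a))"
    proof (rule has_bochner_integral_FTC_Icc_real)
      show "((\<lambda>y. R (y - a)) has_real_derivative \<rho> (x - a)) (at x)" for x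
        using R[of "x + - a"] unfolding DERIV_shift by simp
      show "isCont (\<lambda>y. \<rho> (y - a)) x" for x
        using \<rho>c'[of UNIV] by (simp add: continuous_on_eq_continuous_at)
    qed (use a in auto)
    then have hb: "has_bochner_integral lborel (\<lambda>y. indicator {a..a + \<delta>} y *\<^sub>R (\<rho> (y - a) *\<^sub>R (1::real))) 1"
      using R01 by (simp add: mult.commute)
    have "(LINT y|time_leb. \<rho> (y - a) *\<^sub>R (1::real)) = (LINT y|lebesgue. indicator {a..a + \<delta>} y *\<^sub>R (\<rho> (y - a) *\<^sub>R (1::real)))"
      unfolding LINT_time_eq
      by (rule Bochner_Integration.integral_cong[OF refl time_indicator_mollifier[OF a(1)]]) (rule \<rho>z)
    also have "\<dots> = (LINT y|lborel. indicator {a..a + \<delta>} y *\<^sub>R (\<rho> (y - a) *\<^sub>R (1::real)))"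
      by (rule integral_completion) (use hb in \<open>auto simp: has_bochner_integral_iff intro: borel_measurable_integrable\<close>)
    also have "\<dots> = 1" by (rule has_bochner_integral_integral_eq[OF hb])
    finally show ?thesis by simp
  qed
  have i1r: "integrable time_leb (\<lambda>y. \<rho> (y - a))" 
    using integrable_mollifier[OF a(1) continuous_on_const[of _ "1::real"] \<rho>z \<rho>c] by simp
  have "(LINT y|time_leb. \<rho> (y - a) *\<^sub>R w a) = w a"
    using integral_scaleR_left[of "w a" time_leb "\<lambda>y. \<rho> (y - a)"] i1r one by simp
  then have "(LINT y|time_leb. \<rho> (y - a) *\<^sub>R w y) - w a = (LINT y|time_leb. \<rho> (y - a) *\<^sub>R (w y - w a))"
    using Bochner_Integration.integral_diff[OF i i1] by (simp add: scaleR_diff_right)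
  also have "norm \<dots> \<le> (LINT y|time_leb. norm (\<rho> (y - a) *\<^sub>R (w y - w a)))"
    by (rule integral_norm_bound)
  also have "\<dots> \<le> (LINT y|time_leb. \<rho> (y - a) * e)"
  proof (rule integral_mono)
    show "integrable time_leb (\<lambda>y. norm (\<rho> (y - a) *\<^sub>R (w y - w a)))"
      using Bochner_Integration.integrable_diff[OF i i1]
      by (intro integrable_norm) (simp add: scaleR_diff_right)
    show "integrable time_leb (\<lambda>y. \<rho> (y - a) * e)" using i1r by simp
    show "norm (\<rho> (y - a) *\<^sub>R (w y - w a)) \<le> \<rho> (y - a) * e" for y
      using close[of y] \<rho>0[of "y - a"] \<rho>z[of "y - a"]
      by (cases "y \<in> {a..a + \<delta>}") (auto intro: mult_left_mono)
  qed
  also have "\<dots> = e" using one by simp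
  finally show "norm ((LINT y|time_leb. \<rho> (y - a) *\<^sub>R w y) - w a) \<le> e" .
qed

text \<open>The weak derivative is tested with a smoothed indicator of the interval from s to t. The
  descending layer lies to the right of t, whence the integral up to t + 1; this enlarged interval
  is sufficient for tail estimates.\<close>

lemma weak_time_deriv_increment_le:
  fixes g :: "real \<Rightarrow> 'v::{banach, second_countable_topology}"
  assumes weak: "has_weak_time_deriv g gd" and gm: "g \<in> borel_measurable time_leb"
    and w: "continuous_on {0..} w" and wg: "AE t in time_leb. w t = g t" and st: "0 < s" "s < t"
  shows "norm (w t - w s) \<le> (LINT \<tau>:{s..t + 1}|lebesgue. norm (gd \<tau>))"
proof (rule field_le_epsilon)
  fix e :: real assume e: "e > 0"
  let ?I = "LINT \<tau>:{s..t + 1}|lebesgue. norm (gd \<tau>)"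
  have ex: "\<exists>d>0. \<forall>y\<in>{a..a + d}. norm (w y - w a) \<le> e / 2" if a: "a > 0" for a
  proof -
    have "a \<in> {0..}" "e / 2 > 0" using a e by auto
    with w have "\<exists>d>0. \<forall>y\<in>{0..}. dist y a < d \<longrightarrow> dist (w y) (w a) < e / 2"
      unfolding continuous_on_iff by blast
    then    obtain d where d: "d > 0" "\<And>y. y \<ge> 0 \<Longrightarrow> dist y a < d \<Longrightarrow> dist (w y) (w a) < e / 2"
      by auto
    have "norm (w y - w a) \<le> e / 2" if "y \<in> {a..a + d / 2}" for y
      using d(2)[of y] that a d(1) by (auto simp: dist_norm)
    then show ?thesis using d(1) by (intro exI[of _ "d / 2"]) auto
  qed
  obtain d1 where d1: "d1 > 0" "\<And>y. y \<in> {s..s + d1} \<Longrightarrow> norm (w y - w s) \<le> e / 2" using ex[of s] st by blast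
  obtain d2 where d2: "d2 > 0" "\<And>y. y \<in> {t..t + d2} \<Longrightarrow> norm (w y - w t) \<le> e / 2" using ex[of t] st by auto
  \<comment> \<open>The bound 1 keeps the descending layer inside [t, t + 1].\<close>
  define \<delta> where "\<delta> = min 1 (min d1 d2)"
  have \<delta>: "\<delta> > 0" "\<delta> \<le> 1" "\<delta> \<le> d1" "\<delta> \<le> d2" using d1 d2 by (auto simp: \<delta>_def)
  obtain R \<rho> where R: "smooth R" "\<And>x. (R has_real_derivative \<rho> x) (at x)"
    "\<And>x. 0 \<le> \<rho> x" "\<And>x. x \<notin> {0..\<delta>} \<Longrightarrow> \<rho> x = 0" "continuous_on UNIV \<rho>"
    "\<And>x. x \<le> 0 \<Longrightarrow> R x = 0" "\<And>x. x \<ge> \<delta> \<Longrightarrow> R x = 1" "\<And>x. 0 \<le> R x" "\<And>x. R x \<le> 1"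
    using smooth_step_function[OF \<delta>(1)] by metis
  have m: "integrable time_leb (\<lambda>y. \<rho> (y - a) *\<^sub>R w y)"
    "norm ((LINT y|time_leb. \<rho> (y - a) *\<^sub>R w y) - w a) \<le> e / 2"
    if a: "0 < a" "\<And>y. y \<in> {a..a + \<delta>} \<Longrightarrow> norm (w y - w a) \<le> e / 2" for a
    using integral_mollifier[OF a(1) \<delta>(1) w a(2) R(2-5) R(6)[OF order_refl] R(7)[OF order_refl]] by auto
  have "norm (w y - w s) \<le> e / 2" if "y \<in> {s..s + \<delta>}" for y
    using that \<delta>(3) by (intro d1(2)) auto
  note ms = m[OF st(1) this]
  have "norm (w y - w t) \<le> e / 2" if "y \<in> {t..t + \<delta>}" for y
    using that \<delta>(4) by (intro d2(2)) auto
  note mt = m[OF less_trans[OF st] this]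
  \<comment> \<open>Its derivative pairs with \<open>w\<close> to give an average near s minus an
    average near t.\<close>
  define \<phi> where "\<phi> y = R (y - s) - R (y - t)" for y
  have der: "(\<phi> has_real_derivative \<rho> (y - s) - \<rho> (y - t)) (at y)" for y
  proof -
    have "((\<lambda>y. R (y - a)) has_real_derivative \<rho> (y - a)) (at y)" for a
      using R(2)[of "y + - a"] unfolding DERIV_shift by simp
    then show ?thesis unfolding \<phi>_def by (intro DERIV_diff)
  qed
  have \<phi>0: "\<phi> y = 0" if "y \<notin> {s..t + 1}" for y
    using that R(6)[of "y - s"] R(6)[of "y - t"] R(7)[of "y - s"] R(7)[of "y - t"] st \<delta> by (auto simp: \<phi>_def)
  have \<phi>1: "\<bar>\<phi> y\<bar> \<le> 1" for y
    using R(8,9)[of "y - s"] R(8,9)[of "y - t"] unfolding \<phi>_def by linarith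
  have "smooth (\<lambda>y. 1 * R (1 * y + (- s)) + (- 1) * R (1 * y + (- t)))"
    by (intro smooth_lincomb smooth_affine R(1))
  then have "smooth \<phi>" by (simp add: \<phi>_def[abs_def])
  moreover have sub: "closure {y. \<phi> y \<noteq> 0} \<subseteq> {s..t + 1}"
    by (rule closure_minimal[OF subsetI closed_atLeastAtMost]) (use \<phi>0 in blast)
  moreover have "compact (closure {y. \<phi> y \<noteq> 0})"
    by (rule compact_closed_subset_aux[OF _ closed_closure sub]) simp
  ultimately have \<phi>: "\<phi> \<in> test_functions {0<..}"
    using st unfolding test_functions_def by fastforce
  have "(LINT y|time_leb. deriv \<phi> y *\<^sub>R g y) = (LINT y|time_leb. \<rho> (y - s) *\<^sub>R w y - \<rho> (y - t) *\<^sub>R w y)"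
  proof (rule integral_cong_AE)
    have "deriv \<phi> \<in> borel_measurable borel"
      using test_continuous[OF test_deriv[OF \<phi>], of UNIV] by (rule borel_measurable_continuous_onI)
    then have "deriv \<phi> \<in> borel_measurable time_leb"
      by (intro measurable_restrict_space1 measurable_completion) simp
    then show "(\<lambda>y. deriv \<phi> y *\<^sub>R g y) \<in> borel_measurable time_leb"
      using gm by (rule borel_measurable_scaleR)
    show "(\<lambda>y. \<rho> (y - s) *\<^sub>R w y - \<rho> (y - t) *\<^sub>R w y) \<in> borel_measurable time_leb"
      by (intro borel_measurable_integrable Bochner_Integration.integrable_diff ms mt)
    show "AE y in time_leb. deriv \<phi> y *\<^sub>R g y = \<rho> (y - s) *\<^sub>R w y - \<rho> (y - t) *\<^sub>R w y"
      using wg by eventually_elim (simp add: DERIV_imp_deriv[OF der] scaleR_diff_left)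
  qed
  then have eq: "(LINT y|time_leb. \<rho> (y - s) *\<^sub>R w y) - (LINT y|time_leb. \<rho> (y - t) *\<^sub>R w y)
      = - (LINT y|time_leb. \<phi> y *\<^sub>R gd y)"
    using weak \<phi> Bochner_Integration.integral_diff[OF ms(1) mt(1)] by (simp add: has_weak_time_deriv_def)
  have si: "set_integrable lebesgue {s..t + 1} gd"
  proof -
    have "compact {s..t + 1} \<and> {s..t + 1} \<subseteq> {0<..}" using st by auto
    then show ?thesis using weak unfolding has_weak_time_deriv_def L1_loc_time_def by blast
  qed
  have "norm (LINT y|time_leb. \<phi> y *\<^sub>R gd y) \<le> (LINT y|lebesgue. norm (indicator {0<..} y *\<^sub>R \<phi> y *\<^sub>R gd y))"
    unfolding LINT_time_eq by (rule integral_norm_bound)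
  also have "\<dots> \<le> ?I"
    unfolding set_lebesgue_integral_def
  proof (rule integral_mono_AE')
    show "integrable lebesgue (\<lambda>y. indicator {s..t + 1} y *\<^sub>R norm (gd y))"
      using integrable_norm[OF si[unfolded set_integrable_def]] by simp
    show "AE y in lebesgue. norm (indicator {0<..} y *\<^sub>R \<phi> y *\<^sub>R gd y) \<le> indicator {s..t + 1} y *\<^sub>R norm (gd y)"
      using \<phi>0 \<phi>1 by (intro AE_I2) (auto simp: indicator_def intro: mult_left_le_one_le)
  qed auto
  finally have le: "norm (LINT y|time_leb. \<phi> y *\<^sub>R gd y) \<le> ?I" .
  let ?A = "LINT y|time_leb. \<rho> (y - s) *\<^sub>R w y" and ?B = "LINT y|time_leb. \<rho> (y - t) *\<^sub>R w y"
  have "w t - w s = (?A - w s) - (?B - w t) + (LINT y|time_leb. \<phi> y *\<^sub>R gd y)"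
    using eq by (simp add: algebra_simps)
  also have "norm \<dots> \<le> norm (?A - w s) + norm (?B - w t) + norm (LINT y|time_leb. \<phi> y *\<^sub>R gd y)"
    by (intro norm_triangle_le add_right_mono norm_triangle_ineq4)
  also have "\<dots> \<le> e / 2 + e / 2 + ?I" by (intro add_mono ms mt le)
  finally show "norm (w t - w s) \<le> ?I + e" by simp
qed


subsection \<open>The exceptional set of times and the theorem\<close>

lemma AE_time_ex:
  assumes "AE t in time_leb. P t" "0 \<le> a" "a < b"
  shows "\<exists>t\<in>{a<..<b}. P t"
proof (rule ccontr)
  assume n: "\<not> ?thesis"
  have "AE t in lebesgue. t \<in> {0<..} \<longrightarrow> P t"
    using assms(1) by (subst (asm) AE_restrict_space_iff) auto
  then have "AE t in lebesgue. t \<notin> {a<..<b}"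
    by eventually_elim (use n assms(2) in auto)
  then have "negligible {a<..<b}"
    by (simp add: AE_iff_null_sets negligible_iff_null_sets)
  then show False using open_not_negligible[of "{a<..<b}"] assms(3) by auto
qed

text \<open>By Chebyshev's inequality the superlevel set has finite measure, so its parts beyond
  time N decrease to the empty set in measure.\<close>

lemma lebesgue_superlevel_tail:
  fixes f :: "real \<Rightarrow> real"
  assumes fm: "f \<in> borel_measurable time_leb" and fi: "integrable time_leb (\<lambda>t. (f t)\<^sup>2)"
    and c: "c > 0" and \<epsilon>: "\<epsilon> > 0"
  shows "{t \<in> {0<..}. c < f t} \<in> sets lebesgue"
    "\<exists>N::nat. emeasure lebesgue ({t \<in> {0<..}. c < f t} \<inter> {real N..}) < ennreal \<epsilon>"
proof -
  let ?E = "{t \<in> {0<..}. c < f t}"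
  have "{t \<in> space time_leb. c < f t} \<in> sets time_leb"
    using fm by measurable
  then have Et: "?E \<in> sets time_leb" by (simp add: space_restrict_space)
  then show Es: "?E \<in> sets lebesgue" by (simp add: sets_restrict_space_iff)
  have "integrable time_leb (indicator ?E :: real \<Rightarrow> real)"
  proof (rule Bochner_Integration.integrable_bound)
    show "integrable time_leb (\<lambda>t. (1 / c\<^sup>2) * (f t)\<^sup>2)" using fi by (rule integrable_mult_right)
    show "AE t in time_leb. norm (indicator ?E t :: real) \<le> norm ((1 / c\<^sup>2) * (f t)\<^sup>2)"
      using c power_strict_mono[of c "f _" 2]
      by (intro AE_I2) (auto simp: indicator_def field_simps less_imp_le)
  qed (use Et in measurable)
  moreover have "?E \<inter> space time_leb = ?E" by (auto simp: space_restrict_space)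
  ultimately have "emeasure time_leb ?E < \<infinity>"
    unfolding integrable_indicator_iff by simp
  then have fin: "emeasure lebesgue ?E < \<infinity>"
    by (subst (asm) emeasure_restrict_space) auto
  have "(\<lambda>N. emeasure lebesgue (?E \<inter> {real N..})) \<longlonglongrightarrow> emeasure lebesgue (\<Inter>N. ?E \<inter> {real N..})"
  proof (rule Lim_emeasure_decseq)
    show "range (\<lambda>N. ?E \<inter> {real N..}) \<subseteq> sets lebesgue" using Es by auto
    show "decseq (\<lambda>N. ?E \<inter> {real N..})" by (auto simp: decseq_def)
    show "emeasure lebesgue (?E \<inter> {real N..}) \<noteq> \<infinity>" for N
      using fin emeasure_mono[of "?E \<inter> {real N..}" ?E lebesgue] Es by (auto simp: less_top[symmetric] top_unique)
  qed
  moreover have "(\<Inter>N. ?E \<inter> {real N..}) = {}"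
  proof (rule equals0I)
    fix x assume x: "x \<in> (\<Inter>N. ?E \<inter> {real N..})"
    obtain N :: nat where "x < real N" using reals_Archimedean2 by blast
    moreover have "x \<in> ?E \<inter> {real N..}" by (rule INT_D[OF x UNIV_I])
    ultimately show False by simp
  qed
  ultimately have "(\<lambda>N. emeasure lebesgue (?E \<inter> {real N..})) \<longlonglongrightarrow> 0" by simp
  then have "\<forall>\<^sub>F N in sequentially. emeasure lebesgue (?E \<inter> {real N..}) < ennreal \<epsilon>"
    by (rule order_tendstoD) (use \<epsilon> in simp)
  then show "\<exists>N::nat. emeasure lebesgue (?E \<inter> {real N..}) < ennreal \<epsilon>"
    by (auto simp: eventually_sequentially)
qed

text \<open>Square integrability does not force f to tend to 0. For each level 1 / (k + 1), the part
  of the superlevel set beyond a late time \<open>N k\<close> is discarded; off the union of these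
  parts, f falls below every level eventually.\<close>

lemma small_exceptional_set:
  fixes f :: "real \<Rightarrow> real"
  assumes fm: "f \<in> borel_measurable time_leb" and fi: "integrable time_leb (\<lambda>t. (f t)\<^sup>2)"
    and f0: "\<And>t. 0 \<le> f t" and P: "AE t in time_leb. P t" and \<epsilon>: "\<epsilon> > 0"
  obtains B where "B \<subseteq> {0..}" "B \<in> sets lebesgue" "emeasure lebesgue B < ennreal \<epsilon>"
    "\<And>t. t \<in> {0..} - B \<Longrightarrow> 0 < t \<and> P t"
    "\<And>\<theta> :: nat \<Rightarrow> real. (\<And>n. \<theta> n \<in> {0..} - B) \<Longrightarrow> filterlim \<theta> at_top sequentially \<Longrightarrow>
      (\<lambda>n. f (\<theta> n)) \<longlonglongrightarrow> 0"
proof -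
  define E where "E k = {t \<in> {0<..}. 1 / real (Suc k) < f t}" for k :: nat
  have "\<exists>N::nat. emeasure lebesgue (E k \<inter> {real N..}) < ennreal (\<epsilon> / 2 * (1 / 2) ^ Suc k)" for k
    unfolding E_def by (rule lebesgue_superlevel_tail(2)[OF fm fi]) (use \<epsilon> in auto)
  \<comment> \<open>The allowances \<epsilon> / 2 * 2^-(k+1) add up to \<epsilon> / 2, which leaves
    room for the strict inequality.\<close>
  then obtain N :: "nat \<Rightarrow> nat" where N: "\<And>k. emeasure lebesgue (E k \<inter> {real (N k)..}) < ennreal (\<epsilon> / 2 * (1 / 2) ^ Suc k)"
    by metis
  have Es: "E k \<in> sets lebesgue" for k
    unfolding E_def by (rule lebesgue_superlevel_tail(1)[OF fm fi, where \<epsilon> = 1]) auto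
  have "AE t in lebesgue. t \<in> {0<..} \<longrightarrow> P t"
    using P by (subst (asm) AE_restrict_space_iff) auto
  then obtain Z where Z: "Z \<in> null_sets lebesgue" "{t. \<not> (t \<in> {0<..} \<longrightarrow> P t)} \<subseteq> Z"
    by (auto simp: eventually_ae_filter)
  \<comment> \<open>The point 0 is discarded too, since statements for almost every time concern t >
    0 only.\<close>
  define B where "B = ({0} \<union> Z \<union> (\<Union>k. E k \<inter> {real (N k)..})) \<inter> {0..}"
  have null: "{0} \<union> Z \<in> null_sets lebesgue"
    using Z(1) by (intro null_sets.Un) auto
  have Us: "(\<Union>k. E k \<inter> {real (N k)..}) \<in> sets lebesgue"
    using Es by (intro sets.countable_UN) auto
  have "emeasure lebesgue B \<le> emeasure lebesgue (({0} \<union> Z) \<union> (\<Union>k. E k \<inter> {real (N k)..}))"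
    unfolding B_def by (rule emeasure_mono[OF Int_lower1 sets.Un[OF null_setsD2[OF null] Us]])
  also have "\<dots> = emeasure lebesgue (\<Union>k. E k \<inter> {real (N k)..})"
    using emeasure_Un_null_set[OF Us null] by (simp only: Un_commute)
  also have "\<dots> \<le> (\<Sum>k. emeasure lebesgue (E k \<inter> {real (N k)..}))"
    using Es by (intro emeasure_subadditive_countably) auto
  also have "\<dots> \<le> (\<Sum>k. ennreal (\<epsilon> / 2 * (1 / 2) ^ Suc k))"
    using N by (intro suminf_le) (auto intro: less_imp_le)
  also have "\<dots> = ennreal (\<epsilon> / 2 * 1)"
    by (intro suminf_ennreal_eq sums_mult power_half_series) (use \<epsilon> in auto)
  also have "\<dots> < ennreal \<epsilon>" using \<epsilon> by (intro ennreal_lessI) auto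
  finally have small: "emeasure lebesgue B < ennreal \<epsilon>" .
  show thesis
  proof (rule that[of B, OF _ _ small])
    show "B \<subseteq> {0..}" by (auto simp: B_def)
    show "B \<in> sets lebesgue" 
      unfolding B_def by (intro sets.Int sets.Un[OF null_setsD2[OF null] Us]) simp
    show "0 < t \<and> P t" if "t \<in> {0..} - B" for t
    proof -
      have "t \<notin> {0} \<union> Z" "t \<in> {0..}" using that unfolding B_def by blast+
      then have "0 < t" "t \<notin> Z" by auto
      then show ?thesis using Z(2) by blast
    qed
    fix \<theta> :: "nat \<Rightarrow> real" assume \<theta>: "\<And>n. \<theta> n \<in> {0..} - B" "filterlim \<theta> at_top sequentially"
    show "(\<lambda>n. f (\<theta> n)) \<longlonglongrightarrow> 0"
    proof (rule LIMSEQ_I)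
      fix e :: real assume "e > 0"
      then obtain k where k: "inverse (real (Suc k)) < e" using reals_Archimedean by blast
      obtain n0 where n0: "\<And>n. n \<ge> n0 \<Longrightarrow> real (N k) \<le> \<theta> n"
        using \<theta>(2) unfolding filterlim_at_top eventually_sequentially by blast
      have "norm (f (\<theta> n) - 0) < e" if "n \<ge> n0" for n
      proof -
        have "\<theta> n \<in> {0..}" "\<theta> n \<notin> {0} \<union> Z" "\<theta> n \<notin> E k \<inter> {real (N k)..}"
          using \<theta>(1)[of n] unfolding B_def by blast+
        then have "\<theta> n \<notin> E k" "0 < \<theta> n" using n0[OF that] by auto
        then have "f (\<theta> n) \<le> inverse (real (Suc k))" by (auto simp: E_def inverse_eq_divide)
        then show ?thesis using k f0[of "\<theta> n"] by simp
      qed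
      then show "\<exists>no. \<forall>n\<ge>no. norm (f (\<theta> n) - 0) < e" by blast
    qed
  qed
qed

lemma not_bounded_time_minus_small:
  assumes "B \<in> sets lebesgue" "emeasure lebesgue B < \<infinity>"
  shows "\<not> bounded ({0..} - B :: real set)"
proof
  assume "bounded ({0..} - B)"
  then obtain a where a: "\<And>x. x \<in> {0..} - B \<Longrightarrow> \<bar>x\<bar> \<le> a" unfolding bounded_real by blast
  have sub: "{\<bar>a\<bar><..} \<subseteq> B"
  proof
    fix x assume "x \<in> {\<bar>a\<bar><..}"
    then have "0 \<le> x" "a < \<bar>x\<bar>" by auto
    then show "x \<in> B" using a[of x] by auto
  qed
  obtain n :: nat where n: "emeasure lebesgue B < ennreal (real n)"
    using assms(2) ennreal_Ex_less_of_nat[of "emeasure lebesgue B"] by (auto simp: ennreal_of_nat_eq_real_of_nat)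
  have "ennreal (real n) = emeasure lebesgue {\<bar>a\<bar><..<\<bar>a\<bar> + real n}" by simp
  also have "\<dots> \<le> emeasure lebesgue B"
    using sub assms(1) by (intro emeasure_mono) auto
  finally show False using n by simp
qed

text \<open>The pointwise inequality |x| <= \<eta> + |x|^2 / \<eta> bounds an increment by 2 \<eta>
  plus the tail of the squared norm of the derivative divided by \<eta>. The length 2 is the time
  gap of at most 1 plus the additional unit in \<open>weak_time_deriv_increment_le\<close>.\<close>

lemma tendsto_time_increment:
  fixes gd :: "real \<Rightarrow> 'v::{banach, second_countable_topology}"
  assumes weak: "has_weak_time_deriv g gd" and gm: "g \<in> borel_measurable time_leb"
    and gd: "gd \<in> L2_time"
    and w: "continuous_on {0..} w" and wg: "AE t in time_leb. w t = g t"
    and \<theta>: "filterlim \<theta> at_top sequentially" and t: "\<And>n. \<theta> n < t n" "\<And>n. t n \<le> \<theta> n + 1"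
  shows "(\<lambda>n. w (t n) - w (\<theta> n)) \<longlonglongrightarrow> 0"
proof (rule LIMSEQ_I)
  fix e :: real assume e: "e > 0"
  have gi: "integrable time_leb (\<lambda>\<tau>. (norm (gd \<tau>))\<^sup>2)" using gd by (simp add: L2_time_def)
  have gim: "(\<lambda>\<tau>. (norm (gd \<tau>))\<^sup>2) \<in> borel_measurable time_leb" using gi by (rule borel_measurable_integrable)
  have im: "indicator {a..} \<in> borel_measurable time_leb" for a :: real
    by (intro measurable_restrict_space1 measurable_completion) simp
  have "(\<lambda>n. LINT \<tau>|time_leb. indicator {\<theta> n..} \<tau> * (norm (gd \<tau>))\<^sup>2) \<longlonglongrightarrow> (LINT \<tau>|time_leb. 0)"
  proof (rule integral_dominated_convergence[OF _ _ gi])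
    show "(\<lambda>\<tau>. indicator {\<theta> n..} \<tau> * (norm (gd \<tau>))\<^sup>2) \<in> borel_measurable time_leb" for n
      by (rule borel_measurable_times[OF im gim])
    show "AE \<tau> in time_leb. (\<lambda>n. indicator {\<theta> n..} \<tau> * (norm (gd \<tau>))\<^sup>2) \<longlonglongrightarrow> 0"
    proof (intro AE_I2 tendsto_eventually)
      fix \<tau> :: real
      have "\<forall>\<^sub>F n in sequentially. \<tau> < \<theta> n" using \<theta> by (simp add: filterlim_at_top_dense)
      then show "\<forall>\<^sub>F n in sequentially. indicator {\<theta> n..} \<tau> * (norm (gd \<tau>))\<^sup>2 = 0"
        by eventually_elim simp
    qed
  qed (auto simp: indicator_def)
  then have tail: "(\<lambda>n. LINT \<tau>|time_leb. indicator {\<theta> n..} \<tau> * (norm (gd \<tau>))\<^sup>2) \<longlonglongrightarrow> 0" by simp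
  \<comment> \<open>Then 2 \<eta> is e / 2, and a tail below \<eta> e / 2 contributes less than the
    other half.\<close>
  define \<eta> where "\<eta> = e / 4"
  have \<eta>: "\<eta> > 0" using e by (simp add: \<eta>_def)
  have "\<forall>\<^sub>F n in sequentially. (LINT \<tau>|time_leb. indicator {\<theta> n..} \<tau> * (norm (gd \<tau>))\<^sup>2) < \<eta> * e / 2"
    using tail by (rule order_tendstoD) (use \<eta> e in simp)
  moreover have "\<forall>\<^sub>F n in sequentially. 0 < \<theta> n" using \<theta> by (simp add: filterlim_at_top_dense)
  ultimately have "\<forall>\<^sub>F n in sequentially. norm (w (t n) - w (\<theta> n) - 0) < e"
  proof eventually_elim
    case (elim n)
    have i1: "integrable lebesgue (\<lambda>\<tau>. indicator {\<theta> n..\<theta> n + 2} \<tau> * \<eta>)"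
      by (intro integrable_mult_left integrable_real_indicator) auto
    have "integrable time_leb (\<lambda>\<tau>. indicator {\<theta> n..} \<tau> * (norm (gd \<tau>))\<^sup>2)"
    proof (rule Bochner_Integration.integrable_bound[OF gi])
      show "(\<lambda>\<tau>. indicator {\<theta> n..} \<tau> * (norm (gd \<tau>))\<^sup>2) \<in> borel_measurable time_leb"
        by (rule borel_measurable_times[OF im gim])
    qed (auto simp: indicator_def)
    then have i2: "integrable lebesgue (\<lambda>\<tau>. indicator {0<..} \<tau> *\<^sub>R (indicator {\<theta> n..} \<tau> * (norm (gd \<tau>))\<^sup>2))"
      unfolding LINT_time_eq .
    have "norm (w (t n) - w (\<theta> n)) \<le> (LINT \<tau>|lebesgue. indicator {\<theta> n..t n + 1} \<tau> *\<^sub>R norm (gd \<tau>))"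
      using weak_time_deriv_increment_le[OF weak gm w wg elim(2) t(1)] by (simp add: set_lebesgue_integral_def)
    also have "\<dots> \<le> (LINT \<tau>|lebesgue. indicator {\<theta> n..\<theta> n + 2} \<tau> * \<eta> +
        indicator {0<..} \<tau> *\<^sub>R (indicator {\<theta> n..} \<tau> * (norm (gd \<tau>))\<^sup>2) / \<eta>)"
    proof (rule integral_mono_AE')
      show "integrable lebesgue (\<lambda>\<tau>. indicator {\<theta> n..\<theta> n + 2} \<tau> * \<eta> +
        indicator {0<..} \<tau> *\<^sub>R (indicator {\<theta> n..} \<tau> * (norm (gd \<tau>))\<^sup>2) / \<eta>)"
        by (intro Bochner_Integration.integrable_add[OF i1] integrable_divide i2)
      have "norm x \<le> \<eta> + (norm x)\<^sup>2 / \<eta>" for x :: 'v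
      proof -
        have "norm x * \<eta> \<le> \<eta>\<^sup>2 + (norm x)\<^sup>2"
          using sum_squares_bound[of "norm x" \<eta>] mult_nonneg_nonneg[OF norm_ge_zero[of x] less_imp_le[OF \<eta>]]
          by linarith
        then show ?thesis using \<eta> by (simp add: field_simps power2_eq_square)
      qed
      then show "AE \<tau> in lebesgue. indicator {\<theta> n..t n + 1} \<tau> *\<^sub>R norm (gd \<tau>) \<le>
        indicator {\<theta> n..\<theta> n + 2} \<tau> * \<eta> + indicator {0<..} \<tau> *\<^sub>R (indicator {\<theta> n..} \<tau> * (norm (gd \<tau>))\<^sup>2) / \<eta>"
        using t(2)[of n] elim(2) \<eta> by (intro AE_I2) (auto simp: indicator_def)
    qed (use \<eta> in \<open>auto simp: indicator_def\<close>)
    also have "\<dots> = 2 * \<eta> + (LINT \<tau>|time_leb. indicator {\<theta> n..} \<tau> * (norm (gd \<tau>))\<^sup>2) / \<eta>"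
      by (simp only: Bochner_Integration.integral_add[OF i1 integrable_divide[OF i2]] integral_divide_zero
          LINT_time_eq(1) integral_mult_left_zero) simp
    also have "\<dots> < 2 * \<eta> + (\<eta> * e / 2) / \<eta>"
      using elim(1) \<eta> by (intro add_strict_left_mono divide_strict_right_mono)
    also have "\<dots> = e" using \<eta> by (simp add: \<eta>_def)
    finally show ?case by simp
  qed
  then show "\<exists>no. \<forall>n\<ge>no. norm (w (t n) - w (\<theta> n) - 0) < e"
    by (simp add: eventually_sequentially)
qed

section \<open>The flow at almost every time and its C^1 representative\<close>

lemma norm_V_to_L2_le: "norm (V_to_L2 u) \<le> norm u"
  using V_norms(1)[of u] by (simp add: norm_W22_W12_0_def)

lemma norm_V_to_W22_le: "norm (V_to_W22 u) \<le> 2 * norm u"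
proof (rule power2_le_imp_le)
  have "(norm (V_to_W22 u))\<^sup>2 \<le> (norm u)\<^sup>2 + (norm u)\<^sup>2 + (norm u)\<^sup>2"
    unfolding W22_norm_eq
    using V_norms[of u] by (intro add_mono power_mono) (simp_all add: norm_W22_W12_0_def)
  then show "(norm (V_to_W22 u))\<^sup>2 \<le> (2 * norm u)\<^sup>2"
    using zero_le_square[of "norm u"] unfolding power2_eq_square by linarith
qed simp

lemma bounded_linear_V_to_W22: "bounded_linear V_to_W22"
proof (rule bounded_linear_intro[where K = 2])
  show "norm (V_to_W22 u) \<le> norm u * 2" for u
    using norm_V_to_W22_le[of u] by linarith
qed (simp_all add: V_to_W22_simps)

lemma bounded_linear_V_to_L2: "bounded_linear (\<lambda>u. V_to_L2 u)"
proof (rule bounded_linear_intro[where K = 1])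
  show "norm (V_to_L2 u) \<le> norm u * 1" for u
    using norm_V_to_L2_le[of u] by simp
qed (simp_all add: V_to_W22_simps W22_to_L2_simps)

text \<open>Gathers all conditions on a time into one almost-everywhere statement. The
  Cauchy-Schwarz inequality turns the time derivative into a defect of the stationary variational
  inequality, in the form required by \<open>almost_critical_subsequence\<close>.\<close>

lemma FVI_flow_good_times:
  assumes flow: "FVI_flow \<psi> u0 u"
  obtains w ud C where "continuous_on {0..} w" "has_weak_time_deriv (\<lambda>t. V_to_L2 (u t)) ud" "ud \<in> L2_time"
    "AE t in time_leb. w t = V_to_L2 (u t) \<and> u t \<in> admissible \<psi> \<and> norm (u t) \<le> C \<and>
      elastic_energy (u t) \<le> elastic_energy u0 \<and>
      (\<forall>v\<in>admissible \<psi>. energy_diff (u t) (v - u t) \<ge> - (norm (ud t) * norm (v - u t)))"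
proof -
  obtain C where C: "AE t in time_leb. norm (u t) \<le> C"
    using flow unfolding FVI_flow_def Linf_time_def by blast
  have adm: "AE t in time_leb. u t \<in> admissible \<psi>" using flow unfolding FVI_flow_def by blast
  obtain \<phi> where \<phi>: "antimono_on {0..} \<phi>" "\<phi> 0 = elastic_energy u0"
    "AE t in time_leb. elastic_energy (u t) = \<phi> t"
    using flow unfolding FVI_flow_def by blast
  obtain w where w: "continuous_on {0..} w" "AE t in time_leb. w t = V_to_L2 (u t)"
    using flow unfolding FVI_flow_def by blast
  obtain ud where ud: "has_weak_time_deriv (\<lambda>t. V_to_L2 (u t)) ud" "ud \<in> L2_time"
    "AE t in time_leb. \<forall>v\<in>admissible \<psi>.
        inner (ud t) (V_to_L2 (v - u t)) + energy_deriv (u t) (v - u t) \<ge> 0"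
    using flow unfolding FVI_flow_def by blast
  have pos: "AE t in time_leb. 0 < t" by (rule AE_I2) (simp add: space_restrict_space)
  have "AE t in time_leb. w t = V_to_L2 (u t) \<and> u t \<in> admissible \<psi> \<and> norm (u t) \<le> C \<and>
      elastic_energy (u t) \<le> elastic_energy u0 \<and>
      (\<forall>v\<in>admissible \<psi>. energy_diff (u t) (v - u t) \<ge> - (norm (ud t) * norm (v - u t)))"
    using C adm \<phi>(3) w(2) ud(3) pos
  proof eventually_elim
    case (elim t)
    have "\<phi> t \<le> \<phi> 0" using monotone_onD[OF \<phi>(1), of 0 t] elim(6) by simp
    moreover have "energy_diff (u t) (v - u t) \<ge> - (norm (ud t) * norm (v - u t))" if v: "v \<in> admissible \<psi>" for v
    proof -
      have "inner (ud t) (V_to_L2 (v - u t)) \<le> norm (ud t) * norm (V_to_L2 (v - u t))"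
        by (rule norm_cauchy_schwarz)
      also have "\<dots> \<le> norm (ud t) * norm (v - u t)"
        by (intro mult_left_mono norm_V_to_L2_le) simp
      finally show ?thesis using elim(5) v unfolding energy_deriv_eq by force
    qed
    ultimately show ?case using elim \<phi>(2) by simp
  qed
  then show thesis using that w(1) ud(1,2) by blast
qed

text \<open>The Hoelder ball is compact, so its image in L^2 is closed and the injection has a
  continuous inverse \<open>g\<close> there. The curve \<open>w\<close> meets the image at almost
  every time and hence, by continuity, stays in it at every time.\<close>

lemma continuous_C1_lift:
  assumes w: "continuous_on {0..} w" and ae: "AE t in time_leb. w t = V_to_L2 (u t) \<and> norm (u t) \<le> C"
  obtains g where "continuous_on (C1_to_L2 ` C1_holder_ball C) g"
    "\<And>y. y \<in> C1_to_L2 ` C1_holder_ball C \<Longrightarrow> C1_to_L2 (g y) = y"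
    "closed (C1_to_L2 ` C1_holder_ball C)"
    "\<And>t. 0 \<le> t \<Longrightarrow> w t \<in> C1_to_L2 ` C1_holder_ball C"
proof -
  let ?K = "C1_holder_ball C" and ?S = "C1_to_L2 ` C1_holder_ball C"
  have inj: "inj_on C1_to_L2 ?K" by (intro inj_onI inj_C1_to_L2)
  have cl: "closed ?S"
    by (intro compact_imp_closed compact_continuous_image continuous_on_C1_to_L2 compact_C1_holder_ball)
  have mem: "w t \<in> ?S" if t: "0 \<le> t" for t
  proof (rule ccontr)
    assume n: "w t \<notin> ?S"
    then obtain e where e: "e > 0" "ball (w t) e \<subseteq> - ?S"
      using cl open_contains_ball[of "- ?S"] unfolding closed_def by blast
    have "\<exists>d>0. \<forall>y\<in>{0..}. dist y t < d \<longrightarrow> dist (w y) (w t) < e"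
      using w t e(1) unfolding continuous_on_iff by auto
    then obtain d where d: "d > 0" "\<And>y. y \<in> {0..} \<Longrightarrow> dist y t < d \<Longrightarrow> dist (w y) (w t) < e" by blast
    \<comment> \<open>Only times to the right of t are used, so that t = 0 is included.\<close>
    have "\<exists>y\<in>{t<..<t + d}. w y = V_to_L2 (u y) \<and> norm (u y) \<le> C"
      by (rule AE_time_ex[OF ae t]) (use d in simp)
    then obtain y where y: "y \<in> {t<..<t + d}" "w y = V_to_L2 (u y)" "norm (u y) \<le> C" by blast
    have "w y \<in> ?S"
      using V_to_C1_holder[OF y(3)] y(2) C1_to_L2_V_to_C1[of "u y"] by (metis imageI)
    moreover have "w y \<in> ball (w t) e"
      using d(2)[of y] y(1) t by (auto simp: dist_commute dist_real_def)
    ultimately show False using e(2) by blast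
  qed
  show thesis
    by (rule that[OF continuous_on_inv_into[OF continuous_on_C1_to_L2 compact_C1_holder_ball inj]
          f_the_inv_into_f[OF inj] cl mem])
qed

theorem theorem2p11:
  fixes \<psi> :: "real \<Rightarrow> real" and u0 :: W22_W12_0 and u :: "real \<Rightarrow> W22_W12_0"
  assumes "obstacle \<psi>"
    and "u0 \<in> admissible \<psi>"
    and "elastic_energy u0 < c0\<^sup>2 / 4"
    and "FVI_flow \<psi> u0 u"
  shows "subconvergent {0..} (C1_rep u) {f. \<exists>m\<in>M_crit \<psi> u0. C1_to_L2 f = V_to_L2 m} \<and>
    (\<forall>\<epsilon>::real. \<epsilon> > 0 \<longrightarrow>
      (\<exists>B. B \<subseteq> {0..} \<and> B \<in> sets lebesgue \<and> emeasure lebesgue B < ennreal \<epsilon> \<and>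
        (\<exists>w :: real \<Rightarrow> W22.
          (\<forall>t\<in>{0..} - B. W22_to_L2 (w t) = C1_to_L2 (C1_rep u t)) \<and>
          subconvergent ({0..} - B) w (V_to_W22 ` M_crit \<psi> u0))))"
proof -
  obtain w ud C where w: "continuous_on {0..} w" and weak: "has_weak_time_deriv (\<lambda>t. V_to_L2 (u t)) ud"
    and ud: "ud \<in> L2_time"
    and good: "AE t in time_leb. w t = V_to_L2 (u t) \<and> u t \<in> admissible \<psi> \<and> norm (u t) \<le> C \<and>
      elastic_energy (u t) \<le> elastic_energy u0 \<and>
      (\<forall>v\<in>admissible \<psi>. energy_diff (u t) (v - u t) \<ge> - (norm (ud t) * norm (v - u t)))"
    by (rule FVI_flow_good_times[OF assms(4)])
  have wu: "AE t in time_leb. w t = V_to_L2 (u t)" using good by eventually_elim blast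
  have wC: "AE t in time_leb. w t = V_to_L2 (u t) \<and> norm (u t) \<le> C" using good by eventually_elim blast
  obtain g where g: "continuous_on (C1_to_L2 ` C1_holder_ball C) g"
    "\<And>y. y \<in> C1_to_L2 ` C1_holder_ball C \<Longrightarrow> C1_to_L2 (g y) = y"
    "closed (C1_to_L2 ` C1_holder_ball C)"
    "\<And>t. 0 \<le> t \<Longrightarrow> w t \<in> C1_to_L2 ` C1_holder_ball C"
    using continuous_C1_lift[OF w wC] by blast
  \<comment> \<open>The lifted curve is a continuous C^1 representative, and by uniqueness it is the
    one described by \<open>C1_rep\<close>.\<close>
  have "continuous_on {0..} (\<lambda>t. g (w t))"
    by (rule continuous_on_compose2[OF g(1) w]) (use g(4) in auto)
  moreover have "AE t in time_leb. C1_to_L2 (g (w t)) = V_to_L2 (u t)"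
  proof -
    have "AE t in time_leb. 0 < t" by (rule AE_I2) (simp add: space_restrict_space)
    with wu show ?thesis
    proof eventually_elim
      case (elim t)
      then show ?case using g(2)[OF g(4), of t] by simp
    qed
  qed
  ultimately have "is_C1_rep u (\<lambda>t. g (w t))" by (simp add: is_C1_rep_def)
  then have rep: "C1_rep u t = g (w t)" if "t \<ge> 0" for t using C1_rep_eq that by blast
  have um: "(\<lambda>t. V_to_L2 (u t)) \<in> borel_measurable time_leb"
  proof (rule measurable_compose[of u _ borel])
    show "u \<in> borel_measurable time_leb"
      using assms(4) unfolding FVI_flow_def Linf_time_def by blast
    show "(\<lambda>u. V_to_L2 u) \<in> borel_measurable borel"
      by (intro borel_measurable_continuous_onI linear_continuous_on bounded_linear_V_to_L2)
  qed
  have fm: "(\<lambda>t. norm (ud t)) \<in> borel_measurable time_leb" "integrable time_leb (\<lambda>t. (norm (ud t))\<^sup>2)"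
    using ud by (auto simp: L2_time_def)
  \<comment> \<open>The common source of both claims: \<epsilon> is arbitrary for the W^{2,2}
    statement and equal to 1 for the C^1 statement.\<close>
  have exceptional: "\<exists>B. B \<subseteq> {0..} \<and> B \<in> sets lebesgue \<and> emeasure lebesgue B < ennreal \<epsilon> \<and>
      (\<forall>t\<in>{0..} - B. w t = V_to_L2 (u t)) \<and>
      (\<forall>\<theta>. (\<forall>n. \<theta> n \<in> {0..} - B) \<and> filterlim \<theta> at_top sequentially \<longrightarrow>
        (\<exists>k m. strict_mono (k :: nat \<Rightarrow> nat) \<and> m \<in> M_crit \<psi> u0 \<and> (\<lambda>n. u (\<theta> (k n))) \<longlonglongrightarrow> m))"
    if \<epsilon>: "\<epsilon> > 0" for \<epsilon> :: real
  proof -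
    obtain B where B: "B \<subseteq> {0..}" "B \<in> sets lebesgue" "emeasure lebesgue B < ennreal \<epsilon>"
      "\<And>t. t \<in> {0..} - B \<Longrightarrow> 0 < t \<and> w t = V_to_L2 (u t) \<and> u t \<in> admissible \<psi> \<and> norm (u t) \<le> C \<and>
      elastic_energy (u t) \<le> elastic_energy u0 \<and>
      (\<forall>v\<in>admissible \<psi>. energy_diff (u t) (v - u t) \<ge> - (norm (ud t) * norm (v - u t)))"
      "\<And>\<theta> :: nat \<Rightarrow> real. (\<And>n. \<theta> n \<in> {0..} - B) \<Longrightarrow> filterlim \<theta> at_top sequentially \<Longrightarrow>
        (\<lambda>n. norm (ud (\<theta> n))) \<longlonglongrightarrow> 0"
      using small_exceptional_set[OF fm norm_ge_zero good \<epsilon>] by blast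
    have "\<exists>k m. strict_mono (k :: nat \<Rightarrow> nat) \<and> m \<in> M_crit \<psi> u0 \<and> (\<lambda>n. u (\<theta> (k n))) \<longlonglongrightarrow> m"
      if \<theta>: "\<And>n. \<theta> n \<in> {0..} - B" "filterlim \<theta> at_top sequentially" for \<theta>
    proof -
      \<comment> \<open>The defects are the norms of the time derivative, which tend to 0 along
        times outside \<open>B\<close>.\<close>
      obtain k m where k: "strict_mono (k :: nat \<Rightarrow> nat)" and m: "(\<lambda>n. u (\<theta> (k n))) \<longlonglongrightarrow> m" "m \<in> admissible \<psi>"
        "\<And>v. v \<in> admissible \<psi> \<Longrightarrow> energy_diff m (v - m) \<ge> 0"
        using almost_critical_subsequence[of "\<lambda>n. u (\<theta> n)" \<psi> C "\<lambda>n. norm (ud (\<theta> n))"] B(4)[OF \<theta>(1)] B(5)[OF \<theta>]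
        by blast
      have "(\<lambda>n. elastic_energy (u (\<theta> (k n)))) \<longlonglongrightarrow> elastic_energy m"
        by (rule isCont_tendsto_compose[OF isCont_elastic_energy m(1)])
      then have "elastic_energy m \<le> elastic_energy u0"
        by (rule LIMSEQ_le_const2) (use B(4)[OF \<theta>(1)] in auto)
      then have "m \<in> M_crit \<psi> u0" using m by (simp add: M_crit_def energy_deriv_eq)
      then show ?thesis using k m(1) by blast
    qed
    then show ?thesis using B(1-4) by (intro exI[of _ B]) blast
  qed
  show ?thesis
  proof (intro conjI allI impI)
    obtain B where B: "B \<in> sets lebesgue" "emeasure lebesgue B < ennreal 1"
      "\<And>t. t \<in> {0..} - B \<Longrightarrow> w t = V_to_L2 (u t)"
      "\<And>\<theta>. (\<And>n. \<theta> n \<in> {0..} - B) \<Longrightarrow> filterlim \<theta> at_top sequentially \<Longrightarrow>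
        \<exists>k m. strict_mono (k :: nat \<Rightarrow> nat) \<and> m \<in> M_crit \<psi> u0 \<and> (\<lambda>n. u (\<theta> (k n))) \<longlonglongrightarrow> m"
      using exceptional[of 1] by auto
    \<comment> \<open>A set of measure less than 1 cannot contain an interval of length 1; this is
      the reason for choosing \<epsilon> = 1.\<close>
    have ex: "\<exists>t. t \<notin> B \<and> a < t \<and> t \<le> a + 1" for a :: real
    proof (rule ccontr)
      assume "\<nexists>t. t \<notin> B \<and> a < t \<and> t \<le> a + 1"
      then have "{a<..a + 1} \<subseteq> B" by auto
      then have "emeasure lebesgue {a<..a + 1} \<le> emeasure lebesgue B" using B(1) by (rule emeasure_mono)
      then show False using B(2) by simp
    qed
    show "subconvergent {0..} (C1_rep u) {f. \<exists>m\<in>M_crit \<psi> u0. C1_to_L2 f = V_to_L2 m}"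
      unfolding subconvergent_def
    proof (intro conjI allI impI)
      show "\<not> bounded {0::real..}" using not_bounded_time_minus_small[of "{}"] by simp
      fix \<theta> :: "nat \<Rightarrow> real" assume "(\<forall>n. \<theta> n \<in> {0..}) \<and> filterlim \<theta> at_top sequentially"
      then have \<theta>: "\<And>n. 0 \<le> \<theta> n" "filterlim \<theta> at_top sequentially" by auto
      obtain t where t: "\<And>n. t n \<notin> B" "\<And>n. \<theta> n < t n" "\<And>n. t n \<le> \<theta> n + 1"
        using ex[of "\<theta> _"] by metis
      have tB: "t n \<in> {0..} - B" for n using t(1,2)[of n] \<theta>(1)[of n] by auto
      have "filterlim t at_top sequentially"
        by (rule filterlim_at_top_mono[OF \<theta>(2)]) (use t(2) in \<open>auto intro: less_imp_le always_eventually\<close>)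
      then obtain k m where k: "strict_mono (k :: nat \<Rightarrow> nat)" and m: "m \<in> M_crit \<psi> u0" "(\<lambda>n. u (t (k n))) \<longlonglongrightarrow> m"
        using B(4)[of t, OF tB] by blast
      have "(\<lambda>n. w (t (k n))) \<longlonglongrightarrow> V_to_L2 m"
        using bounded_linear.tendsto[OF bounded_linear_V_to_L2 m(2)] by (simp add: B(3)[OF tB])
      moreover have "(\<lambda>n. w (t (k n)) - w (\<theta> (k n))) \<longlonglongrightarrow> 0"
        using LIMSEQ_subseq_LIMSEQ[OF tendsto_time_increment[OF weak um ud w wu \<theta>(2) t(2,3)] k]
        by (simp add: comp_def)
      ultimately have "(\<lambda>n. w (t (k n)) - (w (t (k n)) - w (\<theta> (k n)))) \<longlonglongrightarrow> V_to_L2 m - 0"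
        by (rule tendsto_diff)
      then have wm: "(\<lambda>n. w (\<theta> (k n))) \<longlonglongrightarrow> V_to_L2 m" by simp
      \<comment> \<open>The limit has to lie in the closed image of the Hoelder ball for
        \<open>g\<close> to be continuous there and to turn convergence in L^2 into convergence in
        C^1.\<close>
      have mS: "V_to_L2 m \<in> C1_to_L2 ` C1_holder_ball C"
        by (rule closed_sequentially[OF g(3) _ wm]) (rule g(4)[OF \<theta>(1)])
      have "(\<lambda>n. g (w (\<theta> (k n)))) \<longlonglongrightarrow> g (V_to_L2 m)"
        by (rule continuous_on_tendsto_compose[OF g(1) wm mS]) (simp add: g(4) \<theta>(1))
      then have "(\<lambda>n. C1_rep u (\<theta> (k n))) \<longlonglongrightarrow> g (V_to_L2 m)" by (simp add: rep \<theta>(1))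
      then show "\<exists>k. strict_mono k \<and> (\<exists>f\<in>{f. \<exists>m\<in>M_crit \<psi> u0. C1_to_L2 f = V_to_L2 m}.
          (\<lambda>n. C1_rep u (\<theta> (k n))) \<longlonglongrightarrow> f)"
        using k m(1) g(2)[OF mS] by blast
    qed simp
  next
    fix \<epsilon> :: real assume "\<epsilon> > 0"
    from exceptional[OF this] obtain B where B: "B \<subseteq> {0..}" "B \<in> sets lebesgue" "emeasure lebesgue B < ennreal \<epsilon>"
      "\<forall>t\<in>{0..} - B. w t = V_to_L2 (u t)"
      "\<forall>\<theta>. (\<forall>n. \<theta> n \<in> {0..} - B) \<and> filterlim \<theta> at_top sequentially \<longrightarrow>
        (\<exists>k m. strict_mono (k :: nat \<Rightarrow> nat) \<and> m \<in> M_crit \<psi> u0 \<and> (\<lambda>n. u (\<theta> (k n))) \<longlonglongrightarrow> m)"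
      by (elim exE conjE)
    have eq: "V_to_L2 (u t) = C1_to_L2 (C1_rep u t)" if "t \<in> {0..} - B" for t
      using that bspec[OF B(4) that] g(2)[OF g(4), of t] by (simp add: rep)
    \<comment> \<open>The given representative \<open>u\<close> itself is the W^{2,2} curve: off
      \<open>B\<close> it agrees with the C^1 representative at each time, not just at almost every
      one.\<close>
    have "subconvergent ({0..} - B) (\<lambda>t. V_to_W22 (u t)) (V_to_W22 ` M_crit \<psi> u0)"
      unfolding subconvergent_def
    proof (intro conjI allI impI)
      show "\<not> bounded ({0..} - B)"
        using B(2) less_trans[OF B(3) ennreal_less_top] by (intro not_bounded_time_minus_small) auto
      fix \<theta> :: "nat \<Rightarrow> real" assume "(\<forall>n. \<theta> n \<in> {0..} - B) \<and> filterlim \<theta> at_top sequentially"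
      from B(5)[rule_format, OF this] obtain k m where "strict_mono (k :: nat \<Rightarrow> nat)" "m \<in> M_crit \<psi> u0" "(\<lambda>n. u (\<theta> (k n))) \<longlonglongrightarrow> m"
        by blast
      then show "\<exists>k. strict_mono k \<and> (\<exists>m\<in>V_to_W22 ` M_crit \<psi> u0. (\<lambda>n. V_to_W22 (u (\<theta> (k n)))) \<longlonglongrightarrow> m)"
        using bounded_linear.tendsto[OF bounded_linear_V_to_W22] by blast
    qed auto
    with B(1-3) eq show "\<exists>B. B \<subseteq> {0..} \<and> B \<in> sets lebesgue \<and> emeasure lebesgue B < ennreal \<epsilon> \<and>
        (\<exists>w :: real \<Rightarrow> W22.
          (\<forall>t\<in>{0..} - B. W22_to_L2 (w t) = C1_to_L2 (C1_rep u t)) \<and>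
          subconvergent ({0..} - B) w (V_to_W22 ` M_crit \<psi> u0))"
      by (intro exI[of _ B] conjI exI[of _ "\<lambda>t. V_to_W22 (u t)"]) auto
  qed
qed

end
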